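(* There is a randomized $\tilde{O}(m\sqrt{n})$ time algorithm that, given an undirected unweighted graph $G=(V,E)$ with $n$ vertices and $m$ edges and $S\subseteq V$ with $T=V\setminus S$, outputs an estimate $R'_{ST}$ such that, with high probability, $R_{ST}\leq R'_{ST}\leq \tfrac{5}{3}R_{ST}+\tfrac{5}{3}$; and if $R_{ST}$ is divisible by $3$, then $R_{ST}\leq R'_{ST}\leq \tfrac{5}{3}R_{ST}+1$.
   Context: $d(u,v)$ denotes the shortest path distance in $G$. For $v\in S$, $\varepsilon_{ST}(v)=\max_{u\in T}d(v,u)$, and the $ST$-Radius is $R_{ST}=\min_{v\in S}\varepsilon_{ST}(v)$. "With high probability" means with probability at least $1-1/n^c$ for every constant $c$. $\tilde{O}$ hides polylogarithmic factors.
   Formalization: The running time proved is Õ(n + m√n) instead of Õ(m√n); the two agree when m ≥ √n (e.g. connected graphs), and for fewer edges the stated bound fails because reading S alone takes time of order n. *)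

theory Defs
  imports "HOL-Probability.Probability" "HOL-Library.Log_Nat" "Graph_Theory.Graph_Theory"
begin

section \<open>Distances and the ST-radius\<close>

text \<open>
  An undirected simple graph is a finite loop-free symmetric digraph (\<^locale>\<open>pair_graph\<close>);
  every undirected edge is therefore counted by two arcs. Distances are values of \<^typ>\<open>ereal\<close>,
  and are infinite between different connected components.
\<close>

definition num_verts :: "'a pair_pre_digraph \<Rightarrow> nat" where
  "num_verts G = card (pverts G)"

definition num_edges :: "'a pair_pre_digraph \<Rightarrow> nat" where
  "num_edges G = card (parcs G) div 2"

definition gdist :: "'a pair_pre_digraph \<Rightarrow> 'a \<Rightarrow> 'a \<Rightarrow> ereal" where
  "gdist G u v = wf_digraph.\<mu> (with_proj G) (\<lambda>_. 1) u v"

definition ST_ecc :: "'a pair_pre_digraph \<Rightarrow> 'a set \<Rightarrow> 'a \<Rightarrow> ereal" where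
  "ST_ecc G T v = Max (gdist G v ` T)"

definition ST_radius :: "'a pair_pre_digraph \<Rightarrow> 'a set \<Rightarrow> 'a set \<Rightarrow> ereal" where
  "ST_radius G S T = Min (ST_ecc G T ` S)"


section \<open>A randomized RAM with logarithmic cost\<close>

text \<open>
  Programs are finite texts of a structured RAM language with finitely many named registers
  and unbounded arrays of natural numbers. Every operation is charged the bit length of the
  numbers it handles, so that large numbers cannot be used to hide work; on numbers
  polynomial in the input size this differs from the unit-cost word RAM only
  by a logarithmic factor.
\<close>

record store =
  reg :: "string \<Rightarrow> nat"
  arr :: "string \<Rightarrow> nat \<Rightarrow> nat"

datatype aexp =
    N nat
  | V string
  | Get string aexp
  | Plus aexp aexp
  | Minus aexp aexp
  | Times aexp aexp
  | Div aexp aexp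

datatype bexp =
    Less aexp aexp
  | Equal aexp aexp
  | Not bexp
  | And bexp bexp

datatype com =
    Skip
  | Assign string aexp
  | Put string aexp aexp
  | Rand string aexp
  | Seq com com
  | If bexp com com
  | While bexp com

primrec aval :: "aexp \<Rightarrow> store \<Rightarrow> nat" where
  "aval (N k) s = k"
| "aval (V x) s = reg s x"
| "aval (Get a e) s = arr s a (aval e s)"
| "aval (Plus e1 e2) s = aval e1 s + aval e2 s"
| "aval (Minus e1 e2) s = aval e1 s - aval e2 s"
| "aval (Times e1 e2) s = aval e1 s * aval e2 s"
| "aval (Div e1 e2) s = aval e1 s div aval e2 s"

primrec bval :: "bexp \<Rightarrow> store \<Rightarrow> bool" where
  "bval (Less e1 e2) s \<longleftrightarrow> aval e1 s < aval e2 s"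
| "bval (Equal e1 e2) s \<longleftrightarrow> aval e1 s = aval e2 s"
| "bval (Not b) s \<longleftrightarrow> \<not> bval b s"
| "bval (And b1 b2) s \<longleftrightarrow> bval b1 s \<and> bval b2 s"

text \<open>\<open>floorlog 2 k\<close> is the number of binary digits of \<open>k\<close> (and 0 for \<open>k = 0\<close>).\<close>

definition word_cost :: "nat \<Rightarrow> nat" where
  "word_cost k = 1 + floorlog 2 k"

text \<open>Each node of an expression is charged for its own value; thus operands and array
  indices are charged at the corresponding subexpressions.\<close>

primrec acost :: "aexp \<Rightarrow> store \<Rightarrow> nat" where
  "acost (N k) s = word_cost k"
| "acost (V x) s = word_cost (reg s x)"
| "acost (Get a e) s = acost e s + word_cost (aval (Get a e) s)"
| "acost (Plus e1 e2) s = acost e1 s + acost e2 s + word_cost (aval (Plus e1 e2) s)"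
| "acost (Minus e1 e2) s = acost e1 s + acost e2 s + word_cost (aval (Minus e1 e2) s)"
| "acost (Times e1 e2) s = acost e1 s + acost e2 s + word_cost (aval (Times e1 e2) s)"
| "acost (Div e1 e2) s = acost e1 s + acost e2 s + word_cost (aval (Div e1 e2) s)"

primrec bcost :: "bexp \<Rightarrow> store \<Rightarrow> nat" where
  "bcost (Less e1 e2) s = 1 + acost e1 s + acost e2 s"
| "bcost (Equal e1 e2) s = 1 + acost e1 s + acost e2 s"
| "bcost (Not b) s = 1 + bcost b s"
| "bcost (And b1 b2) s = 1 + bcost b1 s + bcost b2 s"

definition charge :: "nat \<Rightarrow> (store \<times> nat) option pmf \<Rightarrow> (store \<times> nat) option pmf" where
  "charge t = map_pmf (map_option (\<lambda>(s, t'). (s, t + t')))"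

text \<open>
  \<open>run f c s\<close> is the distribution of the pair of final store and running time. The first
  argument only bounds the depth of the recursion; \<^const>\<open>None\<close> means that it was exhausted.
  \<open>Rand x e\<close> draws a fresh uniform element of \<open>{0..<k}\<close>, where \<open>k\<close> is the value of \<open>e\<close>
  (and yields 0 if \<open>k = 0\<close>).
\<close>

fun run :: "nat \<Rightarrow> com \<Rightarrow> store \<Rightarrow> (store \<times> nat) option pmf" where
  "run 0 c s = return_pmf None"
| "run (Suc f) Skip s = return_pmf (Some (s, 1))"
| "run (Suc f) (Assign x e) s =
     return_pmf (Some (s\<lparr>reg := (reg s)(x := aval e s)\<rparr>, 1 + acost e s))"
| "run (Suc f) (Put a i e) s =
     return_pmf (Some (s\<lparr>arr := (arr s)(a := (arr s a)(aval i s := aval e s))\<rparr>,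
                       1 + acost i s + acost e s))"
| "run (Suc f) (Rand x e) s =
     map_pmf (\<lambda>k. Some (s\<lparr>reg := (reg s)(x := k)\<rparr>, 1 + acost e s))
       (pmf_of_set {0..<max 1 (aval e s)})"
| "run (Suc f) (Seq c1 c2) s =
     bind_pmf (run f c1 s)
       (\<lambda>r. case r of None \<Rightarrow> return_pmf None | Some (s', t) \<Rightarrow> charge t (run f c2 s'))"
| "run (Suc f) (If b c1 c2) s =
     charge (1 + bcost b s) (if bval b s then run f c1 s else run f c2 s)"
| "run (Suc f) (While b c) s =
     charge (1 + bcost b s)
       (if bval b s then run f (Seq c (While b c)) s else return_pmf (Some (s, 0)))"

text \<open>
  \<open>halts_with c s p\<close>: started in \<open>s\<close>, the program \<open>c\<close> halts on all random choices (within a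
  common recursion depth), and \<open>p\<close> is the joint distribution of final store and running time.
\<close>

definition halts_with :: "com \<Rightarrow> store \<Rightarrow> (store \<times> nat) pmf \<Rightarrow> bool" where
  "halts_with c s p \<longleftrightarrow> (\<exists>f. run f c s = map_pmf Some p)"

lemma None_in_charge [simp]: "None \<in> set_pmf (charge t p) \<longleftrightarrow> None \<in> set_pmf p"
  by (auto simp: charge_def image_iff)

lemma run_Suc_eq:
  "None \<notin> set_pmf (run f c s) \<Longrightarrow> run (Suc f) c s = run f c s"
proof (induction f arbitrary: c s)
  case 0
  then show ?case by simp
next
  case (Suc f)
  show ?case
  proof (cases c)
    case (Seq c1 c2)
    have 1: "None \<notin> set_pmf (run f c1 s)"
      using Suc.prems Seq by (force split: option.splits)
    have 2: "None \<notin> set_pmf (run f c2 s')" if "Some (s', t) \<in> set_pmf (run f c1 s)" for s' t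
      using Suc.prems Seq that by (force split: option.splits)
    have "run (Suc (Suc f)) c s = bind_pmf (run f c1 s)
       (\<lambda>r. case r of None \<Rightarrow> return_pmf None | Some (s', t) \<Rightarrow> charge t (run (Suc f) c2 s'))"
      using Suc.IH[OF 1] Seq by simp
    also have "\<dots> = run (Suc f) c s"
      unfolding Seq run.simps
      by (intro bind_pmf_cong refl) (use Suc.IH 2 in \<open>auto split: option.splits\<close>)
    finally show ?thesis .
  next
    case (If b c1 c2)
    then show ?thesis
      using Suc.prems Suc.IH[of c1 s] Suc.IH[of c2 s] by (cases "bval b s") simp_all
  next
    case (While b c1)
    then show ?thesis
      using Suc.prems Suc.IH[of "Seq c1 (While b c1)" s]
      by (cases "bval b s") (simp_all del: run.simps(6))
  qed simp_all
qed

lemma halts_with_unique: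
  assumes "halts_with c s p" and "halts_with c s q"
  shows "p = q"
proof -
  have *: "run (f + d) c s = map_pmf Some p'" if "run f c s = map_pmf Some p'" for f d p'
  proof (induction d)
    case (Suc d)
    then have "None \<notin> set_pmf (run (f + d) c s)" by auto
    from run_Suc_eq[OF this] Suc show ?case by simp
  qed (use that in simp)
  obtain f g where "run f c s = map_pmf Some p" "run g c s = map_pmf Some q"
    using assms by (auto simp: halts_with_def)
  then have "map_pmf Some p = map_pmf Some q"
    using *[of f p g] *[of g q f] by (simp add: add.commute)
  then show ?thesis
    by (rule injD[OF pmf.inj_map, rotated]) simp
qed


section \<open>Input and output\<close>

text \<open>
  The vertices are numbered \<open>0, \<dots>, n - 1\<close>. The graph is given by adjacency lists stored
  consecutively, in any order, in the array \<open>adj\<close>: the neighbours of \<open>v\<close> occupy the cells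
  \<open>off v, \<dots>, off (v + 1) - 1\<close>.
\<close>

definition adjacency_lists ::
  "nat pair_pre_digraph \<Rightarrow> (nat \<Rightarrow> nat) \<Rightarrow> (nat \<Rightarrow> nat) \<Rightarrow> bool" where
  "adjacency_lists G off adj \<longleftrightarrow>
     off 0 = 0 \<and>
     (\<forall>v\<in>pverts G. off v \<le> off (Suc v) \<and>
        bij_betw adj {off v..<off (Suc v)} {u. (v, u) \<in> parcs G})"

text \<open>All cells outside the input are 0. The register \<open>c\<close> holds the confidence parameter,
  i.e.\ the exponent in the admissible error probability.\<close>

definition input_store ::
  "nat \<Rightarrow> nat pair_pre_digraph \<Rightarrow> nat set \<Rightarrow> (nat \<Rightarrow> nat) \<Rightarrow> (nat \<Rightarrow> nat) \<Rightarrow> store" where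
  "input_store c G S off adj =
     \<lparr>reg = (\<lambda>_. 0)(''n'' := num_verts G, ''m'' := num_edges G, ''c'' := c),
      arr = (\<lambda>_ _. 0)(''S'' := \<lambda>i. of_bool (i \<in> S),
                      ''off'' := \<lambda>i. if i \<le> num_verts G then off i else 0,
                      ''adj'' := \<lambda>i. if i < 2 * num_edges G then adj i else 0)\<rparr>"

text \<open>The flag \<open>inf\<close> is needed because the ST-radius of a disconnected graph can be infinite.\<close>

definition estimate :: "store \<Rightarrow> ereal" where
  "estimate s = (if reg s ''inf'' = 0 then ereal (real (reg s ''out'')) else \<infinity>)"

text \<open>
  The summand \<open>n\<close> pays for reading \<open>S\<close>. It matters only for graphs
  with fewer than \<open>sqrt n\<close> edges: otherwise \<open>n \<le> m * sqrt n\<close>, and in particular the bound is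
  \<open>O(m * sqrt n)\<close> up to the logarithmic factor on all connected graphs with at least two
  vertices.
\<close>

definition time_bound :: "real \<Rightarrow> nat \<Rightarrow> nat pair_pre_digraph \<Rightarrow> real" where
  "time_bound C k G =
     (let n = real (num_verts G); m = real (num_edges G)
      in C * (n + m * sqrt n) * log 2 n ^ k)"

end

theory Submission
  imports Defs "HOL-Library.Sublist"
begin

text \<open>
  Let \<open>c\<close> be a centre and \<open>R\<close> the radius. A vertex of \<open>S\<close> at distance at most \<open>L \<approx> 2R/3\<close> from \<open>c\<close>
  is a good enough answer. Start with the set \<open>W\<close> of all vertices of \<open>T\<close> in a random sample of about
  \<open>sqrt n * log n\<close> vertices and enlarge it greedily: choose \<open>s\<close> in \<open>S\<close> with minimal maximal
  distance to \<open>W\<close>, and add to \<open>W\<close> a vertex \<open>w\<close> of \<open>T\<close> farthest from \<open>s\<close>. Since \<open>s\<close> has distance at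
  most \<open>R\<close> to \<open>W\<close>, it can be a bad answer only if \<open>w\<close> has distance more than \<open>L\<close> from \<open>W\<close>. After
  \<open>q \<approx> sqrt n\<close> bad rounds the balls of radius \<open>R/3\<close> around the new vertices are disjoint, so one
  of them, around \<open>b\<close> say, has at most \<open>q\<close> vertices; and the ball of radius \<open>L\<close> around \<open>b\<close> has
  fewer than \<open>q\<close> vertices of \<open>T\<close>, as it would otherwise contain a sampled one.

  Now follow a shortest path from \<open>b\<close> to \<open>c\<close>. If its vertex at distance \<open>R/3\<close> from \<open>b\<close> is in \<open>S\<close>,
  it is a good answer and one of the \<open>q\<close> vertices of \<open>S\<close> nearest to \<open>b\<close>. Otherwise consider the last
  vertex \<open>y\<close> of \<open>T\<close> on the path up to distance \<open>L\<close>. It is one of the \<open>q\<close> vertices of \<open>T\<close> nearest to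
  \<open>b\<close>, and it has a neighbour in \<open>S\<close> or is within \<open>R/3\<close> of \<open>c\<close>; in both cases the vertex of \<open>S\<close> nearest to
  \<open>y\<close> is a good answer.

  Isolated vertices are put aside first, so that a breadth-first search takes time linear in the
  number of edges. All samples are the digits of a single random number below \<open>n ^ K\<close>; the rest
  of the program is deterministic.
\<close>

section \<open>Deterministic runs\<close>

lemma run_mono:
  assumes "run f c s = map_pmf Some p" "f \<le> g"
  shows "run g c s = map_pmf Some p"
  using assms(2)
proof (induction g rule: dec_induct)
  case (step g)
  then have "None \<notin> set_pmf (run g c s)" by auto
  from run_Suc_eq[OF this] step show ?case by simp
qed (use assms in simp)

definition exec :: "com \<Rightarrow> store \<Rightarrow> store \<Rightarrow> nat \<Rightarrow> bool" where
  "exec c s s' t \<longleftrightarrow> (\<exists>f. run f c s = return_pmf (Some (s', t)))"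

lemma run_mono_det:
  assumes "run f c s = return_pmf (Some r)" "f \<le> g"
  shows "run g c s = return_pmf (Some r)"
  using run_mono[of f c s "return_pmf r" g] assms by simp

lemma charge_return [simp]:
  "charge t (return_pmf (Some (s, t'))) = return_pmf (Some (s, t + t'))"
  by (simp add: charge_def)

lemma exec_Skip: "exec Skip s s 1"
  unfolding exec_def by (rule exI[of _ 1]) simp

lemma exec_Assign: "exec (Assign x e) s (s\<lparr>reg := (reg s)(x := aval e s)\<rparr>) (1 + acost e s)"
  unfolding exec_def by (rule exI[of _ 1]) simp

lemma exec_Put:
  "exec (Put a i e) s (s\<lparr>arr := (arr s)(a := (arr s a)(aval i s := aval e s))\<rparr>)
     (1 + acost i s + acost e s)"
  unfolding exec_def by (rule exI[of _ 1]) simp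

lemma exec_Seq:
  assumes "exec c1 s s1 t1" "exec c2 s1 s2 t2"
  shows "exec (Seq c1 c2) s s2 (t1 + t2)"
proof -
  obtain f g where fg: "run f c1 s = return_pmf (Some (s1, t1))"
    "run g c2 s1 = return_pmf (Some (s2, t2))"
    using assms by (auto simp: exec_def)
  have "run (Suc (max f g)) (Seq c1 c2) s = return_pmf (Some (s2, t1 + t2))"
    using run_mono_det[OF fg(1), of "max f g"] run_mono_det[OF fg(2), of "max f g"]
    by (simp add: bind_return_pmf)
  then show ?thesis unfolding exec_def by blast
qed

lemma exec_If:
  assumes "exec (if bval b s then c1 else c2) s s' t"
  shows "exec (If b c1 c2) s s' (1 + bcost b s + t)"
proof -
  obtain f where "run f (if bval b s then c1 else c2) s = return_pmf (Some (s', t))"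
    using assms by (auto simp: exec_def)
  then have "run (Suc f) (If b c1 c2) s = return_pmf (Some (s', 1 + bcost b s + t))"
    by (auto split: if_splits)
  then show ?thesis unfolding exec_def by blast
qed

lemma exec_While_False: "\<not> bval b s \<Longrightarrow> exec (While b c) s s (1 + bcost b s)"
  unfolding exec_def by (rule exI[of _ 1]) simp

lemma exec_While_True:
  assumes "bval b s" "exec c s s1 t1" "exec (While b c) s1 s2 t2"
  shows "exec (While b c) s s2 (1 + bcost b s + t1 + t2)"
proof -
  obtain f where "run f (Seq c (While b c)) s = return_pmf (Some (s2, t1 + t2))"
    using exec_Seq[OF assms(2,3)] by (auto simp: exec_def)
  then have "run (Suc f) (While b c) s = return_pmf (Some (s2, 1 + bcost b s + t1 + t2))"
    using assms(1) by (simp add: add_ac)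
  then show ?thesis unfolding exec_def by blast
qed

primrec wreg :: "com \<Rightarrow> string set" where
  "wreg Skip = {}"
| "wreg (Assign x e) = {x}"
| "wreg (Put a i e) = {}"
| "wreg (Rand x e) = {x}"
| "wreg (Seq c1 c2) = wreg c1 \<union> wreg c2"
| "wreg (If b c1 c2) = wreg c1 \<union> wreg c2"
| "wreg (While b c) = wreg c"

primrec warr :: "com \<Rightarrow> string set" where
  "warr Skip = {}"
| "warr (Assign x e) = {}"
| "warr (Put a i e) = {a}"
| "warr (Rand x e) = {}"
| "warr (Seq c1 c2) = warr c1 \<union> warr c2"
| "warr (If b c1 c2) = warr c1 \<union> warr c2"
| "warr (While b c) = warr c"

definition frame :: "com \<Rightarrow> store \<Rightarrow> store \<Rightarrow> bool" where
  "frame c s s' \<longleftrightarrow> (\<forall>x. x \<notin> wreg c \<longrightarrow> reg s' x = reg s x) \<and>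
     (\<forall>a. a \<notin> warr c \<longrightarrow> arr s' a = arr s a)"

lemma charge_SomeD:
  "Some (s', t) \<in> set_pmf (charge k p) \<Longrightarrow> \<exists>t'. Some (s', t') \<in> set_pmf p"
  by (auto simp: charge_def map_option_case split: option.splits)

lemma run_frame: "Some (s', t) \<in> set_pmf (run f c s) \<Longrightarrow> frame c s s'"
proof (induction f c s arbitrary: s' t rule: run.induct)
  case (6 f c1 c2 s)
  then obtain s1 t1 where 1: "Some (s1, t1) \<in> set_pmf (run f c1 s)"
    and 2: "Some (s', t) \<in> set_pmf (charge t1 (run f c2 s1))"
    by (auto split: option.splits)
  obtain t2 where 3: "Some (s', t2) \<in> set_pmf (run f c2 s1)"
    using charge_SomeD[OF 2] by blast
  from 6(1)[OF 1] 6(2)[OF 1 refl refl 3] show ?case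
    by (auto simp: frame_def)
next
  case (7 f b c1 c2 s)
  obtain t2 where "Some (s', t2) \<in> set_pmf (if bval b s then run f c1 s else run f c2 s)"
    using charge_SomeD[OF 7(3)[unfolded run.simps]] by blast
  with 7(1,2) show ?case
    by (fastforce simp: frame_def split: if_splits)
next
  case (8 f b c s)
  obtain t2 where "Some (s', t2) \<in> set_pmf
     (if bval b s then run f (Seq c (While b c)) s else return_pmf (Some (s, 0)))"
    using charge_SomeD[OF 8(2)[unfolded run.simps]] by blast
  with 8(1) show ?case
    by (fastforce simp: frame_def split: if_splits)
qed (auto simp: frame_def)

lemma exec_frame: "exec c s s' t \<Longrightarrow> frame c s s'"
  unfolding exec_def by (metis run_frame set_return_pmf insertI1)

section \<open>A Hoare logic with time bounds\<close>

text \<open>The size of constants above 4 is chosen so large that the bounds below exclude them.\<close>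

primrec asz :: "aexp \<Rightarrow> nat" where
  "asz (N k) = (if k \<le> 4 then 1 else 100)"
| "asz (V x) = 1"
| "asz (Get a e) = 1 + asz e"
| "asz (Plus e1 e2) = asz e1 + asz e2 + 1"
| "asz (Minus e1 e2) = asz e1 + asz e2 + 1"
| "asz (Times e1 e2) = asz e1 + asz e2 + 1"
| "asz (Div e1 e2) = asz e1 + asz e2 + 1"

primrec bsz :: "bexp \<Rightarrow> nat" where
  "bsz (Less e1 e2) = 1 + asz e1 + asz e2"
| "bsz (Equal e1 e2) = 1 + asz e1 + asz e2"
| "bsz (Not b) = 1 + bsz b"
| "bsz (And b1 b2) = 1 + bsz b1 + bsz b2"

definition bnd :: "nat \<Rightarrow> store \<Rightarrow> bool" where
  "bnd M s \<longleftrightarrow> 4 \<le> M \<and> (\<forall>x. reg s x \<le> M) \<and> (\<forall>a i. arr s a i \<le> M)"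

lemma asz_pos: "1 \<le> asz e"
  by (induction e) auto

lemma aval_le:
  assumes "bnd M s" "asz e \<le> 50"
  shows "aval e s \<le> M ^ asz e"
  using assms(2)
proof (induction e)
  have M: "4 \<le> M" using assms(1) by (auto simp: bnd_def)
  have mono: "M ^ i \<le> M ^ j" if "i \<le> j" for i j using M that by (intro power_increasing) auto
  {
    case (N k)
    then show ?case using M by (auto split: if_splits)
  next
    case (V x)
    then show ?case using assms(1) by (auto simp: bnd_def)
  next
    case (Get a e)
    have "arr s a (aval e s) \<le> M ^ 1" using assms(1) by (simp add: bnd_def)
    also have "\<dots> \<le> M ^ asz (Get a e)" by (rule mono) simp
    finally show ?case by simp
  next
    case (Plus e1 e2)
    then have "aval e1 s \<le> M ^ (asz e1 + asz e2)" "aval e2 s \<le> M ^ (asz e1 + asz e2)"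
      using mono[of "asz e1" "asz e1 + asz e2"] mono[of "asz e2" "asz e1 + asz e2"] by auto
    then have "aval (Plus e1 e2) s \<le> 2 * M ^ (asz e1 + asz e2)" by simp
    also have "\<dots> \<le> M * M ^ (asz e1 + asz e2)" using M by (intro mult_right_mono) auto
    finally show ?case by simp
  next
    case (Minus e1 e2)
    then have "aval (Minus e1 e2) s \<le> M ^ asz e1" by auto
    also have "\<dots> \<le> M ^ asz (Minus e1 e2)" by (rule mono) simp
    finally show ?case .
  next
    case (Times e1 e2)
    then have "aval e1 s * aval e2 s \<le> M ^ asz e1 * M ^ asz e2" by (intro mult_mono) auto
    also have "\<dots> = M ^ (asz e1 + asz e2)" by (simp add: power_add)
    also have "\<dots> \<le> M ^ asz (Times e1 e2)" by (rule mono) simp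
    finally show ?case by simp
  next
    case (Div e1 e2)
    have "aval (Div e1 e2) s \<le> aval e1 s" by (simp add: div_le_dividend)
    also have "\<dots> \<le> M ^ asz e1" using Div by auto
    also have "\<dots> \<le> M ^ asz (Div e1 e2)" by (rule mono) simp
    finally show ?case .
  }
qed

lemma floorlog_le_of_less: "x < 2 ^ k \<Longrightarrow> floorlog 2 x \<le> k"
  by (rule floorlog_leI) auto

lemma word_cost_power:
  assumes "x \<le> M ^ k" "1 \<le> k"
  shows "word_cost x \<le> k * word_cost M"
proof -
  have "M < 2 ^ floorlog 2 M" using floorlog_bounds[of M 2] by (cases "M = 0") (auto simp: floorlog_def)
  then have "M ^ k < (2 ^ floorlog 2 M) ^ k" using assms(2) by (intro power_strict_mono) auto
  then have "x < 2 ^ (floorlog 2 M * k)" using assms(1) by (simp add: power_mult)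
  then have "floorlog 2 x \<le> floorlog 2 M * k" by (rule floorlog_le_of_less)
  with assms(2) show ?thesis by (simp add: word_cost_def algebra_simps)
qed

lemma acost_le:
  assumes "bnd M s" "asz e \<le> 50"
  shows "acost e s \<le> asz e * (50 * word_cost M)"
  using assms(2)
proof (induction e)
  have *: "word_cost (aval e s) \<le> 50 * word_cost M" if "asz e \<le> 50" for e
  proof -
    have "word_cost (aval e s) \<le> asz e * word_cost M"
      by (rule word_cost_power[OF aval_le[OF assms(1) that] asz_pos])
    also have "\<dots> \<le> 50 * word_cost M" using that by (intro mult_right_mono) auto
    finally show ?thesis .
  qed
  {
    case (N k) then show ?case using *[of "N k"] by (auto split: if_splits)
  next
    case (V x) then show ?case using *[of "V x"] by simp
  next
    case (Get a e) then show ?case using *[of "Get a e"] by simp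
  next
    case (Plus e1 e2) then show ?case using *[of "Plus e1 e2"] by (simp add: algebra_simps)
  next
    case (Minus e1 e2) then show ?case using *[of "Minus e1 e2"] by (simp add: algebra_simps)
  next
    case (Times e1 e2) then show ?case using *[of "Times e1 e2"] by (simp add: algebra_simps)
  next
    case (Div e1 e2) then show ?case using *[of "Div e1 e2"] by (simp add: algebra_simps)
  }
qed

lemma bcost_le:
  assumes "bnd M s" "bsz b \<le> 50"
  shows "bcost b s \<le> bsz b * (50 * word_cost M)"
  using assms(2)
proof (induction b)
  have 1: "1 \<le> 50 * word_cost M" by (simp add: word_cost_def)
  {
    case (Less e1 e2)
    then show ?case
      using acost_le[OF assms(1), of e1] acost_le[OF assms(1), of e2] 1 by (simp add: algebra_simps)
  next
    case (Equal e1 e2)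
    then show ?case
      using acost_le[OF assms(1), of e1] acost_le[OF assms(1), of e2] 1 by (simp add: algebra_simps)
  next
    case (Not b) then show ?case using 1 by simp
  next
    case (And b1 b2) then show ?case using 1 by (simp add: algebra_simps)
  }
qed

text \<open>A step evaluates expressions with at most 100 nodes in total, each of which has a value of at
  most \<open>M ^ 50\<close>: hence \<open>5001 = 1 + 100 * 50\<close>.\<close>

definition unit_cost :: "nat \<Rightarrow> nat" where
  "unit_cost M = 5001 * word_cost M"

lemma word_cost_pos: "1 \<le> word_cost M"
  by (simp add: word_cost_def)

lemma unit_cost_ge:
  assumes "a \<le> 100 * (50 * word_cost M)" shows "1 + a \<le> unit_cost M"
  using assms word_cost_pos[of M] by (simp add: unit_cost_def)

definition wp :: "nat \<Rightarrow> com \<Rightarrow> store \<Rightarrow> nat \<Rightarrow> (store \<Rightarrow> bool) \<Rightarrow> bool" where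
  "wp M c s k Q \<longleftrightarrow> (\<exists>s' t. exec c s s' t \<and> t \<le> k * unit_cost M \<and> bnd M s' \<and> Q s')"

lemma wp_conseq:
  assumes "wp M c s k Q" "\<And>s'. bnd M s' \<Longrightarrow> frame c s s' \<Longrightarrow> Q s' \<Longrightarrow> Q' s'" "k \<le> k'"
  shows "wp M c s k' Q'"
proof -
  obtain s' t where *: "exec c s s' t" "t \<le> k * unit_cost M" "bnd M s'" "Q s'"
    using assms(1) by (auto simp: wp_def)
  have "t \<le> k' * unit_cost M" using *(2) assms(3) by (meson le_trans mult_le_mono1)
  then show ?thesis unfolding wp_def using * assms(2) exec_frame by blast
qed

lemma wp_Skip: "bnd M s \<Longrightarrow> Q s \<Longrightarrow> 1 \<le> k \<Longrightarrow> wp M Skip s k Q"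
  unfolding wp_def
  by (rule exI[of _ s], rule exI[of _ 1])
     (use word_cost_pos[of M] exec_Skip[of s] in \<open>auto simp: unit_cost_def Suc_le_eq\<close>)

lemma wp_Assign:
  assumes "bnd M s" "asz e \<le> 50" "aval e s \<le> M" "1 \<le> k"
    and "bnd M (s\<lparr>reg := (reg s)(x := aval e s)\<rparr>) \<Longrightarrow> Q (s\<lparr>reg := (reg s)(x := aval e s)\<rparr>)"
  shows "wp M (Assign x e) s k Q"
proof -
  let ?s = "s\<lparr>reg := (reg s)(x := aval e s)\<rparr>"
  have b: "bnd M ?s" using assms(1,3) by (auto simp: bnd_def)
  have "acost e s \<le> asz e * (50 * word_cost M)" by (rule acost_le[OF assms(1,2)])
  also have "\<dots> \<le> 100 * (50 * word_cost M)" using assms(2) by (intro mult_right_mono) auto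
  finally have "1 + acost e s \<le> unit_cost M" by (rule unit_cost_ge)
  also have "\<dots> \<le> k * unit_cost M" using assms(4) by simp
  finally show ?thesis unfolding wp_def using exec_Assign b assms(5) by blast
qed

lemma wp_Put:
  assumes "bnd M s" "asz i \<le> 50" "asz e \<le> 50" "aval e s \<le> M" "1 \<le> k"
    and "bnd M (s\<lparr>arr := (arr s)(a := (arr s a)(aval i s := aval e s))\<rparr>) \<Longrightarrow>
      Q (s\<lparr>arr := (arr s)(a := (arr s a)(aval i s := aval e s))\<rparr>)"
  shows "wp M (Put a i e) s k Q"
proof -
  let ?s = "s\<lparr>arr := (arr s)(a := (arr s a)(aval i s := aval e s))\<rparr>"
  have b: "bnd M ?s" using assms(1,4) by (auto simp: bnd_def)
  have "acost i s + acost e s \<le> asz i * (50 * word_cost M) + asz e * (50 * word_cost M)"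
    by (intro add_mono acost_le assms(1,2,3))
  also have "\<dots> = (asz i + asz e) * (50 * word_cost M)" by (simp add: algebra_simps)
  also have "\<dots> \<le> 100 * (50 * word_cost M)" using assms(2,3) by (intro mult_right_mono) auto
  finally have "1 + (acost i s + acost e s) \<le> unit_cost M" by (rule unit_cost_ge)
  also have "\<dots> \<le> k * unit_cost M" using assms(5) by simp
  finally have "1 + acost i s + acost e s \<le> k * unit_cost M" by simp
  then show ?thesis unfolding wp_def using exec_Put b assms(6) by blast
qed

lemma wp_Seq:
  assumes "wp M c1 s ka (\<lambda>s1. wp M c2 s1 kb Q)" "ka + kb \<le> k"
  shows "wp M (Seq c1 c2) s k Q"
proof -
  obtain s1 t1 s2 t2 where *: "exec c1 s s1 t1" "t1 \<le> ka * unit_cost M"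
    "exec c2 s1 s2 t2" "t2 \<le> kb * unit_cost M" "bnd M s2" "Q s2"
    using assms(1) by (auto simp: wp_def)
  have "t1 + t2 \<le> (ka + kb) * unit_cost M" using *(2,4) by (simp add: algebra_simps)
  also have "\<dots> \<le> k * unit_cost M" using assms(2) by (intro mult_right_mono) auto
  finally show ?thesis unfolding wp_def using exec_Seq[OF *(1,3)] * by blast
qed

lemma bcost_unit:
  assumes "bnd M s" "bsz b \<le> 50"
  shows "1 + bcost b s \<le> unit_cost M"
proof -
  have "bcost b s \<le> bsz b * (50 * word_cost M)" by (rule bcost_le[OF assms])
  also have "\<dots> \<le> 100 * (50 * word_cost M)" using assms(2) by (intro mult_right_mono) auto
  finally show ?thesis by (rule unit_cost_ge)
qed

lemma wp_If:
  assumes "bnd M s" "bsz b \<le> 50" "1 + k' \<le> k"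
    and "bval b s \<Longrightarrow> wp M c1 s k' Q" "\<not> bval b s \<Longrightarrow> wp M c2 s k' Q"
  shows "wp M (If b c1 c2) s k Q"
proof -
  have "wp M (if bval b s then c1 else c2) s k' Q" using assms(4,5) by auto
  then obtain s' t where *: "exec (if bval b s then c1 else c2) s s' t" "t \<le> k' * unit_cost M"
    "bnd M s'" "Q s'" by (auto simp: wp_def)
  have "1 + bcost b s + t \<le> (1 + k') * unit_cost M"
    using bcost_unit[OF assms(1,2)] *(2) by simp
  also have "\<dots> \<le> k * unit_cost M" using assms(3) by (intro mult_right_mono) auto
  finally show ?thesis unfolding wp_def using exec_If[OF *(1)] * by blast
qed

text \<open>The potential \<open>\<Phi>\<close> pays for the remaining iterations, hence also gives termination.\<close>

lemma wp_While:
  assumes "bsz b \<le> 50" "bnd M s" "I s" "\<Phi> s < k"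
    and step: "\<And>s. bnd M s \<Longrightarrow> I s \<Longrightarrow> bval b s \<Longrightarrow>
       \<exists>k. wp M c s k (\<lambda>s'. I s' \<and> \<Phi> s' + k + 1 \<le> \<Phi> s)"
    and exit: "\<And>s. bnd M s \<Longrightarrow> I s \<Longrightarrow> \<not> bval b s \<Longrightarrow> Q s"
  shows "wp M (While b c) s k Q"
  using assms(2-4)
proof (induction "\<Phi> s" arbitrary: s k rule: less_induct)
  case less
  have bc: "1 + bcost b s \<le> unit_cost M" by (rule bcost_unit[OF less.prems(1) assms(1)])
  show ?case
  proof (cases "bval b s")
    case True
    obtain k1 where "wp M c s k1 (\<lambda>s'. I s' \<and> \<Phi> s' + k1 + 1 \<le> \<Phi> s)"
      using step[OF less.prems(1,2) True] by blast
    then obtain s1 t1 where 1: "exec c s s1 t1" "t1 \<le> k1 * unit_cost M" "bnd M s1" "I s1"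
      "\<Phi> s1 + k1 + 1 \<le> \<Phi> s" by (auto simp: wp_def)
    have "wp M (While b c) s1 (\<Phi> s1 + 1) Q"
      by (rule less.hyps) (use 1 in auto)
    then obtain s2 t2 where 2: "exec (While b c) s1 s2 t2" "t2 \<le> (\<Phi> s1 + 1) * unit_cost M"
      "bnd M s2" "Q s2" by (auto simp: wp_def)
    have "1 + bcost b s + t1 + t2 \<le> (1 + k1 + (\<Phi> s1 + 1)) * unit_cost M"
      using bc 1(2) 2(2) by (simp add: algebra_simps)
    also have "\<dots> \<le> k * unit_cost M" using 1(5) less.prems(3) by (intro mult_right_mono) auto
    finally show ?thesis
      unfolding wp_def using exec_While_True[OF True 1(1) 2(1)] 2 by blast
  next
    case False
    have "1 + bcost b s \<le> k * unit_cost M" using bc less.prems(3)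
      by (metis One_nat_def Suc_leI gr_zeroI less_zeroE le_trans mult_le_mono1 nat_mult_1)
    then show ?thesis
      unfolding wp_def using exec_While_False[OF False] less.prems exit False by blast
  qed
qed

definition For :: "string \<Rightarrow> string \<Rightarrow> com \<Rightarrow> com" where
  "For x y c = Seq (Assign x (N 0)) (While (Less (V x) (V y)) (Seq c (Assign x (Plus (V x) (N 1)))))"

lemma wreg_For [simp]: "wreg (For x y c) = insert x (wreg c)"
  and warr_For [simp]: "warr (For x y c) = warr c"
  by (auto simp: For_def)

lemma wp_For_pot:
  assumes "bnd M s" "x \<notin> wreg c" "y \<notin> wreg c" "x \<noteq> y" "reg s y = n" "n \<le> M"
    and init: "I 0 s" "4 + \<Psi> 0 s + 3 * n \<le> k"
    and inv: "\<And>i s v. I i s \<Longrightarrow> I i (s\<lparr>reg := (reg s)(x := v)\<rparr>)"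
    and inv': "\<And>i s v. \<Psi> i (s\<lparr>reg := (reg s)(x := v)\<rparr>) = \<Psi> i s"
    and step: "\<And>i s. bnd M s \<Longrightarrow> I i s \<Longrightarrow> i < n \<Longrightarrow> reg s x = i \<Longrightarrow> reg s y = n \<Longrightarrow>
       \<exists>k. wp M c s k (\<lambda>s'. I (Suc i) s' \<and> \<Psi> (Suc i) s' + k \<le> \<Psi> i s)"
    and exit: "\<And>s. bnd M s \<Longrightarrow> I n s \<Longrightarrow> Q s"
  shows "wp M (For x y c) s k Q"
  unfolding For_def
proof (rule wp_Seq[where ka = 1 and kb = "k - 1"], rule wp_Assign)
  have M: "4 \<le> M" using assms(1) by (simp add: bnd_def)
  let ?s0 = "s\<lparr>reg := (reg s)(x := aval (N 0) s)\<rparr>"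
  assume b0: "bnd M ?s0"
  show "wp M (While (Less (V x) (V y)) (Seq c (Assign x (Plus (V x) (N 1))))) ?s0 (k - 1) Q"
  proof (rule wp_While[where I = "\<lambda>s. reg s y = n \<and> reg s x \<le> n \<and> I (reg s x) s" and
        \<Phi> = "\<lambda>s. \<Psi> (reg s x) s + 3 * (n - reg s x)"])
    show "reg ?s0 y = n \<and> reg ?s0 x \<le> n \<and> I (reg ?s0 x) ?s0"
      using assms inv[OF init(1), of 0] by simp
    show "\<Psi> (reg ?s0 x) ?s0 + 3 * (n - reg ?s0 x) < k - 1"
      using init(2) by (simp add: inv')
    fix s assume s: "bnd M s" "reg s y = n \<and> reg s x \<le> n \<and> I (reg s x) s"
      "bval (Less (V x) (V y)) s"
    then obtain k1 where k1: "wp M c s k1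
      (\<lambda>s'. I (Suc (reg s x)) s' \<and> \<Psi> (Suc (reg s x)) s' + k1 \<le> \<Psi> (reg s x) s)"
      using step[of s "reg s x"] by auto
    show "\<exists>k1. wp M (Seq c (Assign x (Plus (V x) (N 1)))) s k1
       (\<lambda>s'. (reg s' y = n \<and> reg s' x \<le> n \<and> I (reg s' x) s') \<and>
         \<Psi> (reg s' x) s' + 3 * (n - reg s' x) + k1 + 1 \<le> \<Psi> (reg s x) s + 3 * (n - reg s x))"
    proof (rule exI[of _ "k1 + 1"], rule wp_Seq[OF wp_conseq[OF k1]])
      fix s' assume s': "bnd M s'" "frame c s s'"
        "I (Suc (reg s x)) s' \<and> \<Psi> (Suc (reg s x)) s' + k1 \<le> \<Psi> (reg s x) s"
      have r: "reg s' x = reg s x" "reg s' y = n"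
        using s'(2) assms(2,3) s(2) by (auto simp: frame_def)
      show "wp M (Assign x (Plus (V x) (N 1))) s' 1
         (\<lambda>s'. (reg s' y = n \<and> reg s' x \<le> n \<and> I (reg s' x) s') \<and>
           \<Psi> (reg s' x) s' + 3 * (n - reg s' x) + (k1 + 1) + 1
              \<le> \<Psi> (reg s x) s + 3 * (n - reg s x))"
        by (rule wp_Assign[OF s'(1)])
           (use s s' r assms(4) inv' inv[of "Suc (reg s x)" s'] \<open>n \<le> M\<close> in auto)
    qed auto
  qed (use b0 exit in \<open>auto simp: \<open>x \<noteq> y\<close>\<close>)
qed (use assms init in \<open>auto simp: bnd_def\<close>)

lemma wp_For:
  assumes "bnd M s" "x \<notin> wreg c" "y \<notin> wreg c" "x \<noteq> y" "reg s y = n" "n \<le> M"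
    and init: "I 0 s" "4 + n * (k' + 3) \<le> k"
    and inv: "\<And>i s v. I i s \<Longrightarrow> I i (s\<lparr>reg := (reg s)(x := v)\<rparr>)"
    and step: "\<And>i s. bnd M s \<Longrightarrow> I i s \<Longrightarrow> i < n \<Longrightarrow> reg s x = i \<Longrightarrow> reg s y = n \<Longrightarrow>
       wp M c s k' (I (Suc i))"
    and exit: "\<And>s. bnd M s \<Longrightarrow> I n s \<Longrightarrow> Q s"
  shows "wp M (For x y c) s k Q"
proof (rule wp_For_pot[where I = I and \<Psi> = "\<lambda>i s. (n - i) * k'" and n = n])
  show "4 + (n - 0) * k' + 3 * n \<le> k" using init by (simp add: algebra_simps)
  fix i s assume *: "bnd M s" "I i s" "i < n" "reg s x = i" "reg s y = n"
  obtain d where "n = i + 1 + d" using *(3) less_iff_Suc_add by auto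
  then show "\<exists>k. wp M c s k (\<lambda>s'. I (Suc i) s' \<and> (n - Suc i) * k' + k \<le> (n - i) * k')"
    using step[OF *] by (intro exI[of _ k']) auto
qed (use assms in auto)

section \<open>Graph distance\<close>

locale bichromatic_graph =
  fixes G :: "nat pair_pre_digraph" and S :: "nat set"
  assumes graph: "pair_graph G" and verts: "pverts G = {0..<num_verts G}"
    and S_sub: "S \<subseteq> pverts G" and S_ne: "S \<noteq> {}" and T_ne: "pverts G - S \<noteq> {}"
begin

abbreviation "E \<equiv> parcs G"
abbreviation "n \<equiv> num_verts G"
abbreviation "m \<equiv> num_edges G"
definition "T = pverts G - S"

lemma T_ne': "T \<noteq> {}" and T_sub: "T \<subseteq> {0..<n}" and S_sub': "S \<subseteq> {0..<n}"
  and ST_disjoint: "v \<in> S \<Longrightarrow> v \<notin> T" and T_iff: "v < n \<Longrightarrow> v \<in> T \<longleftrightarrow> v \<notin> S"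
  using T_ne S_sub verts by (auto simp: T_def)

lemma finite_S: "finite S" and finite_T: "finite T"
  using finite_subset[OF S_sub'] finite_subset[OF T_sub] by auto

lemma n_ge_2: "2 \<le> n"
proof -
  obtain a b where "a \<in> S" "b \<in> T" using S_ne T_ne' by auto
  then have "a < n" "b < n" "a \<noteq> b" using S_sub' T_sub ST_disjoint by auto
  then show ?thesis by auto
qed

lemma E_sym: "(u, v) \<in> E \<Longrightarrow> (v, u) \<in> E"
proof -
  interpret pair_graph G by (rule graph)
  show "(u, v) \<in> E \<Longrightarrow> (v, u) \<in> E"
    using arcs_symmetric by blast
qed

lemma E_irrefl: "(u, u) \<notin> E"
proof -
  interpret pair_graph G by (rule graph)
  show ?thesis using pair_no_loops by fastforce
qed

lemma E_verts: assumes "(u, v) \<in> E" shows "u < n" "v < n"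
proof -
  interpret pair_graph G by (rule graph)
  show "u < n" "v < n" using wellformed'[OF assms] verts by auto
qed

lemma finite_E: "finite E"
proof (rule finite_subset)
  show "E \<subseteq> {0..<n} \<times> {0..<n}" using E_verts by auto
qed simp

lemma card_E: "card E = 2 * m"
proof -
  let ?P = "{(u, v). (u, v) \<in> E \<and> u < v}" and ?Q = "{(u, v). (u, v) \<in> E \<and> v < u}"
  have fin: "finite ?P" "finite ?Q" by (auto intro: finite_subset[OF _ finite_E])
  have "E = ?P \<union> ?Q" using E_irrefl by (auto, metis nat_neq_iff)
  moreover have "?P \<inter> ?Q = {}" by auto
  ultimately have "card E = card ?P + card ?Q" using card_Un_disjoint[OF fin] by metis
  moreover have "bij_betw prod.swap ?P ?Q"
    by (rule bij_betwI[of _ _ _ prod.swap]) (auto simp: E_sym)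
  ultimately have "card E = 2 * card ?P" using bij_betw_same_card by force
  then show ?thesis by (simp add: num_edges_def)
qed

text \<open>Distances are natural numbers here; the value \<open>3 * n\<close> encodes infinity and
  keeps the triangle inequality valid.\<close>

definition D :: "nat \<Rightarrow> nat \<Rightarrow> nat" where
  "D u v = (if (u, v) \<in> E\<^sup>* then LEAST k. (u, v) \<in> E ^^ k else 3 * n)"

lemma reach_D: "(u, v) \<in> E\<^sup>* \<Longrightarrow> (u, v) \<in> E ^^ D u v"
  unfolding D_def by (auto simp: rtrancl_power intro: LeastI)

lemma D_le: "(u, v) \<in> E ^^ k \<Longrightarrow> D u v \<le> k"
  unfolding D_def by (auto simp: rtrancl_power intro: Least_le)

lemma D_self [simp]: "D u u = 0"
  using D_le[of u u 0] by simp

lemma relpow_E_sym: "(u, v) \<in> E ^^ k \<Longrightarrow> (v, u) \<in> E ^^ k"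
proof (induction k arbitrary: v)
  case (Suc k)
  then obtain w where "(u, w) \<in> E ^^ k" "(w, v) \<in> E" by auto
  then have "(w, u) \<in> E ^^ k" "(v, w) \<in> E" using Suc E_sym by auto
  then show ?case by (rule relpow_Suc_I2[rotated])
qed simp

lemma reach_sym: "(u, v) \<in> E\<^sup>* \<longleftrightarrow> (v, u) \<in> E\<^sup>*"
  using relpow_E_sym by (auto simp: rtrancl_power)

lemma D_sym: "D u v = D v u"
proof (cases "(u, v) \<in> E\<^sup>*")
  case True
  then have "(v, u) \<in> E\<^sup>*" using reach_sym by blast
  with True have "D u v \<le> D v u" "D v u \<le> D u v"
    using reach_D D_le relpow_E_sym by blast+
  then show ?thesis by simp
next
  case False
  then show ?thesis using reach_sym by (simp add: D_def)
qed

lemma shortest_path: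
  assumes "(u, v) \<in> E\<^sup>*"
  obtains f where "f 0 = u" "f (D u v) = v" "\<And>i. i < D u v \<Longrightarrow> (f i, f (Suc i)) \<in> E"
    "\<And>i j. i \<le> j \<Longrightarrow> j \<le> D u v \<Longrightarrow> D (f i) (f j) = j - i"
proof -
  obtain f where f: "f 0 = u" "f (D u v) = v" "\<And>i. i < D u v \<Longrightarrow> (f i, f (Suc i)) \<in> E"
    using reach_D[OF assms] by (auto simp: relpow_fun_conv)
  have *: "(f i, f (i + k)) \<in> E ^^ k" if "i + k \<le> D u v" for i k
    using that
  proof (induction k)
    case (Suc k)
    then show ?case using f(3)[of "i + k"] by auto
  qed simp
  have "D (f i) (f j) = j - i" if "i \<le> j" "j \<le> D u v" for i j
  proof (rule antisym)
    show "D (f i) (f j) \<le> j - i" using *[of i "j - i"] that by (intro D_le) auto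
    have 1: "(f 0, f i) \<in> E ^^ i" using *[of 0 i] that by simp
    have 2: "(f j, f (D u v)) \<in> E ^^ (D u v - j)" using *[of j "D u v - j"] that by simp
    have "(f i, f j) \<in> E ^^ (j - i)" using *[of i "j - i"] that by simp
    then have "(f i, f j) \<in> E\<^sup>*" by (auto simp: rtrancl_power)
    then have "(f i, f j) \<in> E ^^ D (f i) (f j)" by (rule reach_D)
    with 1 have "(f 0, f j) \<in> E ^^ (i + D (f i) (f j))" by (auto simp: relpow_add)
    with 2 have "(f 0, f (D u v)) \<in> E ^^ (i + D (f i) (f j) + (D u v - j))"
      by (subst relpow_add) auto
    then have "D u v \<le> i + D (f i) (f j) + (D u v - j)" using D_le f(1,2) by metis
    then show "j - i \<le> D (f i) (f j)" using that by simp
  qed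
  with f that show ?thesis by blast
qed

lemma D_less:
  assumes "(u, v) \<in> E\<^sup>*" "u < n"
  shows "D u v < n"
proof -
  obtain f where f: "f 0 = u" "f (D u v) = v" "\<And>i. i < D u v \<Longrightarrow> (f i, f (Suc i)) \<in> E"
    "\<And>i j. i \<le> j \<Longrightarrow> j \<le> D u v \<Longrightarrow> D (f i) (f j) = j - i"
    using shortest_path[OF assms(1)] by metis
  have "inj_on f {0..D u v}"
  proof (rule inj_onI)
    fix i j assume ij: "i \<in> {0..D u v}" "j \<in> {0..D u v}" and eq: "f i = f j"
    have "D (f i) (f j) = 0" "D (f j) (f i) = 0" unfolding eq by simp_all
    then show "i = j" using f(4)[of i j] f(4)[of j i] ij by fastforce
  qed
  moreover have "f ` {0..D u v} \<subseteq> {0..<n}"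
  proof safe
    fix i assume "i \<in> {0..D u v}"
    then show "f i \<in> {0..<n}"
      using f(1) f(3)[of "i - 1"] E_verts(2) assms(2) by (cases i) auto
  qed
  ultimately have "card {0..D u v} \<le> card {0..<n}" by (intro card_inj_on_le) auto
  then show ?thesis by simp
qed

lemma D_cases: "u < n \<Longrightarrow> D u v < n \<and> (u, v) \<in> E\<^sup>* \<or> D u v = 3 * n \<and> (u, v) \<notin> E\<^sup>*"
  using D_less by (auto simp: D_def)

lemma reach_iff: "u < n \<Longrightarrow> (u, v) \<in> E\<^sup>* \<longleftrightarrow> D u v < 3 * n"
  using D_cases[of u v] n_ge_2 by auto

lemma D_le_big: "u < n \<Longrightarrow> D u v \<le> 3 * n"
  using D_cases[of u v] by auto

lemma D_triangle:
  assumes "u < n" "w < n"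
  shows "D u v \<le> D u w + D w v"
proof (cases "(u, w) \<in> E\<^sup>* \<and> (w, v) \<in> E\<^sup>*")
  case True
  then have "(u, v) \<in> E ^^ (D u w + D w v)" using reach_D by (auto simp: relpow_add)
  then show ?thesis by (rule D_le)
next
  case False
  then have "D u w = 3 * n \<or> D w v = 3 * n" unfolding D_def by presburger
  then show ?thesis using D_le_big[OF assms(1), of v] by auto
qed

lemma relpow_if_awalk: "pre_digraph.awalk (with_proj G) u p v \<Longrightarrow> (u, v) \<in> E ^^ length p"
proof -
  interpret pair_graph G by (rule graph)
  show "awalk u p v \<Longrightarrow> (u, v) \<in> E ^^ length p"
  proof (induction p arbitrary: u)
    case (Cons e p)
    then have "(u, snd e) \<in> E" "awalk (snd e) p v"
      by (auto simp: awalk_Cons_iff)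
    then show ?case using relpow_Suc_I2[OF _ Cons.IH] by simp
  qed (simp add: awalk_Nil_iff)
qed

lemma awalk_if_relpow:
  "(u, v) \<in> E ^^ k \<Longrightarrow> u < n \<Longrightarrow> \<exists>p. pre_digraph.awalk (with_proj G) u p v \<and> length p = k"
proof -
  interpret pair_graph G by (rule graph)
  show "(u, v) \<in> E ^^ k \<Longrightarrow> u < n \<Longrightarrow> \<exists>p. awalk u p v \<and> length p = k"
  proof (induction k arbitrary: u)
    case 0
    then show ?case using verts by (intro exI[of _ "[]"]) (auto simp: awalk_Nil_iff)
  next
    case (Suc k)
    then obtain w where w: "(u, w) \<in> E" "(w, v) \<in> E ^^ k" using relpow_Suc_D2 by metis
    then obtain p where "awalk w p v" "length p = k" using Suc.IH E_verts by blast
    then have "awalk u ((u, w) # p) v" using w Suc.prems verts by (auto simp: awalk_Cons_iff)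
    then show ?case using \<open>length p = k\<close> by (intro exI[of _ "(u, w) # p"]) auto
  qed
qed

lemma gdist_eq:
  assumes "u < n"
  shows "gdist G u v = (if D u v < n then ereal (real (D u v)) else \<infinity>)"
proof -
  interpret pair_graph G by (rule graph)
  have cost: "awalk_cost (\<lambda>_. 1) p = real (length p)" for p :: "(nat \<times> nat) list"
    by (induction p) auto
  have mu: "gdist G u v = (INF p\<in>{p. awalk u p v}. ereal (real (length p)))"
    unfolding gdist_def \<mu>_def cost ..
  show ?thesis
  proof (cases "(u, v) \<in> E\<^sup>*")
    case True
    obtain p where p: "awalk u p v" "length p = D u v"
      using awalk_if_relpow[OF reach_D[OF True] assms] by auto
    have "gdist G u v = ereal (real (D u v))" unfolding mu
    proof (rule antisym)
      show "(INF p\<in>{p. awalk u p v}. ereal (real (length p))) \<le> ereal (real (D u v))"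
        using p by (intro INF_lower2[of p]) auto
      show "ereal (real (D u v)) \<le> (INF p\<in>{p. awalk u p v}. ereal (real (length p)))"
        using relpow_if_awalk D_le by (intro INF_greatest) auto
    qed
    then show ?thesis using D_less[OF True assms] by simp
  next
    case False
    then have "{p. awalk u p v} = {}"
      using relpow_if_awalk by (auto simp: rtrancl_power)
    then have "gdist G u v = \<infinity>" unfolding mu by (simp add: top_ereal_def)
    then show ?thesis using False D_cases[OF assms, of v] by auto
  qed
qed

section \<open>Eccentricities and radius\<close>

definition ecc :: "nat \<Rightarrow> nat" where "ecc v = Max (D v ` T)"
definition radius :: nat where "radius = Min (ecc ` S)"

lemma ecc_le_iff: "ecc v \<le> b \<longleftrightarrow> (\<forall>t\<in>T. D v t \<le> b)"
  unfolding ecc_def using finite_T T_ne' by (subst Max_le_iff) auto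

lemma ecc_attained: "\<exists>t\<in>T. ecc v = D v t"
proof -
  have "ecc v \<in> D v ` T" unfolding ecc_def using finite_T T_ne' by (intro Max_in) auto
  then show ?thesis by auto
qed

lemma radius_attained: "\<exists>s\<in>S. radius = ecc s"
proof -
  have "radius \<in> ecc ` S" unfolding radius_def using finite_S S_ne by (intro Min_in) auto
  then show ?thesis by auto
qed

lemma radius_le: "s \<in> S \<Longrightarrow> radius \<le> ecc s"
  unfolding radius_def using finite_S by simp

definition to_ereal :: "nat \<Rightarrow> ereal" where
  "to_ereal d = (if d < n then ereal (real d) else \<infinity>)"

lemma to_ereal_mono: "mono to_ereal"
  by (auto simp: mono_def to_ereal_def)

lemma ST_ecc_eq:
  assumes "v < n"
  shows "ST_ecc G T v = to_ereal (ecc v)"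
proof -
  have "gdist G v ` T = to_ereal ` (D v ` T)"
    using gdist_eq[OF assms] by (auto simp: to_ereal_def image_image)
  then show ?thesis unfolding ST_ecc_def ecc_def
    using mono_Max_commute[OF to_ereal_mono, of "D v ` T"] finite_T T_ne' by simp
qed

lemma ST_radius_eq: "ST_radius G S T = to_ereal radius"
proof -
  have "ST_ecc G T ` S = to_ereal ` (ecc ` S)"
    using ST_ecc_eq S_sub' unfolding image_image by (intro image_cong) auto
  then show ?thesis unfolding ST_radius_def radius_def
    using mono_Min_commute[OF to_ereal_mono, of "ecc ` S"] finite_S S_ne by simp
qed

section \<open>Correctness of the algorithm\<close>

definition gball :: "nat \<Rightarrow> nat \<Rightarrow> nat set" where
  "gball v r = {u. u < n \<and> D v u \<le> r}"

text \<open>\<open>slack R\<close> and \<open>core_radius R\<close> are the exact versions of \<open>2R/3\<close> and \<open>R/3\<close> in the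
  argument above; all that matters is \<open>slack_props\<close> and \<open>approx_bound\<close>.\<close>

definition slack :: "nat \<Rightarrow> nat" where
  "slack R = (if R mod 3 = 0 then 2 * (R div 3) + 1 else 2 * (R div 3) + 2)"

definition core_radius :: "nat \<Rightarrow> nat" where
  "core_radius R = (if R mod 3 = 0 then R div 3 else R div 3 + 1)"

lemma slack_props:
  "2 * core_radius R \<le> slack R" "R + 1 \<le> slack R + core_radius R" "2 * R \<le> 3 * slack R"
  "slack R \<le> R + 3"
  unfolding core_radius_def slack_def by (auto; presburger)+

lemma approx_bound:
  "real (R + slack R) \<le> 5/3 * real R + 5/3"
  "R mod 3 = 0 \<Longrightarrow> real (R + slack R) \<le> 5/3 * real R + 1"
proof -
  have "3 * (R + slack R) \<le> 5 * R + 5" unfolding slack_def by (auto; presburger)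
  then have "real (3 * (R + slack R)) \<le> real (5 * R + 5)" by (rule of_nat_mono)
  then show "real (R + slack R) \<le> 5/3 * real R + 5/3" by simp
  assume "R mod 3 = 0"
  then have "3 * (R + slack R) \<le> 5 * R + 3" unfolding slack_def by (auto; presburger)
  then have "real (3 * (R + slack R)) \<le> real (5 * R + 3)" by (rule of_nat_mono)
  then show "real (R + slack R) \<le> 5/3 * real R + 1" by simp
qed

lemma finite_gball: "finite (gball v r)"
  unfolding gball_def by auto

lemma small_ball:
  assumes q: "n \<le> q * q" "1 \<le> q"
    and w: "\<And>i. i < q \<Longrightarrow> w i < n"
    and far: "\<And>i j. j < i \<Longrightarrow> i < q \<Longrightarrow> 2 * r < D (w i) (w j)"
  shows "\<exists>i<q. card (gball (w i) r) \<le> q"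
proof (rule ccontr)
  assume "\<not> ?thesis"
  then have big: "q + 1 \<le> card (gball (w i) r)" if "i < q" for i using that by (auto simp: Suc_le_eq)
  have aux: "gball (w i) r \<inter> gball (w j) r = {}" if ij: "j < i" "i < q" for i j
  proof (rule ccontr)
    assume "gball (w i) r \<inter> gball (w j) r \<noteq> {}"
    then obtain x where x: "x < n" "D (w i) x \<le> r" "D (w j) x \<le> r" by (auto simp: gball_def)
    have "D (w i) (w j) \<le> D (w i) x + D x (w j)" using D_triangle w ij x by simp
    also have "\<dots> \<le> 2 * r" using x D_sym[of x "w j"] by simp
    finally show False using far[OF ij] by simp
  qed
  have "q * (q + 1) = (\<Sum>i\<in>{..<q}. q + 1)" by simp
  also have "\<dots> \<le> (\<Sum>i\<in>{..<q}. card (gball (w i) r))" using big by (intro sum_mono) auto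
  also have "\<dots> = card (\<Union>i\<in>{..<q}. gball (w i) r)"
    using aux finite_gball by (intro card_UN_disjoint[symmetric]) (auto, metis disjoint_iff nat_neq_iff)
  also have "\<dots> \<le> card {0..<n}" by (intro card_mono) (auto simp: gball_def)
  finally show False using q by simp
qed

definition well_spread :: "nat \<Rightarrow> nat set \<Rightarrow> bool" where
  "well_spread q W \<longleftrightarrow> (\<forall>w<n. \<forall>r<3 * n. q \<le> card (T \<inter> gball w r) \<longrightarrow> W \<inter> T \<inter> gball w r \<noteq> {})"

lemma algorithm_core:
  fixes q :: nat and W :: "nat set" and si wi :: "nat \<Rightarrow> nat" and b :: nat and A N :: "nat set"
    and p :: "nat \<Rightarrow> nat"
  assumes q: "n \<le> q * q" "1 \<le> q"
    and R: "R = radius" "R < n"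
    and A: "\<And>u v. (u, v) \<in> E \<Longrightarrow> u \<in> A" "T \<subseteq> A" "A \<subseteq> {0..<n}"
    and W: "well_spread q W" "W0 = W \<inter> T"
    and si: "\<And>i. i < q \<Longrightarrow> si i \<in> S"
    and si_min: "\<And>i s x. i < q \<Longrightarrow> s \<in> S \<inter> A \<Longrightarrow> x \<in> W0 \<union> wi ` {..<i} \<Longrightarrow>
        \<exists>y \<in> W0 \<union> wi ` {..<i}. D (si i) x \<le> D s y"
    and wi: "\<And>i. i < q \<Longrightarrow> wi i \<in> T" "\<And>i. i < q \<Longrightarrow> ecc (si i) = D (si i) (wi i)"
    and b: "b \<in> wi ` {..<q}" "\<And>r. r < 3 * n \<Longrightarrow> \<exists>i<q. card (gball (wi i) r) \<le> q \<Longrightarrow> card (gball b r) \<le> q"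
    and N: "\<And>v r. v \<in> S \<Longrightarrow> r < 3 * n \<Longrightarrow> v \<in> gball b r \<Longrightarrow> card (gball b r) \<le> q \<Longrightarrow> v \<in> N"
      "\<And>v r. v \<in> T \<Longrightarrow> r < 3 * n \<Longrightarrow> v \<in> gball b r \<Longrightarrow> card (T \<inter> gball b r) < q \<Longrightarrow> v \<in> N"
    and p: "\<And>v s. v \<in> N \<Longrightarrow> s \<in> S \<inter> A \<Longrightarrow> p v \<in> S \<and> D v (p v) \<le> D v s"
  shows "(\<exists>i<q. ecc (si i) \<le> R + slack R) \<or> (\<exists>v\<in>N. ecc (p v) \<le> R + slack R)"
proof (rule ccontr)
  assume neg: "\<not> ?thesis"
  define L \<rho> where "L = slack R" and "\<rho> = core_radius R"
  have L: "2 * \<rho> \<le> L" "R + 1 \<le> L + \<rho>" "2 * R \<le> 3 * L" "L < 3 * n"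
    using slack_props[of R] R(2) n_ge_2 by (auto simp: L_def \<rho>_def)
  obtain c where c: "c \<in> S" "ecc c = R" using radius_attained R by auto
  have b_T: "b \<in> T" using b(1) wi(1) by auto
  have c_n: "c < n" using c S_sub' by auto
  have cT: "D c t \<le> R" if "t \<in> T" for t using c(2) ecc_le_iff[of c R] that by auto
  have reach: "(t, c) \<in> E\<^sup>*" if "t \<in> T" for t
    using cT[OF that] R(2) c_n reach_iff[of c t] reach_sym by auto
  have c_A: "c \<in> A"
  proof -
    obtain t where t: "t \<in> T" using T_ne' by auto
    then have "c \<noteq> t" "(c, t) \<in> E\<^sup>*" using reach reach_sym c ST_disjoint by auto
    then show ?thesis using A(1) by (metis converse_rtranclE)
  qed
  have T_n: "t < n" if "t \<in> T" for t using that T_sub by auto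
  have close: False if "s \<in> S" "D s c \<le> L" "ecc s > R + L" for s
  proof -
    have "D s t \<le> R + L" if "t \<in> T" for t
      using D_triangle[of s c t] \<open>s \<in> S\<close> c_n cT[OF that] \<open>D s c \<le> L\<close> S_sub' by fastforce
    then show False using that(3) ecc_le_iff[of s "R + L"] by auto
  qed
  have neg1: "ecc (si i) > R + L" if "i < q" for i using neg that by (auto simp: L_def not_le)
  have neg2: "ecc (p v) > R + L" if "v \<in> N" for v using neg that by (auto simp: L_def not_le)
  have sep: "D (wi i) x > L" if i: "i < q" and x: "x \<in> W0 \<union> wi ` {..<i}" for i x
  proof -
    have T': "W0 \<union> wi ` {..<i} \<subseteq> T" using W wi(1) i by auto
    obtain y where y: "y \<in> W0 \<union> wi ` {..<i}" "D (si i) x \<le> D c y"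
      using si_min[OF i _ x, of c] c c_A by auto
    then have "D (si i) x \<le> R" using cT T' by (meson le_trans subsetD)
    moreover have "D (si i) (wi i) \<le> D (si i) x + D x (wi i)"
      using si[OF i] S_sub' T' x T_n by (intro D_triangle) auto
    ultimately show ?thesis using neg1[OF i] wi(2)[OF i] D_sym[of x "wi i"] by simp
  qed
  have "\<exists>i<q. card (gball (wi i) \<rho>) \<le> q"
  proof (rule small_ball[OF q])
    fix i j assume "j < i" "i < q"
    then show "2 * \<rho> < D (wi i) (wi j)" using sep[of i "wi j"] L(1) by fastforce
  qed (use wi T_n in auto)
  then have small: "card (gball b \<rho>) \<le> q" using b(2) L by auto
  have few: "card (T \<inter> gball b L) < q"
  proof (rule ccontr)
    assume "\<not> ?thesis"
    then have "W0 \<inter> gball b L \<noteq> {}"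
      using W T_n[OF b_T] L(4) by (auto simp: well_spread_def not_less)
    then obtain x where "x \<in> W0" "D b x \<le> L" by (auto simp: gball_def)
    moreover obtain i where "i < q" "b = wi i" using b(1) by auto
    ultimately show False using sep[of i x] by auto
  qed
  define d where "d = D b c"
  have d: "d \<le> R" using cT[OF b_T] D_sym by (simp add: d_def)
  obtain f where f: "f 0 = b" "f d = c" "\<And>i. i < d \<Longrightarrow> (f i, f (Suc i)) \<in> E"
    and Df: "\<And>i j. i \<le> j \<Longrightarrow> j \<le> d \<Longrightarrow> D (f i) (f j) = j - i"
    using shortest_path[OF reach[OF b_T]] unfolding d_def by metis
  have f_n: "f i < n" if "i \<le> d" for i
    using f E_verts(1)[OF f(3), of i] c_n that by (cases "i = d") auto
  have f_A: "f i \<in> A" if "i \<le> d" for i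
    using A(1)[OF f(3), of i] c_A f(2) that by (cases "i = d") auto
  have in_ball: "f i \<in> gball b r" if "i \<le> d" "i \<le> r" for i r
    using Df[of 0 i] f(1) f_n that by (auto simp: gball_def)
  have via: "D (p v) c \<le> D v x + D v c" if "v \<in> N" "v < n" "x \<in> S" "x \<in> A" for v x
  proof -
    have "p v \<in> S" "D v (p v) \<le> D v x" using p[OF that(1), of x] that by auto
    then show ?thesis using D_triangle[of "p v" v c] D_sym[of "p v" v] S_sub' that by fastforce
  qed
  have finish: False if "v \<in> N" "v < n" "x \<in> S" "x \<in> A" "D v x + D v c \<le> L" for v x
    using close[of "p v"] via[of v x] that neg2[of v] p[of v x] by auto
  define e where "e = min \<rho> d"
  have e: "e \<le> d" "e \<le> \<rho>" by (auto simp: e_def)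
  show False
  proof (cases "f e \<in> S")
    case True
    have "f e \<in> N" using N(1)[OF True, of \<rho>] in_ball[OF e] small L by auto
    moreover have "D (f e) c \<le> L" using Df[of e d] f(2) e d L(2) by (auto simp: e_def)
    ultimately show False using finish[of "f e" "f e"] True f_A f_n e by simp
  next
    case False
    then have e_T: "f e \<in> T" using f_n e T_iff by simp
    with f(2) c ST_disjoint have "e < d" using e by (metis le_neq_implies_less)
    then have e\<rho>: "e = \<rho>" by (auto simp: e_def)
    define P where "P a \<longleftrightarrow> a < d \<and> a \<le> L \<and> f a \<in> T" for a
    define a where "a = (GREATEST a. P a)"
    have "P \<rho>" using e_T \<open>e < d\<close> e\<rho> L(1) by (auto simp: P_def)
    moreover have bound: "P a \<Longrightarrow> a \<le> d" for a by (auto simp: P_def)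
    ultimately have a: "P a" "\<rho> \<le> a" "\<not> P (Suc a)"
      unfolding a_def using GreatestI_nat[of P \<rho> d] Greatest_le_nat[of P \<rho> d]
        Greatest_le_nat[of P "Suc (GREATEST a. P a)" d] by auto
    then have a': "a < d" "a \<le> L" "f a \<in> T" by (auto simp: P_def)
    have fa_N: "f a \<in> N" using N(2)[OF a'(3) L(4) in_ball[of a L] few] a' by auto
    have Dac: "D (f a) c = d - a" using Df[of a d] f(2) a' by simp
    show False
    proof (cases "f (Suc a) \<in> S")
      case True
      have "D (f a) (f (Suc a)) = 1" using Df[of a "Suc a"] a' by simp
      then have "D (f a) (f (Suc a)) + D (f a) c \<le> L" using Dac a(2) d L(2) a' by simp
      then show False using finish[of "f a" "f (Suc a)"] True fa_N f_n f_A a' by simp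
    next
      case False
      then have "Suc a \<noteq> d" using c f(2) by auto
      then have "Suc a < d" using a' by simp
      moreover have "f (Suc a) \<in> T" using False f_n[of "Suc a"] T_iff a' by simp
      ultimately have "a = L" using a(3) a' by (auto simp: P_def)
      then have "D (f a) c + D (f a) c \<le> L" using Dac d L(3) by linarith
      then show False using finish[of "f a" c] fa_N f_n[of a] c c_A a' by simp
    qed
  qed
qed

end

section \<open>Symbolic execution of loop-free code\<close>

primrec straight :: "com \<Rightarrow> bool" where
  "straight Skip = True"
| "straight (Assign x e) = (asz e \<le> 50)"
| "straight (Put a i e) = (asz i \<le> 50 \<and> asz e \<le> 50)"
| "straight (Rand x e) = False"
| "straight (Seq c1 c2) = (straight c1 \<and> straight c2)"
| "straight (If b c1 c2) = (bsz b \<le> 50 \<and> straight c1 \<and> straight c2)"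
| "straight (While b c) = False"

primrec steps :: "com \<Rightarrow> nat" where
  "steps Skip = 1"
| "steps (Assign x e) = 1"
| "steps (Put a i e) = 1"
| "steps (Rand x e) = 1"
| "steps (Seq c1 c2) = steps c1 + steps c2"
| "steps (If b c1 c2) = 1 + max (steps c1) (steps c2)"
| "steps (While b c) = 1"

primrec xec :: "com \<Rightarrow> store \<Rightarrow> store" where
  "xec Skip s = s"
| "xec (Assign x e) s = s\<lparr>reg := (reg s)(x := aval e s)\<rparr>"
| "xec (Put a i e) s = s\<lparr>arr := (arr s)(a := (arr s a)(aval i s := aval e s))\<rparr>"
| "xec (Rand x e) s = s"
| "xec (Seq c1 c2) s = xec c2 (xec c1 s)"
| "xec (If b c1 c2) s = (if bval b s then xec c1 s else xec c2 s)"
| "xec (While b c) s = s"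

primrec safe :: "nat \<Rightarrow> com \<Rightarrow> store \<Rightarrow> bool" where
  "safe M Skip s = True"
| "safe M (Assign x e) s = (aval e s \<le> M)"
| "safe M (Put a i e) s = (aval e s \<le> M)"
| "safe M (Rand x e) s = False"
| "safe M (Seq c1 c2) s = (safe M c1 s \<and> safe M c2 (xec c1 s))"
| "safe M (If b c1 c2) s = (if bval b s then safe M c1 s else safe M c2 s)"
| "safe M (While b c) s = False"

lemma wp_straight:
  assumes "straight c" "bnd M s" "safe M c s" "steps c \<le> k" "bnd M (xec c s) \<Longrightarrow> Q (xec c s)"
  shows "wp M c s k Q"
proof -
  have "wp M c s (steps c) (\<lambda>s'. s' = xec c s)"
    using assms(1-3)
  proof (induction c arbitrary: s)
    case (Seq c1 c2)
    show ?case unfolding steps.simps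
    proof (rule wp_Seq[OF wp_conseq[OF Seq.IH(1)]])
      fix s' assume "bnd M s'" "s' = xec c1 s"
      then show "wp M c2 s' (steps c2) (\<lambda>s'. s' = xec (Seq c1 c2) s)"
        using Seq.IH(2)[of s'] Seq.prems by simp
    qed (use Seq.prems in auto)
  next
    case (If b c1 c2)
    show ?case
      by (rule wp_If[where k' = "max (steps c1) (steps c2)"])
         (use If in \<open>auto intro!: wp_conseq[OF If.IH(1)] wp_conseq[OF If.IH(2)]\<close>)
  qed (auto intro: wp_Skip wp_Assign wp_Put)
  then show ?thesis by (rule wp_conseq) (use assms in auto)
qed

lemma bnd_reg: "bnd M s \<Longrightarrow> reg s x \<le> M" and bnd_arr: "bnd M s \<Longrightarrow> arr s a i \<le> M"
  by (auto simp: bnd_def)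

section \<open>Adjacency lists\<close>

locale bichromatic_instance = bichromatic_graph G S for G S +
  fixes off adj :: "nat \<Rightarrow> nat"
  assumes adj_lists: "adjacency_lists G off adj"
begin

definition A :: "nat set" where "A = {v. v < n \<and> off v < off (Suc v)}"
definition lst :: "nat list" where "lst = filter (\<lambda>v. off v < off (Suc v)) [0..<n]"

lemma off_0: "off 0 = 0" and off_Suc: "v < n \<Longrightarrow> off v \<le> off (Suc v)"
  and adj_bij: "v < n \<Longrightarrow> bij_betw adj {off v..<off (Suc v)} {u. (v, u) \<in> E}"
  using adj_lists verts by (auto simp: adjacency_lists_def)

lemma adj_image: "v < n \<Longrightarrow> adj ` {off v..<off (Suc v)} = {u. (v, u) \<in> E}"
  using adj_bij by (auto simp: bij_betw_def)

lemma A_iff: "v \<in> A \<longleftrightarrow> (\<exists>u. (v, u) \<in> E)"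
proof
  assume "v \<in> A"
  then have "v < n" "off v \<in> {off v..<off (Suc v)}" by (auto simp: A_def)
  then show "\<exists>u. (v, u) \<in> E" using adj_image by blast
next
  assume "\<exists>u. (v, u) \<in> E"
  then obtain u where u: "(v, u) \<in> E" by auto
  then have "v < n" using E_verts by auto
  with u have "u \<in> adj ` {off v..<off (Suc v)}" using adj_image by auto
  then show "v \<in> A" using \<open>v < n\<close> by (auto simp: A_def)
qed

lemma A_less: "v \<in> A \<Longrightarrow> v < n" by (simp add: A_def)
lemma finite_A: "finite A" by (simp add: A_def)
lemma set_lst: "set lst = A" by (auto simp: lst_def A_def)
lemma distinct_lst: "distinct lst" by (auto simp: lst_def)
lemma length_lst: "length lst = card A" using set_lst distinct_lst distinct_card by metis
lemma lst_nth: "i < length lst \<Longrightarrow> lst ! i \<in> A" using set_lst nth_mem by metis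

lemma lst_cover: "v \<in> A \<Longrightarrow> \<exists>i<length lst. lst ! i = v"
  using set_lst by (metis in_set_conv_nth)

lemma card_A: "card A \<le> 2 * m"
proof -
  have "A = fst ` E" using A_iff by force
  then show ?thesis using card_image_le[OF finite_E, of fst] card_E by simp
qed

lemma card_A': "card A \<le> n"
proof -
  have "A \<subseteq> {0..<n}" using A_less by auto
  from card_mono[OF _ this] show ?thesis by simp
qed

lemma off_sum: "v \<le> n \<Longrightarrow> off v = (\<Sum>u<v. off (Suc u) - off u)"
proof (induction v)
  case (Suc v)
  then have *: "(\<Sum>u<v. off (Suc u) - off u) = off v" "off v \<le> off (Suc v)" using off_Suc[of v] by auto
  show ?case by (simp add: *)
qed (simp add: off_0)

lemma deg_card: "v < n \<Longrightarrow> off (Suc v) - off v = card {u. (v, u) \<in> E}"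
  using bij_betw_same_card[OF adj_bij] by simp

lemma off_n: "off n = 2 * m"
proof -
  have "E = (SIGMA v:{..<n}. {u. (v, u) \<in> E})" using E_verts by auto
  then have "card E = card (SIGMA v:{..<n}. {u. (v, u) \<in> E})" by (rule arg_cong)
  also have "\<dots> = (\<Sum>v<n. card {u. (v, u) \<in> E})"
  proof (rule card_SigmaI)
    show "\<forall>v\<in>{..<n}. finite {u. (v, u) \<in> E}"
      using E_verts by (auto intro!: finite_subset[of "{u. (_, u) \<in> E}" "{0..<n}"])
  qed simp
  also have "\<dots> = off n" using deg_card off_sum[of n] by simp
  finally show ?thesis using card_E by simp
qed

lemma off_mono: "u \<le> v \<Longrightarrow> v \<le> n \<Longrightarrow> off u \<le> off v"
  by (induction v rule: dec_induct) (use off_Suc in \<open>auto simp: Suc_le_eq intro: le_trans\<close>)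

lemma off_le: "v \<le> n \<Longrightarrow> off v \<le> 2 * m"
  using off_mono[of v n] off_n by simp

lemma m_le: "2 * m \<le> n * n"
proof -
  have "E \<subseteq> {0..<n} \<times> {0..<n}" using E_verts by auto
  from card_mono[OF _ this] show ?thesis using card_E by simp
qed

lemma deg_sum: "(\<Sum>v\<in>A. off (Suc v) - off v) \<le> 2 * m"
proof -
  have "(\<Sum>v\<in>A. off (Suc v) - off v) \<le> (\<Sum>v\<in>{..<n}. off (Suc v) - off v)"
    by (rule sum_mono2) (auto simp: A_less)
  then show ?thesis using off_sum[of n] off_n by simp
qed

section \<open>Breadth-first search\<close>

definition bfs_inv :: "nat \<Rightarrow> (nat \<Rightarrow> nat) \<Rightarrow> nat list \<Rightarrow> nat \<Rightarrow> nat set \<Rightarrow> bool" where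
  "bfs_inv src d Q h X \<longleftrightarrow>
     distinct Q \<and> set Q = {u\<in>A. d u < 3 * n} \<and> (\<forall>u\<in>A. d u \<le> 3 * n) \<and> src \<in> set Q \<and> d src = 0 \<and>
     (\<forall>u\<in>set Q. (src, u) \<in> E ^^ d u) \<and>
     (\<forall>i j. i \<le> j \<longrightarrow> j < length Q \<longrightarrow> d (Q ! i) \<le> d (Q ! j)) \<and>
     (\<forall>j<length Q. d (Q ! j) \<le> j) \<and> h \<le> length Q \<and>
     (\<forall>j<length Q. h < length Q \<longrightarrow> d (Q ! j) \<le> d (Q ! h) + 1) \<and>
     (\<forall>i<h. \<forall>u. (Q ! i, u) \<in> E \<longrightarrow> u \<in> set Q \<and> d u \<le> d (Q ! i) + 1) \<and>
     (\<forall>u\<in>X. u \<in> set Q \<and> d u \<le> d (Q ! h) + 1)"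

lemma bfs_inv_length:
  assumes "bfs_inv src d Q h X"
  shows "length Q \<le> n"
proof -
  have "distinct Q" "set Q \<subseteq> A" using assms by (auto simp: bfs_inv_def)
  then have "length Q \<le> card A" using finite_A by (metis card_mono distinct_card)
  then show ?thesis using card_A' by simp
qed

lemma bfs_inv_init:
  assumes "src \<in> A" "\<And>u. u \<in> A \<Longrightarrow> d u = (if u = src then 0 else 3 * n)"
  shows "bfs_inv src d [src] 0 {}"
  using assms n_ge_2 by (auto simp: bfs_inv_def split: if_splits)

lemma bfs_inv_old:
  assumes "bfs_inv src d Q h X" "h < length Q" "(Q ! h, u) \<in> E" "d u \<noteq> 3 * n"
  shows "bfs_inv src d Q h (insert u X)"
proof -
  have "u \<in> A" using assms(3) E_sym A_iff by blast
  with assms(1,4) have u: "u \<in> set Q" by (auto simp: bfs_inv_def le_less)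
  then obtain j where "j < length Q" "Q ! j = u" by (auto simp: in_set_conv_nth)
  then have "d u \<le> d (Q ! h) + 1" using assms(1,2) by (auto simp: bfs_inv_def)
  with u assms(1) show ?thesis by (auto simp: bfs_inv_def)
qed

lemma bfs_inv_new:
  assumes inv: "bfs_inv src d Q h X" and h: "h < length Q" and e: "(Q ! h, u) \<in> E" "d u = 3 * n"
  shows "bfs_inv src (d(u := d (Q ! h) + 1)) (Q @ [u]) h (insert u X)"
proof -
  let ?v = "Q ! h" and ?d = "d(u := d (Q ! h) + 1)"
  have uA: "u \<in> A" using e(1) E_sym A_iff by blast
  have uQ: "u \<notin> set Q" using inv e(2) by (auto simp: bfs_inv_def)
  have nth: "?d (Q ! j) = d (Q ! j)" if "j < length Q" for j
    using uQ that nth_mem[of j Q] by (auto simp del: nth_mem)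
  have dQ: "?d x = d x" if "x \<in> set Q" for x using uQ that by auto
  have dv: "d ?v \<le> h" using inv h by (auto simp: bfs_inv_def)
  have less: "?d u < 3 * n" using dv h bfs_inv_length[OF inv] by simp
  have walk: "(src, u) \<in> E ^^ ?d u"
    using inv h e(1) nth_mem[OF h] by (auto simp: bfs_inv_def)
  have s0: "src \<in> set Q" "d src = 0" using inv by (auto simp: bfs_inv_def)
  have set: "set (Q @ [u]) = {x\<in>A. ?d x < 3 * n}"
  proof -
    have "set Q = {x\<in>A. d x < 3 * n}" using inv by (auto simp: bfs_inv_def)
    then show ?thesis using uA less e(2) by auto
  qed
  have mono: "?d ((Q @ [u]) ! i) \<le> ?d ((Q @ [u]) ! j)" if "i \<le> j" "j < length (Q @ [u])" for i j
  proof (cases "j < length Q")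
    case True
    then show ?thesis using that inv nth by (auto simp: bfs_inv_def nth_append)
  next
    case False
    then have "j = length Q" using that by simp
    then show ?thesis using that inv nth h by (cases "i = j") (auto simp: bfs_inv_def nth_append)
  qed
  have idx: "?d ((Q @ [u]) ! j) \<le> j" if "j < length (Q @ [u])" for j
  proof (cases "j < length Q")
    case True
    then show ?thesis using inv nth by (auto simp: bfs_inv_def nth_append)
  next
    case False
    then have "j = length Q" using that by simp
    then show ?thesis using dv h by (simp add: nth_append)
  qed
  have up: "?d ((Q @ [u]) ! j) \<le> ?d ((Q @ [u]) ! h) + 1" if "j < length (Q @ [u])" for j
  proof (cases "j < length Q")
    case True
    then show ?thesis using inv nth h by (auto simp: bfs_inv_def nth_append)
  next
    case False
    then have "j = length Q" using that by simp
    then show ?thesis using nth[OF h] h by (simp add: nth_append)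
  qed
  have old: "x \<in> set (Q @ [u]) \<and> ?d x \<le> ?d ((Q @ [u]) ! i) + 1" if "i < h" "((Q @ [u]) ! i, x) \<in> E" for i x
  proof -
    have "(Q ! i, x) \<in> E" using that h by (simp add: nth_append)
    then have "x \<in> set Q" "d x \<le> d (Q ! i) + 1" using inv that(1) by (auto simp: bfs_inv_def)
    then show ?thesis using nth[of i] dQ that(1) h by (simp add: nth_append)
  qed
  have cur: "x \<in> set (Q @ [u]) \<and> ?d x \<le> ?d ((Q @ [u]) ! h) + 1" if "x \<in> insert u X" for x
  proof (cases "x = u")
    case True
    then show ?thesis using nth[OF h] h by (simp add: nth_append)
  next
    case False
    then have "x \<in> set Q" "d x \<le> d ?v + 1" using inv that by (auto simp: bfs_inv_def)
    then show ?thesis using nth[OF h] dQ h by (simp add: nth_append)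
  qed
  have le: "\<forall>x\<in>A. ?d x \<le> 3 * n" using inv less by (auto simp: bfs_inv_def)
  have walks: "\<forall>x\<in>set (Q @ [u]). (src, x) \<in> E ^^ ?d x"
    using walk inv dQ by (auto simp: bfs_inv_def)
  show ?thesis
    unfolding bfs_inv_def
  proof (intro conjI)
    show "distinct (Q @ [u])" using inv uQ by (auto simp: bfs_inv_def)
    show "src \<in> set (Q @ [u])" "?d src = 0" using s0 dQ by auto
    show "h \<le> length (Q @ [u])" using h by simp
  qed (use set mono idx up old cur le walks in blast)+
qed

lemma bfs_inv_advance:
  assumes inv: "bfs_inv src d Q h X" and h: "h < length Q" and X: "\<And>u. (Q ! h, u) \<in> E \<Longrightarrow> u \<in> X"
  shows "bfs_inv src d Q (Suc h) {}"
proof -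
  have up: "d (Q ! j) \<le> d (Q ! Suc h) + 1" if "j < length Q" "Suc h < length Q" for j
  proof -
    have "d (Q ! j) \<le> d (Q ! h) + 1" "d (Q ! h) \<le> d (Q ! Suc h)"
      using inv h that by (auto simp: bfs_inv_def)
    then show ?thesis by simp
  qed
  have "u \<in> set Q \<and> d u \<le> d (Q ! i) + 1" if "i < Suc h" "(Q ! i, u) \<in> E" for i u
  proof (cases "i = h")
    case True
    then have "u \<in> X" using X that by simp
    then have "u \<in> set Q \<and> d u \<le> d (Q ! h) + 1" using inv unfolding bfs_inv_def by blast
    with True show ?thesis by simp
  next
    case False
    then have "i < h" using that by simp
    with inv that(2) show ?thesis unfolding bfs_inv_def by blast
  qed
  with up inv h show ?thesis by (auto simp: bfs_inv_def)
qed

definition bfs_order :: "nat \<Rightarrow> nat list \<Rightarrow> bool" where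
  "bfs_order src Q \<longleftrightarrow> distinct Q \<and> set Q = {u\<in>A. D src u < 3 * n} \<and>
     (\<forall>i j. i \<le> j \<longrightarrow> j < length Q \<longrightarrow> D src (Q ! i) \<le> D src (Q ! j))"

lemma bfs_inv_final:
  assumes inv: "bfs_inv src d Q (length Q) X" and src: "src < n"
  shows "\<And>u. u \<in> A \<Longrightarrow> d u = D src u" "bfs_order src Q"
proof -
  have closed: "x \<in> set Q \<and> d x \<le> k" if "(src, x) \<in> E ^^ k" for x k
    using that
  proof (induction k arbitrary: x)
    case 0
    then show ?case using inv by (auto simp: bfs_inv_def)
  next
    case (Suc k)
    then obtain y where y: "(src, y) \<in> E ^^ k" "(y, x) \<in> E" by auto
    then have "y \<in> set Q" "d y \<le> k" using Suc.IH by auto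
    moreover obtain i where "i < length Q" "Q ! i = y" using \<open>y \<in> set Q\<close> by (auto simp: in_set_conv_nth)
    then have "x \<in> set Q" "d x \<le> d y + 1" using inv y(2) by (auto simp: bfs_inv_def)
    ultimately show ?case by simp
  qed
  show eq: "d u = D src u" if "u \<in> A" for u
  proof (cases "(src, u) \<in> E\<^sup>*")
    case True
    have "u \<in> set Q" "d u \<le> D src u" using closed[OF reach_D[OF True]] by auto
    moreover have "D src u \<le> d u" using inv \<open>u \<in> set Q\<close> by (intro D_le) (auto simp: bfs_inv_def)
    ultimately show ?thesis by simp
  next
    case False
    then have "u \<notin> set Q" using inv by (auto simp: bfs_inv_def rtrancl_power)
    then have "d u = 3 * n" using inv that by (auto simp: bfs_inv_def le_less)
    then show ?thesis using False D_cases[OF src, of u] by auto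
  qed
  have sub: "set Q \<subseteq> A" using inv by (auto simp: bfs_inv_def)
  have nth: "d (Q ! i) = D src (Q ! i)" if "i < length Q" for i
    using eq[of "Q ! i"] sub that nth_mem by blast
  have "set Q = {u\<in>A. D src u < 3 * n}" using inv eq by (auto simp: bfs_inv_def)
  moreover have "D src (Q ! i) \<le> D src (Q ! j)" if "i \<le> j" "j < length Q" for i j
  proof -
    have "d (Q ! i) \<le> d (Q ! j)" using inv that unfolding bfs_inv_def by blast
    then show ?thesis using nth[of i] nth[of j] that by simp
  qed
  ultimately show "bfs_order src Q" using inv unfolding bfs_order_def by (simp add: bfs_inv_def)
qed

end

definition bfs_reset :: com where
  "bfs_reset = For ''i'' ''na'' (Put ''dist'' (Get ''lst'' (V ''i'')) (V ''big''))"

definition bfs_start :: com where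
  "bfs_start =
    Seq (Put ''dist'' (V ''src'') (N 0))
    (Seq (Put ''queue'' (N 0) (V ''src''))
    (Seq (Assign ''tail'' (N 1)) (Assign ''h'' (N 0))))"

definition bfs_visit :: com where
  "bfs_visit =
    Seq (Assign ''u'' (Get ''adj'' (V ''e'')))
    (Seq (If (Equal (Get ''dist'' (V ''u'')) (V ''big''))
       (Seq (Put ''dist'' (V ''u'') (Plus (Get ''dist'' (V ''v'')) (N 1)))
       (Seq (Put ''queue'' (V ''tail'') (V ''u''))
            (Assign ''tail'' (Plus (V ''tail'') (N 1)))))
       Skip)
    (Assign ''e'' (Plus (V ''e'') (N 1))))"

definition bfs_pop :: com where
  "bfs_pop =
    Seq (Assign ''v'' (Get ''queue'' (V ''h'')))
    (Seq (Assign ''e'' (Get ''off'' (V ''v'')))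
         (Assign ''end'' (Get ''off'' (Plus (V ''v'') (N 1)))))"

definition bfs_loop :: com where
  "bfs_loop = While (Less (V ''h'') (V ''tail''))
     (Seq bfs_pop
     (Seq (While (Less (V ''e'') (V ''end'')) bfs_visit)
          (Assign ''h'' (Plus (V ''h'') (N 1)))))"

definition bfs :: com where
  "bfs = Seq bfs_reset (Seq bfs_start bfs_loop)"

lemmas bfs_defs = bfs_def bfs_reset_def bfs_start_def bfs_visit_def bfs_pop_def bfs_loop_def

lemma wreg_bfs: "wreg bfs = {''i'', ''tail'', ''h'', ''u'', ''e'', ''v'', ''end''}"
  and warr_bfs: "warr bfs = {''dist'', ''queue''}"
  by (auto simp: bfs_defs)

definition qlist :: "store \<Rightarrow> nat list" where
  "qlist s = map (arr s ''queue'') [0..<reg s ''tail'']"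

lemma length_qlist [simp]: "length (qlist s) = reg s ''tail''"
  by (simp add: qlist_def)

lemma qlist_nth: "i < reg s ''tail'' \<Longrightarrow> qlist s ! i = arr s ''queue'' i"
  by (simp add: qlist_def)

lemma qlist_cong:
  "arr s' ''queue'' = arr s ''queue'' \<Longrightarrow> reg s' ''tail'' = reg s ''tail'' \<Longrightarrow> qlist s' = qlist s"
  by (simp add: qlist_def)

locale bichromatic_run = bichromatic_instance G S off adj for G S off adj +
  fixes M q :: nat
  assumes M: "n * n + 3 * n + 4 \<le> M"
begin

definition env :: "store \<Rightarrow> bool" where
  "env s \<longleftrightarrow> reg s ''n'' = n \<and> reg s ''big'' = 3 * n \<and> reg s ''na'' = length lst \<and> reg s ''q'' = q \<and>
     (\<forall>v<n. arr s ''S'' v = of_bool (v \<in> S)) \<and> (\<forall>v\<le>n. arr s ''off'' v = off v) \<and>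
     (\<forall>e<2 * m. arr s ''adj'' e = adj e) \<and> (\<forall>i<length lst. arr s ''lst'' i = lst ! i)"

lemma env_frame:
  assumes "env s" "frame c s s'" "wreg c \<inter> {''n'', ''big'', ''na'', ''q''} = {}"
    "warr c \<inter> {''S'', ''off'', ''adj'', ''lst''} = {}"
  shows "env s'"
proof -
  have "reg s' ''n'' = reg s ''n''" "reg s' ''big'' = reg s ''big''" "reg s' ''na'' = reg s ''na''"
    "reg s' ''q'' = reg s ''q''" "arr s' ''S'' = arr s ''S''" "arr s' ''off'' = arr s ''off''"
    "arr s' ''adj'' = arr s ''adj''" "arr s' ''lst'' = arr s ''lst''"
    using assms(2-4) unfolding frame_def by blast+
  then show ?thesis using assms(1) by (simp add: env_def)
qed

lemma env_reg:
  "r ''n'' = reg s ''n'' \<Longrightarrow> r ''big'' = reg s ''big'' \<Longrightarrow> r ''na'' = reg s ''na'' \<Longrightarrow>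
   r ''q'' = reg s ''q'' \<Longrightarrow> env (s\<lparr>reg := r\<rparr>) \<longleftrightarrow> env s"
  by (simp add: env_def)

lemma env_arr:
  "r ''S'' = arr s ''S'' \<Longrightarrow> r ''off'' = arr s ''off'' \<Longrightarrow> r ''adj'' = arr s ''adj'' \<Longrightarrow>
   r ''lst'' = arr s ''lst'' \<Longrightarrow> env (s\<lparr>arr := r\<rparr>) \<longleftrightarrow> env s"
  by (simp add: env_def)

lemma na_le: "length lst \<le> M" "length lst \<le> n" "length lst \<le> 2 * m"
  using card_A card_A' M by (auto simp: length_lst)

lemma big_le: "3 * n \<le> M" and m_le_M: "2 * m \<le> M" and n_le_M: "n + 1 \<le> M"
  using M m_le by auto

definition bfs_time :: nat where "bfs_time = 100 * (m + 1)"

lemma wp_bfs_reset: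
  assumes "bnd M s" "env s"
  shows "wp M bfs_reset s (4 + length lst * 4) (\<lambda>s'. \<forall>u\<in>A. arr s' ''dist'' u = 3 * n)"
  unfolding bfs_reset_def
proof (rule wp_For[where n = "length lst" and k' = 1 and
      I = "\<lambda>i s. env s \<and> (\<forall>j<i. arr s ''dist'' (lst ! j) = 3 * n)"])
  fix i s assume s: "bnd M s" "env s \<and> (\<forall>j<i. arr s ''dist'' (lst ! j) = 3 * n)"
    "i < length lst" "reg s ''i'' = i" "reg s ''na'' = length lst"
  show "wp M (Put ''dist'' (Get ''lst'' (V ''i'')) (V ''big'')) s 1
    (\<lambda>s. env s \<and> (\<forall>j<Suc i. arr s ''dist'' (lst ! j) = 3 * n))"
    by (rule wp_straight) (use s big_le in \<open>auto simp: env_arr env_def less_Suc_eq\<close>)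
qed (use assms na_le in \<open>auto simp: env_def dest!: lst_cover\<close>)

definition bfs_state :: "nat \<Rightarrow> nat set \<Rightarrow> store \<Rightarrow> bool" where
  "bfs_state src X s \<longleftrightarrow> env s \<and> bfs_inv src (arr s ''dist'') (qlist s) (reg s ''h'') X"

lemma wp_bfs_start:
  assumes "bnd M s" "env s" "src \<in> A" "reg s ''src'' = src" "\<forall>u\<in>A. arr s ''dist'' u = 3 * n"
  shows "wp M bfs_start s 4 (\<lambda>s'. bfs_state src {} s' \<and> reg s' ''h'' = 0)"
proof (rule wp_straight)
  let ?s = "xec bfs_start s"
  have "env ?s" using assms(2) by (simp add: bfs_start_def env_def)
  moreover have "qlist ?s = [src]" using assms(4) by (simp add: bfs_start_def qlist_def)
  moreover have "reg ?s ''h'' = 0" by (simp add: bfs_start_def)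
  moreover have "arr ?s ''dist'' = (arr s ''dist'')(src := 0)"
    using assms(4) by (simp add: bfs_start_def)
  ultimately show "bfs_state src {} ?s \<and> reg ?s ''h'' = 0"
    unfolding bfs_state_def using assms(3,5) by (auto intro!: bfs_inv_init)
qed (use assms M bnd_reg in \<open>auto simp: bfs_start_def\<close>)

lemma wp_bfs_visit:
  assumes s: "bnd M s" "bfs_state src X s" "reg s ''h'' < reg s ''tail''"
    "reg s ''v'' = qlist s ! reg s ''h''" "reg s ''e'' < off (Suc (reg s ''v''))" "off (reg s ''v'') \<le> reg s ''e''"
  shows "wp M bfs_visit s 8 (\<lambda>s'. bfs_state src (insert (adj (reg s ''e'')) X) s' \<and> reg s' ''e'' = Suc (reg s ''e'') \<and>
     reg s' ''h'' = reg s ''h'' \<and> reg s' ''v'' = reg s ''v'' \<and> reg s' ''v'' = qlist s' ! reg s ''h'' \<and>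
     reg s' ''end'' = reg s ''end'' \<and> prefix (qlist s) (qlist s'))"
proof -
  let ?v = "reg s ''v''" and ?u = "adj (reg s ''e'')" and ?d = "arr s ''dist''" and ?h = "reg s ''h''"
  have inv: "bfs_inv src ?d (qlist s) ?h X" and env: "env s" using s(2) by (auto simp: bfs_state_def)
  have len: "reg s ''tail'' \<le> n" using bfs_inv_length[OF inv] by simp
  have vQ: "?v \<in> set (qlist s)" using s(3,4) by simp
  then have v: "?v < n" "?d ?v < 3 * n" using inv A_less by (auto simp: bfs_inv_def)
  have E: "(qlist s ! ?h, ?u) \<in> E"
  proof -
    have "?u \<in> adj ` {off ?v..<off (Suc ?v)}" using s(5,6) by auto
    then show ?thesis using adj_image[OF v(1)] s(4) by auto
  qed
  have e: "reg s ''e'' < 2 * m" using s(5) off_le[of "Suc ?v"] v by simp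
  have adj: "arr s ''adj'' (reg s ''e'') = ?u" using env e by (simp add: env_def)
  have u: "?u \<le> M" using bnd_arr[OF s(1), of "''adj''" "reg s ''e''"] adj by simp
  have big: "reg s ''big'' = 3 * n" using env by (simp add: env_def)
  let ?s = "xec bfs_visit s"
  show ?thesis
  proof (rule wp_straight)
    show "safe M bfs_visit s"
      using adj u len v e n_le_M m_le_M big_le
      by (auto simp: bfs_visit_def)
  next
    have env': "env ?s" using env by (simp add: bfs_visit_def env_def)
    show "bfs_state src (insert ?u X) ?s \<and> reg ?s ''e'' = Suc (reg s ''e'') \<and>
     reg ?s ''h'' = ?h \<and> reg ?s ''v'' = ?v \<and> reg ?s ''v'' = qlist ?s ! ?h \<and>
     reg ?s ''end'' = reg s ''end'' \<and> prefix (qlist s) (qlist ?s)"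
    proof (cases "?d ?u = 3 * n")
      case True
      have Q: "qlist ?s = qlist s @ [?u]"
        using True adj big by (simp add: bfs_visit_def qlist_def)
      have d: "arr ?s ''dist'' = ?d(?u := ?d (qlist s ! ?h) + 1)"
        using True adj big s(4) by (simp add: bfs_visit_def)
      have "bfs_inv src (arr ?s ''dist'') (qlist ?s) ?h (insert ?u X)"
        unfolding Q d by (rule bfs_inv_new) (use inv s(3) E True in auto)
      then show ?thesis using env' True adj big s(3,4)
        unfolding bfs_state_def Q by (simp add: bfs_visit_def nth_append)
    next
      case False
      have Q: "qlist ?s = qlist s"
        using False adj big by (simp add: bfs_visit_def qlist_def)
      have d: "arr ?s ''dist'' = ?d" using False adj big by (simp add: bfs_visit_def)
      have "bfs_inv src (arr ?s ''dist'') (qlist ?s) ?h (insert ?u X)"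
        unfolding Q d by (rule bfs_inv_old) (use inv s(3) E False in auto)
      then show ?thesis using env' False adj big s(3,4)
        unfolding bfs_state_def Q by (simp add: bfs_visit_def)
    qed
  qed (use s in \<open>auto simp: bfs_visit_def\<close>)
qed

lemma wp_bfs_inner:
  assumes s: "bnd M s" "bfs_state src {} s" "reg s ''h'' < reg s ''tail''"
    "reg s ''v'' = qlist s ! reg s ''h''" "reg s ''e'' = off (reg s ''v'')" "reg s ''end'' = off (Suc (reg s ''v''))"
  shows "wp M (While (Less (V ''e'') (V ''end'')) bfs_visit) s
     (9 * (off (Suc (reg s ''v'')) - off (reg s ''v'')) + 1)
     (\<lambda>s'. bfs_state src {u. (reg s ''v'', u) \<in> E} s' \<and> reg s' ''h'' = reg s ''h'' \<and>
       reg s ''v'' = qlist s' ! reg s ''h'' \<and> prefix (qlist s) (qlist s'))"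
proof -
  define v h where "v = reg s ''v''" and "h = reg s ''h''"
  have vQ: "v \<in> set (qlist s)" using s(3,4) by (simp add: v_def)
  then have v: "v < n" using s(2) A_less by (auto simp: bfs_inv_def bfs_state_def)
  define I where "I s' \<longleftrightarrow> bfs_state src (adj ` {off v..<reg s' ''e''}) s' \<and> reg s' ''h'' = h \<and>
    reg s' ''v'' = v \<and> v = qlist s' ! h \<and> off v \<le> reg s' ''e'' \<and> reg s' ''e'' \<le> off (Suc v) \<and>
    reg s' ''end'' = off (Suc v) \<and> prefix (qlist s) (qlist s')" for s'
  show ?thesis unfolding v_def[symmetric] h_def[symmetric]
  proof (rule wp_While[where I = I and \<Phi> = "\<lambda>s'. 9 * (off (Suc v) - reg s' ''e'')"])
    show "I s" using s off_Suc[OF v] by (simp add: I_def v_def h_def)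
  next
    fix s' assume s': "bnd M s'" "I s'" "bval (Less (V ''e'') (V ''end'')) s'"
    have I: "bfs_state src (adj ` {off v..<reg s' ''e''}) s'" "reg s' ''h'' = h"
      "reg s' ''v'' = v" "v = qlist s' ! h" "off v \<le> reg s' ''e''" "reg s' ''e'' < off (Suc v)"
      "reg s' ''end'' = off (Suc v)" "prefix (qlist s) (qlist s')"
      using s'(2,3) by (auto simp: I_def)
    have img: "insert (adj (reg s' ''e'')) (adj ` {off v..<reg s' ''e''}) = adj ` {off v..<Suc (reg s' ''e'')}"
      using I(5) by (auto simp: atLeastLessThanSuc)
    show "\<exists>k. wp M bfs_visit s' k (\<lambda>s''. I s'' \<and>
       9 * (off (Suc v) - reg s'' ''e'') + k + 1 \<le> 9 * (off (Suc v) - reg s' ''e''))"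
      by (rule exI, rule wp_conseq[OF wp_bfs_visit[OF s'(1) I(1)] _ order_refl])
         (use I s(3) h_def img prefix_length_le[OF I(8)] in \<open>auto simp: I_def\<close>)
  next
    fix s' assume s': "bnd M s'" "I s'" "\<not> bval (Less (V ''e'') (V ''end'')) s'"
    then have "reg s' ''e'' = off (Suc v)" by (auto simp: I_def)
    then show "bfs_state src {u. (v, u) \<in> E} s' \<and> reg s' ''h'' = h \<and> v = qlist s' ! h \<and> prefix (qlist s) (qlist s')"
      using s'(2) adj_image[OF v] by (auto simp: I_def)
  qed (use s in \<open>auto simp: v_def\<close>)
qed

lemma wp_bfs_loop:
  assumes s: "bnd M s" "bfs_state src {} s" "reg s ''h'' = 0"
  shows "wp M bfs_loop s (10 * card A + 18 * m + 1)
     (\<lambda>s'. bfs_state src {} s' \<and> reg s' ''h'' = reg s' ''tail'')"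
proof -
  define \<Phi> where "\<Phi> s' = (\<Sum>v\<in>A - set (take (reg s' ''h'') (qlist s')). 10 + 9 * (off (Suc v) - off v))" for s'
  show ?thesis unfolding bfs_loop_def
  proof (rule wp_While[where I = "bfs_state src {}" and \<Phi> = \<Phi>])
    have "\<Phi> s = 10 * card A + 9 * (\<Sum>v\<in>A. off (Suc v) - off v)"
      by (simp add: \<Phi>_def s(3) sum.distrib sum_distrib_left)
    then show "\<Phi> s < 10 * card A + 18 * m + 1" using deg_sum by simp
  next
    fix s assume s: "bnd M s" "bfs_state src {} s" "bval (Less (V ''h'') (V ''tail'')) s"
    then have h: "reg s ''h'' < reg s ''tail''" by simp
    define v where "v = qlist s ! reg s ''h''"
    have inv: "bfs_inv src (arr s ''dist'') (qlist s) (reg s ''h'') {}" and env: "env s"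
      using s(2) by (auto simp: bfs_state_def)
    have vQ: "v \<in> set (qlist s)" using h by (simp add: v_def)
    then have vA: "v \<in> A" and v: "v < n" using inv A_less by (auto simp: bfs_inv_def)
    have len: "reg s ''tail'' \<le> n" using bfs_inv_length[OF inv] by simp
    let ?k = "3 + ((9 * (off (Suc v) - off v) + 1) + 1)"
    let ?post = "\<lambda>s'. bfs_state src {} s' \<and> \<Phi> s' + ?k + 1 \<le> \<Phi> s"
    have "wp M (Seq bfs_pop (Seq (While (Less (V ''e'') (V ''end'')) bfs_visit)
          (Assign ''h'' (Plus (V ''h'') (N 1))))) s ?k ?post"
    proof (rule wp_Seq[OF _ order_refl], rule wp_straight)
      have offs: "arr s ''off'' v = off v" "arr s ''off'' (Suc v) = off (Suc v)"
        using env v by (auto simp: env_def)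
      have pop: "arr s ''queue'' (reg s ''h'') = v" using h by (simp add: v_def qlist_nth)
      let ?s = "xec bfs_pop s"
      show "straight bfs_pop" "steps bfs_pop \<le> 3" by (auto simp: bfs_pop_def)
      show "safe M bfs_pop s" using bnd_arr[OF s(1)] by (simp add: bfs_pop_def)
      assume b: "bnd M ?s"
      have 1: "bfs_state src {} ?s"
        using s(2) qlist_cong[of ?s s] by (simp add: bfs_state_def env_def bfs_pop_def)
      have 2: "reg ?s ''h'' = reg s ''h''" "reg ?s ''tail'' = reg s ''tail''"
        "reg ?s ''v'' = v" "reg ?s ''e'' = off v" "reg ?s ''end'' = off (Suc v)" "qlist ?s = qlist s"
        using pop offs by (auto simp: bfs_pop_def qlist_def)
      have "wp M (While (Less (V ''e'') (V ''end'')) bfs_visit) ?s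
         (9 * (off (Suc v) - off v) + 1)
         (\<lambda>s'. bfs_state src {u. (v, u) \<in> E} s' \<and> reg s' ''h'' = reg s ''h'' \<and>
           v = qlist s' ! reg s ''h'' \<and> prefix (qlist s) (qlist s'))"
        using wp_bfs_inner[OF b 1] 2 h v_def by simp
      then show "wp M (Seq (While (Less (V ''e'') (V ''end'')) bfs_visit)
          (Assign ''h'' (Plus (V ''h'') (N 1)))) ?s (9 * (off (Suc v) - off v) + 1 + 1) ?post"
      proof (rule wp_Seq[OF wp_conseq[OF _ _ order_refl] order_refl])
        fix s' assume s': "bnd M s'" "bfs_state src {u. (v, u) \<in> E} s' \<and> reg s' ''h'' = reg s ''h'' \<and>
           v = qlist s' ! reg s ''h'' \<and> prefix (qlist s) (qlist s')"
        then have h': "reg s ''h'' < reg s' ''tail''" and pre: "prefix (qlist s) (qlist s')"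
          using h prefix_length_le[of "qlist s" "qlist s'"] by auto
        let ?t = "xec (Assign ''h'' (Plus (V ''h'') (N 1))) s'"
        have inv': "bfs_inv src (arr s' ''dist'') (qlist s') (reg s ''h'') {u. (v, u) \<in> E}"
          using s' unfolding bfs_state_def by metis
        show "wp M (Assign ''h'' (Plus (V ''h'') (N 1))) s' 1 ?post"
        proof (rule wp_straight)
          have Q: "qlist ?t = qlist s'" by (simp add: qlist_def)
          have "bfs_inv src (arr s' ''dist'') (qlist s') (Suc (reg s ''h'')) {}"
            by (rule bfs_inv_advance[OF inv']) (use s' h' in auto)
          then have st: "bfs_state src {} ?t"
            using s' Q by (simp add: bfs_state_def env_reg)
          have "distinct (qlist s')" using inv' by (simp add: bfs_inv_def)
          then have nv: "v \<notin> set (take (reg s ''h'') (qlist s'))"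
            using s' h' by (auto simp: in_set_conv_nth nth_eq_iff_index_eq)
          show "?post ?t"
          proof
            show "bfs_state src {} ?t" by (rule st)
            let ?f = "\<lambda>v. 10 + 9 * (off (Suc v) - off v)"
            have "take (reg s ''h'') (qlist s') = take (reg s ''h'') (qlist s)"
              using pre h by (auto simp: prefix_def)
            moreover have "set (take (Suc (reg s ''h'')) (qlist s')) = insert v (set (take (reg s ''h'') (qlist s')))"
              using s' h' by (simp add: take_Suc_conv_app_nth)
            ultimately have "\<Phi> s = (\<Sum>v\<in>insert v (A - set (take (Suc (reg s ''h'')) (qlist s'))). ?f v)"
              unfolding \<Phi>_def using nv vA by (intro sum.cong) auto
            also have "\<dots> = ?f v + (\<Sum>v\<in>A - set (take (Suc (reg s ''h'')) (qlist s')). ?f v)"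
              using s' h' finite_A by (subst sum.insert) (auto simp: take_Suc_conv_app_nth)
            also have "\<dots> = ?f v + \<Phi> ?t" using s' Q by (simp add: \<Phi>_def)
            finally show "\<Phi> ?t + ?k + 1 \<le> \<Phi> s" by simp
          qed
        qed (use s' h len n_le_M s in auto)
      qed
    qed (use s in auto)
    then show "\<exists>k. wp M (Seq bfs_pop (Seq (While (Less (V ''e'') (V ''end'')) bfs_visit)
          (Assign ''h'' (Plus (V ''h'') (N 1))))) s k (\<lambda>s'. bfs_state src {} s' \<and> \<Phi> s' + k + 1 \<le> \<Phi> s)"
      by blast
  next
    fix s assume "bnd M s" "bfs_state src {} s" "\<not> bval (Less (V ''h'') (V ''tail'')) s"
    then show "bfs_state src {} s \<and> reg s ''h'' = reg s ''tail''"
      by (auto simp: bfs_state_def bfs_inv_def)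
  qed (use s in auto)
qed

definition bfs_done :: "nat \<Rightarrow> store \<Rightarrow> bool" where
  "bfs_done src s \<longleftrightarrow> (\<forall>u\<in>A. arr s ''dist'' u = D src u) \<and> bfs_order src (qlist s)"

lemma wp_bfs:
  assumes "bnd M s" "env s" "src \<in> A" "reg s ''src'' = src"
  shows "wp M bfs s bfs_time (bfs_done src)"
  unfolding bfs_def
proof (rule wp_Seq[OF wp_conseq[OF wp_bfs_reset[OF assms(1,2)] _ order_refl]])
  fix s1 assume s1: "bnd M s1" "frame bfs_reset s s1" "\<forall>u\<in>A. arr s1 ''dist'' u = 3 * n"
  have e1: "env s1" by (rule env_frame[OF assms(2) s1(2)]) (auto simp: bfs_reset_def)
  have r1: "reg s1 ''src'' = src" using s1(2) assms(4) by (simp add: frame_def bfs_reset_def)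
  show "wp M (Seq bfs_start bfs_loop) s1 (4 + (10 * card A + 18 * m + 1)) (bfs_done src)"
  proof (rule wp_Seq[OF wp_conseq[OF wp_bfs_start[OF s1(1) e1 assms(3) r1 s1(3)] _ order_refl] order_refl])
    fix s2 assume s2: "bnd M s2" "frame bfs_start s1 s2" "bfs_state src {} s2 \<and> reg s2 ''h'' = 0"
    then show "wp M bfs_loop s2 (10 * card A + 18 * m + 1) (bfs_done src)"
    proof (intro wp_conseq[OF wp_bfs_loop[OF s2(1)] _ order_refl]; elim conjE)
      fix s' assume "bfs_state src {} s'" "reg s' ''h'' = reg s' ''tail''"
      then have "bfs_inv src (arr s' ''dist'') (qlist s') (length (qlist s')) {}"
        by (simp add: bfs_state_def)
      from bfs_inv_final[OF this A_less[OF assms(3)]] show "bfs_done src s'"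
        by (simp add: bfs_done_def)
    qed
  qed
qed (use card_A length_lst in \<open>auto simp: bfs_time_def\<close>)

end

section \<open>Subroutines\<close>

definition argmin_S :: "string \<Rightarrow> com" where
  "argmin_S a = Seq (Assign ''mn'' (V ''big'')) (For ''i'' ''na''
     (Seq (Assign ''v'' (Get ''lst'' (V ''i'')))
       (If (And (Equal (Get ''S'' (V ''v'')) (N 1)) (Not (Less (V ''mn'') (Get a (V ''v'')))))
         (Seq (Assign ''mn'' (Get a (V ''v''))) (Assign ''sm'' (V ''v'')))
         Skip)))"

definition argmax_T :: com where
  "argmax_T = Seq (Assign ''mxv'' (N 0)) (For ''i'' ''na''
     (Seq (Assign ''v'' (Get ''lst'' (V ''i'')))
       (If (And (Equal (Get ''S'' (V ''v'')) (N 0)) (Not (Less (Get ''dist'' (V ''v'')) (V ''mxv''))))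
         (Seq (Assign ''mxv'' (Get ''dist'' (V ''v''))) (Assign ''far'' (V ''v'')))
         Skip)))"

definition upd_mx :: com where
  "upd_mx = For ''i'' ''na''
     (Seq (Assign ''v'' (Get ''lst'' (V ''i'')))
       (If (Less (Get ''mx'' (V ''v'')) (Get ''dist'' (V ''v'')))
         (Put ''mx'' (V ''v'') (Get ''dist'' (V ''v'')))
         Skip))"

definition candidate :: com where
  "candidate = Seq (Assign ''src'' (V ''sm'')) (Seq bfs (Seq argmax_T
     (If (Less (V ''mxv'') (V ''best'')) (Assign ''best'' (V ''mxv'')) Skip)))"

lemma wreg_argmin_S: "wreg (argmin_S a) = {''mn'', ''i'', ''v'', ''sm''}"
  and warr_argmin_S: "warr (argmin_S a) = {}"
  and wreg_argmax_T: "wreg argmax_T = {''mxv'', ''i'', ''v'', ''far''}"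
  and warr_argmax_T: "warr argmax_T = {}"
  and wreg_upd_mx: "wreg upd_mx = {''i'', ''v''}"
  and warr_upd_mx: "warr upd_mx = {''mx''}"
  by (auto simp: argmin_S_def argmax_T_def upd_mx_def)

lemma wreg_candidate: "wreg candidate = {''src'', ''best'', ''mxv'', ''far''} \<union> wreg bfs"
  and warr_candidate: "warr candidate = warr bfs"
  by (auto simp: candidate_def wreg_argmax_T warr_argmax_T wreg_bfs)

lemmas written = wreg_bfs warr_bfs wreg_argmin_S warr_argmin_S wreg_argmax_T warr_argmax_T
  wreg_upd_mx warr_upd_mx wreg_candidate warr_candidate

context bichromatic_run
begin

lemma env_lst: "env s \<Longrightarrow> i < length lst \<Longrightarrow> arr s ''lst'' i = lst ! i"
  and env_na: "env s \<Longrightarrow> reg s ''na'' = length lst"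
  and env_big: "env s \<Longrightarrow> reg s ''big'' = 3 * n"
  and env_q: "env s \<Longrightarrow> reg s ''q'' = q"
  and env_S: "env s \<Longrightarrow> v < n \<Longrightarrow> arr s ''S'' v = of_bool (v \<in> S)"
  by (auto simp: env_def)

lemma lst_less: "i < length lst \<Longrightarrow> lst ! i < n"
  using lst_nth A_less by blast

lemma wp_argmin_S:
  assumes s: "bnd M s" "env s" and f: "f = arr s a" "\<forall>u\<in>A. f u \<le> 3 * n" and ne: "S \<inter> A \<noteq> {}"
  shows "wp M (argmin_S a) s (20 * (m + 1))
     (\<lambda>s'. reg s' ''sm'' \<in> S \<inter> A \<and> (\<forall>u\<in>S \<inter> A. f (reg s' ''sm'') \<le> f u))"
  unfolding argmin_S_def
proof (rule wp_Seq[where ka = 1], rule wp_straight)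
  let ?s = "xec (Assign ''mn'' (V ''big'')) s"
  assume b: "bnd M ?s"
  define I where "I i s \<longleftrightarrow> env s \<and> arr s a = f \<and> reg s ''mn'' \<le> 3 * n \<and>
    (\<forall>j<i. lst ! j \<in> S \<longrightarrow> reg s ''mn'' \<le> f (lst ! j)) \<and>
    ((\<forall>j<i. lst ! j \<notin> S) \<or> reg s ''sm'' \<in> S \<inter> A \<and> reg s ''mn'' = f (reg s ''sm''))
    \<and> ((\<forall>j<i. lst ! j \<notin> S) \<longrightarrow> reg s ''mn'' = 3 * n)" for i s
  let ?c = "Seq (Assign ''v'' (Get ''lst'' (V ''i'')))
       (If (And (Equal (Get ''S'' (V ''v'')) (N 1)) (Not (Less (V ''mn'') (Get a (V ''v'')))))
         (Seq (Assign ''mn'' (Get a (V ''v''))) (Assign ''sm'' (V ''v'')))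
         Skip)"
  show "wp M (For ''i'' ''na'' ?c) ?s (4 + length lst * (4 + 3))
    (\<lambda>s'. reg s' ''sm'' \<in> S \<inter> A \<and> (\<forall>u\<in>S \<inter> A. f (reg s' ''sm'') \<le> f u))"
  proof (rule wp_For[where n = "length lst" and k' = 4 and I = I])
    show "I 0 ?s" using s f by (simp add: I_def env_reg env_big)
  next
    fix i s v assume "I i s"
    then show "I i (s\<lparr>reg := (reg s)(''i'' := v)\<rparr>)" by (simp add: I_def env_reg)
  next
    fix i s assume s: "bnd M s" "I i s" "i < length lst" "reg s ''i'' = i" "reg s ''na'' = length lst"
    have "f (lst ! i) \<le> 3 * n" using f(2) lst_nth[OF s(3)] by auto
    then have fl: "f (lst ! i) \<le> 3 * n" "f (lst ! i) \<le> M" using big_le by auto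
    have e: "env s" "arr s a = f" and l: "arr s ''lst'' i = lst ! i"
      "arr s ''S'' (lst ! i) = of_bool (lst ! i \<in> S)"
      using s env_lst env_S lst_less by (auto simp: I_def)
    show "wp M ?c s 4 (I (Suc i))"
    proof (rule wp_straight)
      show "safe M ?c s" using s(4) e l fl bnd_arr[OF s(1)] lst_less[OF s(3)] n_le_M by simp
      show "I (Suc i) (xec ?c s)"
        using s(2,4) e l fl lst_nth[OF s(3)] unfolding I_def
        by (auto simp: env_reg env_arr less_Suc_eq)
    qed (use s in auto)
  next
    fix s assume s: "I (length lst) s"
    obtain u where "u \<in> S" "u \<in> A" using ne by auto
    then have "\<not> (\<forall>j<length lst. lst ! j \<notin> S)" using lst_cover by blast
    then show "reg s ''sm'' \<in> S \<inter> A \<and> (\<forall>u\<in>S \<inter> A. f (reg s ''sm'') \<le> f u)"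
      using s lst_cover unfolding I_def by (metis IntD1 IntD2)
  qed (use b na_le env_na[OF s(2)] in auto)
qed (use s big_le na_le in \<open>auto simp: env_big\<close>)

lemma wp_argmax_T:
  assumes s: "bnd M s" "env s" and d: "\<forall>u\<in>A. arr s ''dist'' u = D v u" and TA: "T \<subseteq> A"
  shows "wp M argmax_T s (20 * (m + 1))
     (\<lambda>s'. reg s' ''mxv'' = ecc v \<and> reg s' ''far'' \<in> T \<and> D v (reg s' ''far'') = ecc v)"
  unfolding argmax_T_def
proof (rule wp_Seq[where ka = 1], rule wp_straight)
  let ?s = "xec (Assign ''mxv'' (N 0)) s"
  assume b: "bnd M ?s"
  define I where "I i s \<longleftrightarrow> env s \<and> (\<forall>u\<in>A. arr s ''dist'' u = D v u) \<and>
    (\<forall>j<i. lst ! j \<in> T \<longrightarrow> D v (lst ! j) \<le> reg s ''mxv'') \<and>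
    ((\<forall>j<i. lst ! j \<notin> T) \<or> reg s ''far'' \<in> T \<and> reg s ''mxv'' = D v (reg s ''far''))
    \<and> ((\<forall>j<i. lst ! j \<notin> T) \<longrightarrow> reg s ''mxv'' = 0)" for i s
  let ?c = "Seq (Assign ''v'' (Get ''lst'' (V ''i'')))
       (If (And (Equal (Get ''S'' (V ''v'')) (N 0)) (Not (Less (Get ''dist'' (V ''v'')) (V ''mxv''))))
         (Seq (Assign ''mxv'' (Get ''dist'' (V ''v''))) (Assign ''far'' (V ''v'')))
         Skip)"
  show "wp M (For ''i'' ''na'' ?c) ?s (4 + length lst * (4 + 3))
    (\<lambda>s'. reg s' ''mxv'' = ecc v \<and> reg s' ''far'' \<in> T \<and> D v (reg s' ''far'') = ecc v)"
  proof (rule wp_For[where n = "length lst" and k' = 4 and I = I])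
    show "I 0 ?s" using s d by (simp add: I_def env_reg)
  next
    fix i s v assume "I i s"
    then show "I i (s\<lparr>reg := (reg s)(''i'' := v)\<rparr>)" by (simp add: I_def env_reg)
  next
    fix i s assume s: "bnd M s" "I i s" "i < length lst" "reg s ''i'' = i" "reg s ''na'' = length lst"
    have e: "env s" and l: "arr s ''lst'' i = lst ! i" "arr s ''dist'' (lst ! i) = D v (lst ! i)"
      "arr s ''S'' (lst ! i) = of_bool (lst ! i \<notin> T)"
      using s env_lst env_S lst_less T_iff lst_nth by (auto simp: I_def)
    show "wp M ?c s 4 (I (Suc i))"
    proof (rule wp_straight)
      show "safe M ?c s" using s(4) e l bnd_arr[OF s(1), of "''dist''" "lst ! i"] lst_less[OF s(3)] n_le_M by simp
      show "I (Suc i) (xec ?c s)"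
        using s(2,4) e l lst_nth[OF s(3)] unfolding I_def
        by (auto simp: env_reg env_arr less_Suc_eq)
    qed (use s in auto)
  next
    fix s assume s: "I (length lst) s"
    obtain t where t: "t \<in> T" "ecc v = D v t" using ecc_attained by auto
    have cov: "\<exists>j<length lst. lst ! j = u" if "u \<in> T" for u using that TA lst_cover by auto
    then have ne: "\<not> (\<forall>j<length lst. lst ! j \<notin> T)" using t by metis
    then have far: "reg s ''far'' \<in> T" "reg s ''mxv'' = D v (reg s ''far'')" using s by (auto simp: I_def)
    have "D v u \<le> reg s ''mxv''" if "u \<in> T" for u
      using s cov[OF that] that unfolding I_def by metis
    then have "ecc v = reg s ''mxv''" using far t ecc_le_iff[of v "ecc v"] by (metis antisym order_refl)
    then show "reg s ''mxv'' = ecc v \<and> reg s ''far'' \<in> T \<and> D v (reg s ''far'') = ecc v"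
      using far by simp
  qed (use b na_le env_na[OF s(2)] in auto)
qed (use s M na_le in auto)

lemma wp_upd_mx:
  assumes s: "bnd M s" "env s"
  shows "wp M upd_mx s (20 * (m + 1))
     (\<lambda>s'. \<forall>u\<in>A. arr s' ''mx'' u = max (arr s ''mx'' u) (arr s ''dist'' u))"
  unfolding upd_mx_def
proof -
  define f g where "f = arr s ''mx''" and "g = arr s ''dist''"
  define I where "I i s \<longleftrightarrow> env s \<and> arr s ''dist'' = g \<and>
    (\<forall>j<i. arr s ''mx'' (lst ! j) = max (f (lst ! j)) (g (lst ! j))) \<and>
    (\<forall>j<length lst. i \<le> j \<longrightarrow> arr s ''mx'' (lst ! j) = f (lst ! j))" for i s
  let ?c = "Seq (Assign ''v'' (Get ''lst'' (V ''i'')))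
       (If (Less (Get ''mx'' (V ''v'')) (Get ''dist'' (V ''v'')))
         (Put ''mx'' (V ''v'') (Get ''dist'' (V ''v'')))
         Skip)"
  have "wp M (For ''i'' ''na'' ?c) s (20 * (m + 1))
     (\<lambda>s'. \<forall>u\<in>A. arr s' ''mx'' u = max (f u) (g u))"
  proof (rule wp_For[where n = "length lst" and k' = 3 and I = I])
    show "I 0 s" using s by (simp add: I_def f_def g_def)
  next
    fix i s v assume "I i s"
    then show "I i (s\<lparr>reg := (reg s)(''i'' := v)\<rparr>)" by (simp add: I_def env_reg)
  next
    fix i s assume s: "bnd M s" "I i s" "i < length lst" "reg s ''i'' = i" "reg s ''na'' = length lst"
    have e: "env s" and l: "arr s ''lst'' i = lst ! i"
      using s env_lst by (auto simp: I_def)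
    have ne: "lst ! j \<noteq> lst ! i" if "j < length lst" "j \<noteq> i" for j
      using that s(3) distinct_lst by (simp add: nth_eq_iff_index_eq)
    show "wp M ?c s 3 (I (Suc i))"
    proof (rule wp_straight)
      show "safe M ?c s" using s(4) e l bnd_arr[OF s(1), of "''dist''" "lst ! i"] lst_less[OF s(3)] n_le_M by simp
      show "I (Suc i) (xec ?c s)"
        using s(2,3,4) e l ne unfolding I_def
        by (auto simp: env_reg env_arr less_Suc_eq)
    qed (use s in auto)
  next
    fix s assume s: "I (length lst) s"
    then show "\<forall>u\<in>A. arr s ''mx'' u = max (f u) (g u)" using lst_cover unfolding I_def by metis
  qed (use s na_le env_na[OF s(2)] in auto)
  then show "wp M (For ''i'' ''na'' ?c) s (20 * (m + 1))
     (\<lambda>s'. \<forall>u\<in>A. arr s' ''mx'' u = max (arr s ''mx'' u) (arr s ''dist'' u))"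
    by (simp add: f_def g_def)
qed

lemma wp_candidate:
  assumes s: "bnd M s" "env s" and sm: "reg s ''sm'' = v" "v \<in> A" and TA: "T \<subseteq> A"
  shows "wp M candidate s (124 * (m + 1))
     (\<lambda>s'. reg s' ''best'' = min (reg s ''best'') (ecc v) \<and>
        reg s' ''far'' \<in> T \<and> D v (reg s' ''far'') = ecc v)"
  unfolding candidate_def
proof (rule wp_Seq[where ka = 1], rule wp_straight)
  let ?s = "xec (Assign ''src'' (V ''sm'')) s"
  let ?b = "If (Less (V ''mxv'') (V ''best'')) (Assign ''best'' (V ''mxv'')) Skip"
  let ?Q = "\<lambda>s'. reg s' ''best'' = min (reg s ''best'') (ecc v) \<and>
        reg s' ''far'' \<in> T \<and> D v (reg s' ''far'') = ecc v"
  assume b: "bnd M ?s"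
  have e: "env ?s" using s(2) by (simp add: env_reg)
  show "wp M (Seq bfs (Seq argmax_T ?b)) ?s (bfs_time + (20 * (m + 1) + 2)) ?Q"
  proof (rule wp_Seq[OF wp_conseq[OF wp_bfs[OF b e sm(2)] _ order_refl] order_refl])
    fix s1 assume s1: "bnd M s1" "frame bfs ?s s1" "bfs_done v s1"
    have e1: "env s1" by (rule env_frame[OF e s1(2)]) (auto simp: written)
    have best1: "reg s1 ''best'' = reg s ''best''" using s1(2) by (simp add: frame_def written)
    have d: "\<forall>u\<in>A. arr s1 ''dist'' u = D v u" using s1(3) by (simp add: bfs_done_def)
    show "wp M (Seq argmax_T ?b) s1 (20 * (m + 1) + 2) ?Q"
    proof (rule wp_Seq[OF wp_conseq[OF wp_argmax_T[OF s1(1) e1 d TA] _ order_refl] order_refl])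
      fix s2 assume s2: "bnd M s2" "frame argmax_T s1 s2"
        "reg s2 ''mxv'' = ecc v \<and> reg s2 ''far'' \<in> T \<and> D v (reg s2 ''far'') = ecc v"
      have "reg s2 ''best'' = reg s ''best''" using s2(2) best1 by (simp add: frame_def written)
      moreover have "ecc v \<le> M" using s2 bnd_reg[OF s2(1), of "''mxv''"] by simp
      ultimately show "wp M ?b s2 2 ?Q" using s2
        by (intro wp_straight) (auto simp: min_def)
    qed
  qed (use sm in auto)
qed (use s sm A_less[OF sm(2)] n_le_M in \<open>auto simp: bfs_time_def\<close>)

end

section \<open>The main phase\<close>

definition sample_round :: com where
  "sample_round = Seq (Assign ''src'' (Get ''smp'' (V ''j'')))
     (If (Equal (Get ''S'' (V ''src'')) (N 0)) (Seq bfs upd_mx) Skip)"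

definition radius_step :: com where
  "radius_step = Seq (If (Less (V ''q'') (V ''tail''))
       (Assign ''rd'' (Get ''dist'' (Get ''queue'' (V ''q''))))
       (Assign ''rd'' (V ''big'')))
     (If (Not (Less (V ''rd'') (V ''bestr'')))
       (Seq (Assign ''bestr'' (V ''rd'')) (Assign ''bw'' (V ''src'')))
       Skip)"

definition greedy_round :: com where
  "greedy_round = Seq (argmin_S ''mx'') (Seq candidate
     (Seq (Assign ''src'' (V ''far'')) (Seq bfs (Seq upd_mx radius_step))))"

definition select :: com where
  "select = Seq (Put ''cnt'' (Get ''S'' (V ''src'')) (Plus (Get ''cnt'' (Get ''S'' (V ''src''))) (N 1)))
     (Seq bfs (Seq (argmin_S ''dist'') candidate))"

definition final_round :: com where
  "final_round = Seq (Assign ''src'' (Get ''q2'' (V ''j'')))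
     (If (Less (Get ''cnt'' (Get ''S'' (V ''src''))) (V ''q'')) select Skip)"

definition copy_queue :: com where
  "copy_queue = Seq (Seq (Assign ''n2'' (V ''tail''))
     (Seq (Put ''cnt'' (N 0) (N 0)) (Put ''cnt'' (N 1) (N 0))))
     (For ''j'' ''n2'' (Put ''q2'' (V ''j'') (Get ''queue'' (V ''j''))))"

definition final_phase :: com where
  "final_phase = Seq (Assign ''src'' (V ''bw'')) (Seq bfs (Seq copy_queue
     (For ''j'' ''n2'' final_round)))"

definition main_phase :: com where
  "main_phase = Seq (Assign ''best'' (V ''big'')) (Seq (For ''j'' ''K'' sample_round)
     (Seq (Assign ''bestr'' (N 0)) (Seq (For ''j'' ''q'' greedy_round) (Seq final_phase
     (If (Less (V ''best'') (V ''big'')) (Assign ''out'' (V ''best'')) (Assign ''inf'' (N 1)))))))"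

lemmas phase_defs = sample_round_def radius_step_def greedy_round_def select_def final_round_def
  copy_queue_def final_phase_def

lemma frame_reg: "frame c s s' \<Longrightarrow> x \<notin> wreg c \<Longrightarrow> reg s' x = reg s x"
  and frame_arr: "frame c s s' \<Longrightarrow> a \<notin> warr c \<Longrightarrow> arr s' a = arr s a"
  by (auto simp: frame_def)

context bichromatic_run
begin

definition maxd :: "nat set \<Rightarrow> nat \<Rightarrow> nat" where
  "maxd W u = Max (insert 0 ((\<lambda>w. D w u) ` W))"

lemma maxd_empty [simp]: "maxd {} u = 0"
  by (simp add: maxd_def)

lemma maxd_insert: "finite W \<Longrightarrow> maxd (insert w W) u = max (maxd W u) (D w u)"
  unfolding maxd_def image_insert by (subst insert_commute, subst Max_insert) (auto simp: max.commute)

lemma maxd_ge: "finite W \<Longrightarrow> w \<in> W \<Longrightarrow> D w u \<le> maxd W u"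
  unfolding maxd_def by (intro Max_ge) auto

lemma maxd_attained: "finite W \<Longrightarrow> W \<noteq> {} \<Longrightarrow> \<exists>w\<in>W. maxd W u = D w u"
proof -
  assume W: "finite W" "W \<noteq> {}"
  have "maxd W u \<in> insert 0 ((\<lambda>w. D w u) ` W)" unfolding maxd_def using W by (intro Max_in) auto
  then consider "maxd W u = 0" | "\<exists>w\<in>W. maxd W u = D w u" by auto
  then show ?thesis
  proof cases
    case 1
    obtain w where "w \<in> W" using W by auto
    with 1 show ?thesis using maxd_ge[OF W(1), of w u] by auto
  qed
qed

lemma maxd_le:
  assumes "finite W" "W \<subseteq> {0..<n}"
  shows "maxd W u \<le> 3 * n"
  unfolding maxd_def using assms D_le_big by (subst Max_le_iff) auto

lemma reach_A:
  assumes "v \<in> A" "u < n" "D v u < 3 * n"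
  shows "u \<in> A"
proof -
  have "(v, u) \<in> E\<^sup>*" using reach_iff[of v u] assms A_less by auto
  then show ?thesis using assms(1) E_sym A_iff by (metis rtranclE)
qed

lemma gball_bfs_order:
  assumes "v \<in> A" "bfs_order v Q" "r < 3 * n"
  shows "gball v r = {u \<in> set Q. D v u \<le> r}"
proof -
  have "set Q = {u\<in>A. D v u < 3 * n}" using assms(2) by (simp add: bfs_order_def)
  then show ?thesis using reach_A[OF assms(1)] A_less assms(3) by (auto simp: gball_def)
qed

lemma wp_sample_loop:
  assumes s: "bnd M s" "env s" and K: "reg s ''K'' = K" "\<And>j. j < K \<Longrightarrow> arr s ''smp'' j = w j"
    and w: "\<And>j. j < K \<Longrightarrow> w j < n" and mx: "\<forall>u\<in>A. arr s ''mx'' u = 0" and TA: "T \<subseteq> A"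
  shows "wp M (For ''j'' ''K'' sample_round) s (4 + K * (130 * (m + 1)))
     (\<lambda>s'. \<forall>u\<in>A. arr s' ''mx'' u = maxd (w ` {..<K} \<inter> T) u)"
proof (rule wp_For[where n = K and k' = "123 * (m + 1)" and
      I = "\<lambda>i s. env s \<and> (\<forall>j<K. arr s ''smp'' j = w j) \<and>
        (\<forall>u\<in>A. arr s ''mx'' u = maxd (w ` {..<i} \<inter> T) u)"])
  show "env s \<and> (\<forall>j<K. arr s ''smp'' j = w j) \<and> (\<forall>u\<in>A. arr s ''mx'' u = maxd (w ` {..<0} \<inter> T) u)"
    using s K mx by simp
next
  fix i s
  assume b: "bnd M s" and inv: "env s \<and> (\<forall>j<K. arr s ''smp'' j = w j) \<and>
        (\<forall>u\<in>A. arr s ''mx'' u = maxd (w ` {..<i} \<inter> T) u)"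
    and i: "i < K" "reg s ''j'' = i"
  let ?P = "\<lambda>s. env s \<and> (\<forall>j<K. arr s ''smp'' j = w j) \<and>
        (\<forall>u\<in>A. arr s ''mx'' u = maxd (w ` {..<Suc i} \<inter> T) u)"
  let ?s = "xec (Assign ''src'' (Get ''smp'' (V ''j''))) s"
  have wi: "w i < n" using w i by simp
  show "wp M sample_round s (123 * (m + 1)) ?P"
    unfolding sample_round_def
  proof (rule wp_Seq[where ka = 1], rule wp_straight)
    assume b1: "bnd M ?s"
    have e1: "env ?s" using inv by (simp add: env_reg)
    have src: "reg ?s ''src'' = w i" using inv i by simp
    have S: "arr ?s ''S'' (w i) = of_bool (w i \<in> S)" using env_S[OF e1 wi] .
    have img: "w ` {..<Suc i} = insert (w i) (w ` {..<i})" by (auto simp: less_Suc_eq)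
    show "wp M (If (Equal (Get ''S'' (V ''src'')) (N 0)) (Seq bfs upd_mx) Skip) ?s (122 * (m + 1)) ?P"
    proof (rule wp_If[where k' = "120 * (m + 1)"])
      assume "bval (Equal (Get ''S'' (V ''src'')) (N 0)) ?s"
      then have wT: "w i \<in> T" using S src T_iff[OF wi] by simp
      then have wA: "w i \<in> A" using TA by auto
      show "wp M (Seq bfs upd_mx) ?s (120 * (m + 1)) ?P"
      proof (rule wp_Seq[OF wp_conseq[OF wp_bfs[OF b1 e1 wA src] _ order_refl]])
        fix s1 assume s1: "bnd M s1" "frame bfs ?s s1" "bfs_done (w i) s1"
        have e2: "env s1" by (rule env_frame[OF e1 s1(2)]) (auto simp: written)
        have keep: "arr s1 ''smp'' = arr s ''smp''" "arr s1 ''mx'' = arr s ''mx''"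
          using s1(2) by (auto simp: frame_def written)
        show "wp M upd_mx s1 (20 * (m + 1)) ?P"
        proof (rule wp_conseq[OF wp_upd_mx[OF s1(1) e2] _ order_refl])
          fix s2 assume s2: "bnd M s2" "frame upd_mx s1 s2"
            "\<forall>u\<in>A. arr s2 ''mx'' u = max (arr s1 ''mx'' u) (arr s1 ''dist'' u)"
          have "env s2" by (rule env_frame[OF e2 s2(2)]) (auto simp: written)
          moreover have "arr s2 ''smp'' = arr s ''smp''"
            using s2(2) keep by (auto simp: frame_def written)
          moreover have "arr s2 ''mx'' u = maxd (w ` {..<Suc i} \<inter> T) u" if "u \<in> A" for u
            using s2(3) s1(3) inv that keep wT by (simp add: img maxd_insert bfs_done_def)
          ultimately show "?P s2" using inv by simp
        qed
      qed (simp add: bfs_time_def)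
    next
      assume "\<not> bval (Equal (Get ''S'' (V ''src'')) (N 0)) ?s"
      then have "w i \<notin> T" using S src T_iff[OF wi] by simp
      then show "wp M Skip ?s (120 * (m + 1)) ?P"
        using e1 b1 inv by (intro wp_Skip) (auto simp: img)
    qed (use b1 in auto)
  qed (use b bnd_arr[OF b] in auto)
qed (use s K bnd_reg[OF s(1), of "''K''"] in \<open>auto simp: env_reg sample_round_def written algebra_simps\<close>)

definition is_rad :: "nat \<Rightarrow> nat \<Rightarrow> bool" where
  "is_rad w \<rho> \<longleftrightarrow> (\<forall>r<3 * n. card (gball w r) \<le> q \<longleftrightarrow> r < \<rho>)"

lemma is_rad_bfs:
  assumes "w \<in> A" "bfs_order w Q"
  shows "is_rad w (if q < length Q then D w (Q ! q) else 3 * n)"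
  unfolding is_rad_def
proof (intro allI impI)
  fix r assume r: "r < 3 * n"
  note ball = gball_bfs_order[OF assms r]
  have mono: "D w (Q ! i) \<le> D w (Q ! j)" if "i \<le> j" "j < length Q" for i j
    using assms(2) that unfolding bfs_order_def by blast
  have dist: "distinct Q" using assms(2) by (simp add: bfs_order_def)
  show "card (gball w r) \<le> q \<longleftrightarrow> r < (if q < length Q then D w (Q ! q) else 3 * n)"
  proof (cases "q < length Q")
    case q: True
    show ?thesis
    proof (cases "r < D w (Q ! q)")
      case True
      have "gball w r \<subseteq> set (take q Q)"
      proof
        fix u assume "u \<in> gball w r"
        then obtain k where k: "k < length Q" "u = Q ! k" "D w (Q ! k) \<le> r"
          unfolding ball by (auto simp: in_set_conv_nth)
        then have "\<not> q \<le> k" using mono[of q k] True by auto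
        then show "u \<in> set (take q Q)" using k q by (auto simp: in_set_conv_nth intro!: exI[of _ k])
      qed
      then have "card (gball w r) \<le> card (set (take q Q))" by (intro card_mono) auto
      also have "\<dots> \<le> q" using card_length[of "take q Q"] by simp
      finally show ?thesis using True q by simp
    next
      case False
      have "set (take (Suc q) Q) \<subseteq> gball w r"
      proof
        fix u assume "u \<in> set (take (Suc q) Q)"
        then obtain k where k: "k < length Q" "k \<le> q" "u = Q ! k"
          by (auto simp: in_set_conv_nth)
        then have "D w u \<le> r" using mono[of k q] q False by simp
        then show "u \<in> gball w r" unfolding ball using k by simp
      qed
      then have "card (set (take (Suc q) Q)) \<le> card (gball w r)" by (intro card_mono finite_gball)
      moreover have "card (set (take (Suc q) Q)) = Suc q"
        using dist q by (simp add: distinct_card)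
      ultimately show ?thesis using False q by simp
    qed
  next
    case False
    have "card (gball w r) \<le> card (set Q)" unfolding ball by (intro card_mono) auto
    also have "\<dots> \<le> q" using card_length[of Q] False by simp
    finally show ?thesis using False r by simp
  qed
qed

lemma wp_radius_step:
  assumes s: "bnd M s" "env s" and w: "w \<in> A" "reg s ''src'' = w" "bfs_done w s"
  shows "wp M radius_step s 5 (\<lambda>s'. \<exists>\<rho>. is_rad w \<rho> \<and>
     (if \<rho> < reg s ''bestr'' then reg s' ''bestr'' = reg s ''bestr'' \<and> reg s' ''bw'' = reg s ''bw''
      else reg s' ''bestr'' = \<rho> \<and> reg s' ''bw'' = w))"
proof (rule wp_straight)
  define \<rho> where "\<rho> = (if q < reg s ''tail'' then D w (qlist s ! q) else 3 * n)"
  have "is_rad w \<rho>" using is_rad_bfs[OF w(1), of "qlist s"] w(3) by (simp add: bfs_done_def \<rho>_def)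
  have Q: "D w (qlist s ! q) = arr s ''dist'' (arr s ''queue'' q)" if "q < reg s ''tail''"
  proof -
    have "qlist s ! q \<in> set (qlist s)" using that by simp
    then have "qlist s ! q \<in> A" using w(3) by (auto simp: bfs_done_def bfs_order_def)
    then show ?thesis using w(3) that by (simp add: bfs_done_def qlist_nth)
  qed
  show "safe M radius_step s"
    using bnd_arr[OF s(1)] bnd_reg[OF s(1)] by (simp add: radius_step_def)
  show "\<exists>\<rho>. is_rad w \<rho> \<and>
     (if \<rho> < reg s ''bestr'' then reg (xec radius_step s) ''bestr'' = reg s ''bestr'' \<and>
       reg (xec radius_step s) ''bw'' = reg s ''bw''
      else reg (xec radius_step s) ''bestr'' = \<rho> \<and> reg (xec radius_step s) ''bw'' = w)"
    using \<open>is_rad w \<rho>\<close> Q w(2) env_q[OF s(2)] env_big[OF s(2)]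
    by (intro exI[of _ \<rho>]) (auto simp: radius_step_def \<rho>_def)
qed (use s in \<open>auto simp: radius_step_def\<close>)

definition greedy_step :: "nat set \<Rightarrow> store \<Rightarrow> nat \<Rightarrow> nat \<Rightarrow> nat \<Rightarrow> store \<Rightarrow> bool" where
  "greedy_step W s v w \<rho> s' \<longleftrightarrow> v \<in> S \<inter> A \<and> (\<forall>u\<in>S \<inter> A. maxd W v \<le> maxd W u) \<and>
     w \<in> T \<and> D v w = ecc v \<and> reg s' ''best'' = min (reg s ''best'') (ecc v) \<and>
     (\<forall>u\<in>A. arr s' ''mx'' u = maxd (insert w W) u) \<and> is_rad w \<rho> \<and>
     (if \<rho> < reg s ''bestr'' then reg s' ''bestr'' = reg s ''bestr'' \<and> reg s' ''bw'' = reg s ''bw''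
      else reg s' ''bestr'' = \<rho> \<and> reg s' ''bw'' = w)"

lemma wp_greedy_round:
  assumes s: "bnd M s" "env s" and W: "W \<subseteq> T" "\<forall>u\<in>A. arr s ''mx'' u = maxd W u"
    and TA: "T \<subseteq> A" and SA: "S \<inter> A \<noteq> {}"
  shows "wp M greedy_round s (280 * (m + 1)) (\<lambda>s'. \<exists>v w \<rho>. greedy_step W s v w \<rho> s')"
    (is "wp M _ s _ ?Q")
proof -
  have finW: "finite W" and Wn: "W \<subseteq> {0..<n}" using W(1) finite_T finite_subset T_sub by blast+
  have f: "\<forall>u\<in>A. arr s ''mx'' u \<le> 3 * n" using W(2) maxd_le[OF finW Wn] by simp
  show ?thesis
    unfolding greedy_round_def
  proof (rule wp_Seq[OF wp_conseq[OF wp_argmin_S[OF s refl f SA] _ order_refl]])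
    fix s1 assume s1: "bnd M s1" "frame (argmin_S ''mx'') s s1"
      "reg s1 ''sm'' \<in> S \<inter> A \<and> (\<forall>u\<in>S \<inter> A. arr s ''mx'' (reg s1 ''sm'') \<le> arr s ''mx'' u)"
    define v where "v = reg s1 ''sm''"
    have v: "v \<in> S" "v \<in> A" "\<And>u. u \<in> S \<inter> A \<Longrightarrow> maxd W v \<le> maxd W u"
      using s1(3) W(2) by (auto simp: v_def)
    have e1: "env s1" by (rule env_frame[OF s(2) s1(2)]) (auto simp: written)
    show "wp M (Seq candidate (Seq (Assign ''src'' (V ''far'')) (Seq bfs (Seq upd_mx radius_step))))
      s1 (124 * (m + 1) + (1 + (bfs_time + (20 * (m + 1) + 5)))) ?Q"
    proof (rule wp_Seq[OF wp_conseq[OF wp_candidate[OF s1(1) e1 v_def[symmetric] v(2) TA] _ order_refl] order_refl])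
      fix s2 assume s2: "bnd M s2" "frame candidate s1 s2" "reg s2 ''best'' = min (reg s1 ''best'') (ecc v) \<and>
        reg s2 ''far'' \<in> T \<and> D v (reg s2 ''far'') = ecc v"
      define w where "w = reg s2 ''far''"
      have w: "w \<in> T" "w \<in> A" "D v w = ecc v" using s2(3) TA by (auto simp: w_def)
      have e2: "env s2" by (rule env_frame[OF e1 s2(2)]) (auto simp: written)
      let ?s2 = "xec (Assign ''src'' (V ''far'')) s2"
      show "wp M (Seq (Assign ''src'' (V ''far'')) (Seq bfs (Seq upd_mx radius_step))) s2
        (1 + (bfs_time + (20 * (m + 1) + 5))) ?Q"
      proof (rule wp_Seq[OF _ order_refl], rule wp_straight)
        assume b: "bnd M ?s2"
        have e2': "env ?s2" using e2 by (simp add: env_reg)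
        have src: "reg ?s2 ''src'' = w" by (simp add: w_def)
        show "wp M (Seq bfs (Seq upd_mx radius_step)) ?s2 (bfs_time + (20 * (m + 1) + 5)) ?Q"
        proof (rule wp_Seq[OF wp_conseq[OF wp_bfs[OF b e2' w(2) src] _ order_refl] order_refl])
          fix s3 assume s3: "bnd M s3" "frame bfs ?s2 s3" "bfs_done w s3"
          have e3: "env s3" by (rule env_frame[OF e2' s3(2)]) (auto simp: written)
          show "wp M (Seq upd_mx radius_step) s3 (20 * (m + 1) + 5) ?Q"
          proof (rule wp_Seq[OF wp_conseq[OF wp_upd_mx[OF s3(1) e3] _ order_refl] order_refl])
            fix s4 assume s4: "bnd M s4" "frame upd_mx s3 s4"
              "\<forall>u\<in>A. arr s4 ''mx'' u = max (arr s3 ''mx'' u) (arr s3 ''dist'' u)"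
            have e4: "env s4" by (rule env_frame[OF e3 s4(2)]) (auto simp: written)
            have mx3: "arr s3 ''mx'' = arr s ''mx''"
              using frame_arr[OF s3(2), of "''mx''"] frame_arr[OF s2(2), of "''mx''"]
                frame_arr[OF s1(2), of "''mx''"] by (simp add: written)
            have regs: "reg s4 ''best'' = min (reg s ''best'') (ecc v)" "reg s4 ''src'' = w"
              "reg s4 ''bestr'' = reg s ''bestr''" "reg s4 ''bw'' = reg s ''bw''"
            proof -
              have 4: "reg s4 x = reg s3 x" if "x \<in> {''best'', ''src'', ''bestr'', ''bw''}" for x
                by (rule frame_reg[OF s4(2)]) (use that in \<open>auto simp: written\<close>)
              have 3: "reg s3 x = reg ?s2 x" if "x \<in> {''best'', ''src'', ''bestr'', ''bw''}" for x
                by (rule frame_reg[OF s3(2)]) (use that in \<open>auto simp: written\<close>)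
              have 2: "reg s2 x = reg s1 x" if "x \<in> {''bestr'', ''bw''}" for x
                by (rule frame_reg[OF s2(2)]) (use that in \<open>auto simp: written\<close>)
              have 1: "reg s1 x = reg s x" if "x \<in> {''best'', ''bestr'', ''bw''}" for x
                by (rule frame_reg[OF s1(2)]) (use that in \<open>auto simp: written\<close>)
              show "reg s4 ''best'' = min (reg s ''best'') (ecc v)"
                using s2(3) by (simp add: 4 3 1)
              show "reg s4 ''src'' = w" using src by (simp add: 4 3)
              show "reg s4 ''bestr'' = reg s ''bestr''" "reg s4 ''bw'' = reg s ''bw''"
                by (simp_all add: 4 3 2 1)
            qed
            have mx4: "\<forall>u\<in>A. arr s4 ''mx'' u = maxd (insert w W) u"
            proof
              fix u assume u: "u \<in> A"
              have "arr s3 ''dist'' u = D w u" using s3(3) u unfolding bfs_done_def by blast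
              moreover have "arr s3 ''mx'' u = maxd W u" using W(2) u unfolding mx3 by blast
              ultimately show "arr s4 ''mx'' u = maxd (insert w W) u"
                using s4(3) u by (simp add: maxd_insert[OF finW])
            qed
            have bd4: "bfs_done w s4"
            proof -
              have "arr s4 ''queue'' = arr s3 ''queue''" "reg s4 ''tail'' = reg s3 ''tail''"
                "arr s4 ''dist'' = arr s3 ''dist''"
                by (intro frame_reg[OF s4(2)] frame_arr[OF s4(2)]; simp add: written)+
              then have "qlist s4 = qlist s3" "arr s4 ''dist'' = arr s3 ''dist''"
                by (auto intro: qlist_cong)
              then show ?thesis using s3(3) by (simp add: bfs_done_def)
            qed
            show "wp M radius_step s4 5 ?Q"
            proof (rule wp_conseq[OF wp_radius_step[OF s4(1) e4 w(2) regs(2) bd4] _ order_refl])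
              fix s5 assume s5: "frame radius_step s4 s5" "\<exists>\<rho>. is_rad w \<rho> \<and>
                (if \<rho> < reg s4 ''bestr'' then reg s5 ''bestr'' = reg s4 ''bestr'' \<and> reg s5 ''bw'' = reg s4 ''bw''
                 else reg s5 ''bestr'' = \<rho> \<and> reg s5 ''bw'' = w)"
              have keep: "reg s5 ''best'' = reg s4 ''best''" "arr s5 ''mx'' = arr s4 ''mx''"
                using s5(1) by (auto simp: frame_def radius_step_def)
              obtain \<rho> where \<rho>: "is_rad w \<rho>" "if \<rho> < reg s ''bestr'' then reg s5 ''bestr'' = reg s ''bestr'' \<and>
                   reg s5 ''bw'' = reg s ''bw'' else reg s5 ''bestr'' = \<rho> \<and> reg s5 ''bw'' = w"
                using s5(2) unfolding regs by auto
              show "?Q s5"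
                unfolding greedy_step_def
              proof (intro exI conjI ballI)
                show "reg s5 ''best'' = min (reg s ''best'') (ecc v)" using keep(1) regs(1) by (rule trans)
                show "arr s5 ''mx'' u = maxd (insert w W) u" if "u \<in> A" for u
                  using mx4 that unfolding keep(2) by blast
              qed (use \<rho> v w in blast)+
            qed
          qed
        qed
      qed (use s2 bnd_reg[OF s2(1)] in auto)
    qed
  qed (simp add: bfs_time_def)
qed

definition greedy :: "nat set \<Rightarrow> nat \<Rightarrow> (nat \<Rightarrow> nat) \<Rightarrow> (nat \<Rightarrow> nat) \<Rightarrow> bool" where
  "greedy W i si wi \<longleftrightarrow> (\<forall>j<i. si j \<in> S \<inter> A \<and> wi j \<in> T \<and> ecc (si j) = D (si j) (wi j) \<and>
     (\<forall>u\<in>S \<inter> A. maxd (W \<union> wi ` {..<j}) (si j) \<le> maxd (W \<union> wi ` {..<j}) u))"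

definition best_ok :: "nat \<Rightarrow> bool" where
  "best_ok b \<longleftrightarrow> b = 3 * n \<or> b \<in> ecc ` S"

lemma best_ok_min: "best_ok b \<Longrightarrow> v \<in> S \<Longrightarrow> best_ok (min b (ecc v))"
  by (auto simp: best_ok_def min_def)

definition greedy_inv :: "nat set \<Rightarrow> (nat \<Rightarrow> nat) \<Rightarrow> (nat \<Rightarrow> nat) \<Rightarrow> nat \<Rightarrow> store \<Rightarrow> bool" where
  "greedy_inv W si wi i s \<longleftrightarrow> greedy W i si wi \<and>
     (\<forall>u\<in>A. arr s ''mx'' u = maxd (W \<union> wi ` {..<i}) u) \<and>
     best_ok (reg s ''best'') \<and> (\<forall>j<i. reg s ''best'' \<le> ecc (si j)) \<and>
     (if i = 0 then reg s ''bestr'' = 0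
      else reg s ''bw'' \<in> wi ` {..<i} \<and> is_rad (reg s ''bw'') (reg s ''bestr'')) \<and>
     (\<forall>j<i. \<exists>\<rho>\<le>reg s ''bestr''. is_rad (wi j) \<rho>)"

lemma greedy_inv_reg: "greedy_inv W si wi i (s\<lparr>reg := (reg s)(''j'' := v)\<rparr>) = greedy_inv W si wi i s"
  by (simp add: greedy_inv_def)

lemma greedy_inv_step:
  assumes inv: "greedy_inv W si wi i s"
    and step: "greedy_step (W \<union> wi ` {..<i}) s v w \<rho> s'"
  shows "greedy_inv W (si(i := v)) (wi(i := w)) (Suc i) s'"
proof -
  let ?si = "si(i := v)" and ?wi = "wi(i := w)"
  have v: "v \<in> S \<inter> A" "\<forall>u\<in>S \<inter> A. maxd (W \<union> wi ` {..<i}) v \<le> maxd (W \<union> wi ` {..<i}) u"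
    and w: "w \<in> T" "D v w = ecc v" and best: "reg s' ''best'' = min (reg s ''best'') (ecc v)"
    and mx: "\<forall>u\<in>A. arr s' ''mx'' u = maxd (insert w (W \<union> wi ` {..<i})) u"
    and rad: "is_rad w \<rho>" "if \<rho> < reg s ''bestr''
      then reg s' ''bestr'' = reg s ''bestr'' \<and> reg s' ''bw'' = reg s ''bw''
      else reg s' ''bestr'' = \<rho> \<and> reg s' ''bw'' = w"
    using step unfolding greedy_step_def by blast+
  have img: "?wi ` {..<j} = wi ` {..<j}" if "j \<le> i" for j using that by (intro image_cong) auto
  have img': "?wi ` {..<Suc i} = insert w (wi ` {..<i})" using img[of i] by (auto simp: lessThan_Suc)
  have "greedy W (Suc i) ?si ?wi"
    unfolding greedy_def
  proof (intro allI impI)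
    fix j assume j: "j < Suc i"
    then have "?wi ` {..<j} = wi ` {..<j}" by (intro img) simp
    then show "?si j \<in> S \<inter> A \<and> ?wi j \<in> T \<and> ecc (?si j) = D (?si j) (?wi j) \<and>
      (\<forall>u\<in>S \<inter> A. maxd (W \<union> ?wi ` {..<j}) (?si j) \<le> maxd (W \<union> ?wi ` {..<j}) u)"
      using inv v w j unfolding greedy_inv_def greedy_def by (cases "j = i") auto
  qed
  moreover have "best_ok (reg s' ''best'')"
    using inv v best best_ok_min by (auto simp: greedy_inv_def)
  moreover have "\<forall>j<Suc i. reg s' ''best'' \<le> ecc (?si j)"
    using inv best by (auto simp: greedy_inv_def less_Suc_eq min_le_iff_disj)
  moreover have "reg s' ''bw'' \<in> ?wi ` {..<Suc i} \<and> is_rad (reg s' ''bw'') (reg s' ''bestr'')"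
    using inv rad unfolding img' greedy_inv_def by (auto split: if_splits)
  moreover have "\<exists>\<rho>\<le>reg s' ''bestr''. is_rad (?wi j) \<rho>" if "j < Suc i" for j
  proof (cases "j = i")
    case True
    then show ?thesis using rad by (intro exI[of _ \<rho>]) (auto split: if_splits)
  next
    case False
    then have "j < i" using that by simp
    then obtain \<rho>' where "\<rho>' \<le> reg s ''bestr''" "is_rad (wi j) \<rho>'"
      using inv by (auto simp: greedy_inv_def)
    then show ?thesis using False rad(2) by (intro exI[of _ \<rho>']) (auto split: if_splits)
  qed
  moreover have "\<forall>u\<in>A. arr s' ''mx'' u = maxd (W \<union> ?wi ` {..<Suc i}) u" using mx img' by simp
  ultimately show ?thesis by (simp add: greedy_inv_def)
qed

lemma wp_greedy_loop:
  assumes s: "bnd M s" "env s" and W: "W \<subseteq> T" "\<forall>u\<in>A. arr s ''mx'' u = maxd W u"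
    and TA: "T \<subseteq> A" and SA: "S \<inter> A \<noteq> {}" and init: "reg s ''bestr'' = 0" "best_ok (reg s ''best'')"
  shows "wp M (For ''j'' ''q'' greedy_round) s (4 + q * (283 * (m + 1)))
     (\<lambda>s'. \<exists>si wi. greedy_inv W si wi q s')"
proof (rule wp_For[where n = q and k' = "280 * (m + 1)" and
      I = "\<lambda>i s. env s \<and> (\<exists>si wi. greedy_inv W si wi i s)"])
  show "env s \<and> (\<exists>si wi. greedy_inv W si wi 0 s)"
    using assms by (auto simp: greedy_inv_def greedy_def)
next
  fix i s assume b: "bnd M s" and inv: "env s \<and> (\<exists>si wi. greedy_inv W si wi i s)"
  then obtain si wi where e: "env s" and g: "greedy_inv W si wi i s" by auto
  have W': "W \<union> wi ` {..<i} \<subseteq> T" "\<forall>u\<in>A. arr s ''mx'' u = maxd (W \<union> wi ` {..<i}) u"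
    using W(1) g by (auto simp: greedy_inv_def greedy_def)
  show "wp M greedy_round s (280 * (m + 1)) (\<lambda>s. env s \<and> (\<exists>si wi. greedy_inv W si wi (Suc i) s))"
  proof (rule wp_conseq[OF wp_greedy_round[OF b e W' TA SA] _ order_refl])
    fix s' assume "frame greedy_round s s'"
    then have "env s'" by (rule env_frame[OF e]) (auto simp: written phase_defs)
    moreover assume "\<exists>v w \<rho>. greedy_step (W \<union> wi ` {..<i}) s v w \<rho> s'"
    ultimately show "env s' \<and> (\<exists>si wi. greedy_inv W si wi (Suc i) s')"
      using greedy_inv_step[OF g] by blast
  qed
qed (use s bnd_reg[OF s(1), of "''q''"] env_q[OF s(2)] in
    \<open>auto simp: env_reg phase_defs written greedy_inv_reg algebra_simps\<close>)

end

context bichromatic_run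
begin

definition side :: "nat \<Rightarrow> nat" where
  "side v = of_bool (v \<in> S)"

definition count_side :: "nat list \<Rightarrow> nat \<Rightarrow> nat \<Rightarrow> nat" where
  "count_side Q b j = card {k. k < j \<and> side (Q ! k) = b}"

definition sel :: "nat list \<Rightarrow> nat \<Rightarrow> bool" where
  "sel Q k \<longleftrightarrow> count_side Q (side (Q ! k)) k < q"

lemma side_less: "side v < 2" by (simp add: side_def)

lemma count_side_0 [simp]: "count_side Q b 0 = 0"
  by (simp add: count_side_def)

lemma count_side_Suc:
  "count_side Q b (Suc j) = (if side (Q ! j) = b then Suc (count_side Q b j) else count_side Q b j)"
proof -
  have "{k. k < Suc j \<and> side (Q ! k) = b} =
    (if side (Q ! j) = b then insert j {k. k < j \<and> side (Q ! k) = b} else {k. k < j \<and> side (Q ! k) = b})"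
    by (auto simp: less_Suc_eq)
  then show ?thesis unfolding count_side_def by simp
qed

lemma sel_if_few:
  assumes b: "b \<in> A" "bfs_order b Q" and r: "r < 3 * n" and v: "v \<in> gball b r"
    and few: "card ({u. side u = side v} \<inter> gball b r) \<le> q"
  shows "\<exists>k<length Q. Q ! k = v \<and> sel Q k"
proof -
  note ball = gball_bfs_order[OF b r]
  obtain k where k: "k < length Q" "Q ! k = v" using v unfolding ball by (auto simp: in_set_conv_nth)
  have mono: "D b (Q ! i) \<le> D b (Q ! j)" if "i \<le> j" "j < length Q" for i j
    using b(2) that unfolding bfs_order_def by blast
  let ?I = "{k'. k' < k \<and> side (Q ! k') = side v}"
  have "(!) Q ` insert k ?I \<subseteq> {u. side u = side v} \<inter> gball b r"
  proof
    fix u assume "u \<in> (!) Q ` insert k ?I"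
    then have "\<exists>k'\<le>k. u = Q ! k' \<and> side u = side v" using k by (auto intro: less_imp_le)
    then obtain k' where k': "k' \<le> k" "u = Q ! k'" "side u = side v" by blast
    then have "D b u \<le> r" using mono[of k' k] k v unfolding ball by simp
    then show "u \<in> {u. side u = side v} \<inter> gball b r" unfolding ball using k' k by simp
  qed
  then have "card ((!) Q ` insert k ?I) \<le> q"
    using card_mono[of "{u. side u = side v} \<inter> gball b r"] finite_gball few by (meson finite_Int le_trans)
  moreover have "inj_on ((!) Q) (insert k ?I)"
    by (rule inj_onI) (use b(2) k in \<open>auto simp: bfs_order_def nth_eq_iff_index_eq\<close>)
  ultimately have "card (insert k ?I) \<le> q" by (simp only: card_image)
  then have "sel Q k" using k by (simp add: sel_def count_side_def)
  with k show ?thesis by blast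
qed

lemma wp_select:
  assumes s: "bnd M s" "env s" and y: "reg s ''src'' = y" "y \<in> A" "arr s ''cnt'' (side y) < q"
    and TA: "T \<subseteq> A" and SA: "S \<inter> A \<noteq> {}"
  shows "wp M select s (245 * (m + 1)) (\<lambda>s'.
     arr s' ''cnt'' = (arr s ''cnt'')(side y := Suc (arr s ''cnt'' (side y))) \<and>
     (\<exists>p\<in>S \<inter> A. (\<forall>u\<in>S \<inter> A. D y p \<le> D y u) \<and> reg s' ''best'' = min (reg s ''best'') (ecc p)))"
    (is "wp M _ s _ ?Q")
proof -
  let ?c = "Put ''cnt'' (Get ''S'' (V ''src'')) (Plus (Get ''cnt'' (Get ''S'' (V ''src''))) (N 1))"
  let ?s = "xec ?c s"
  have S: "arr s ''S'' y = side y" using env_S[OF s(2) A_less[OF y(2)]] by (simp add: side_def)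
  have qM: "q \<le> M" using env_q[OF s(2)] bnd_reg[OF s(1), of "''q''"] by simp
  show ?thesis
    unfolding select_def
  proof (rule wp_Seq[where ka = 1], rule wp_straight)
    assume b1: "bnd M ?s"
    have e1: "env ?s" using s(2) by (simp add: env_arr)
    have src1: "reg ?s ''src'' = y" using y by simp
    have cnt1: "arr ?s ''cnt'' = (arr s ''cnt'')(side y := Suc (arr s ''cnt'' (side y)))"
      using S y by simp
    have best1: "reg ?s ''best'' = reg s ''best''" by simp
    show "wp M (Seq bfs (Seq (argmin_S ''dist'') candidate)) ?s
      (bfs_time + (20 * (m + 1) + 124 * (m + 1))) ?Q"
    proof (rule wp_Seq[OF wp_conseq[OF wp_bfs[OF b1 e1 y(2) src1] _ order_refl] order_refl])
      fix s2 assume s2: "bnd M s2" "frame bfs ?s s2" "bfs_done y s2"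
      have e2: "env s2" by (rule env_frame[OF e1 s2(2)]) (auto simp: written)
      have keep2: "arr s2 ''cnt'' = arr ?s ''cnt''" "reg s2 ''best'' = reg ?s ''best''"
        by (intro frame_reg[OF s2(2)] frame_arr[OF s2(2)]; simp add: written)+
      have d2: "arr s2 ''dist'' u = D y u" if "u \<in> A" for u
        using s2(3) that unfolding bfs_done_def by blast
      have f: "\<forall>u\<in>A. arr s2 ''dist'' u \<le> 3 * n"
        using d2 D_le_big[OF A_less[OF y(2)]] by simp
      show "wp M (Seq (argmin_S ''dist'') candidate) s2 (20 * (m + 1) + 124 * (m + 1)) ?Q"
      proof (rule wp_Seq[OF wp_conseq[OF wp_argmin_S[OF s2(1) e2 refl f SA] _ order_refl] order_refl])
        fix s3 assume s3: "bnd M s3" "frame (argmin_S ''dist'') s2 s3"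
          "reg s3 ''sm'' \<in> S \<inter> A \<and> (\<forall>u\<in>S \<inter> A. arr s2 ''dist'' (reg s3 ''sm'') \<le> arr s2 ''dist'' u)"
        define p where "p = reg s3 ''sm''"
        have p: "p \<in> S" "p \<in> A" "\<forall>u\<in>S \<inter> A. D y p \<le> D y u" using s3(3) d2 by (auto simp: p_def)
        have e3: "env s3" by (rule env_frame[OF e2 s3(2)]) (auto simp: written)
        have keep3: "arr s3 ''cnt'' = arr s2 ''cnt''" "reg s3 ''best'' = reg s2 ''best''"
          by (intro frame_reg[OF s3(2)] frame_arr[OF s3(2)]; simp add: written)+
        show "wp M candidate s3 (124 * (m + 1)) ?Q"
        proof (rule wp_conseq[OF wp_candidate[OF s3(1) e3 p_def[symmetric] p(2) TA] _ order_refl])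
          fix s4 assume s4: "frame candidate s3 s4" "reg s4 ''best'' = min (reg s3 ''best'') (ecc p) \<and>
            reg s4 ''far'' \<in> T \<and> D p (reg s4 ''far'') = ecc p"
          have "arr s4 ''cnt'' = arr s3 ''cnt''" by (rule frame_arr[OF s4(1)]) (simp add: written)
          then have "arr s4 ''cnt'' = (arr s ''cnt'')(side y := Suc (arr s ''cnt'' (side y)))"
            using keep3(1) keep2(1) cnt1 by (metis (no_types))
          moreover have "reg s4 ''best'' = min (reg s ''best'') (ecc p)"
            using s4(2) keep3(2) keep2(2) best1 by (metis (no_types))
          ultimately show "?Q s4" using p by blast
        qed
      qed
    qed
  qed (use s S y qM in \<open>auto simp: bfs_time_def\<close>)
qed

definition final_inv :: "nat list \<Rightarrow> nat \<Rightarrow> nat \<Rightarrow> store \<Rightarrow> bool" where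
  "final_inv Q b0 j s \<longleftrightarrow> env s \<and> (\<forall>k<length Q. arr s ''q2'' k = Q ! k) \<and>
     (\<forall>b<2. arr s ''cnt'' b = min q (count_side Q b j)) \<and> best_ok (reg s ''best'') \<and>
     reg s ''best'' \<le> b0 \<and>
     (\<forall>k<j. sel Q k \<longrightarrow> (\<exists>p\<in>S \<inter> A. (\<forall>u\<in>S \<inter> A. D (Q ! k) p \<le> D (Q ! k) u) \<and> reg s ''best'' \<le> ecc p))"

text \<open>The counters pay for the at most \<open>2 * q\<close> expensive rounds.\<close>

definition final_pot :: "nat list \<Rightarrow> nat \<Rightarrow> store \<Rightarrow> nat" where
  "final_pot Q j s = (2 * q - (arr s ''cnt'' 0 + arr s ''cnt'' 1)) * (245 * (m + 1)) + (length Q - j) * 3"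

lemma wp_final_round:
  assumes s: "bnd M s" "final_inv Q b0 j s" "j < length Q" "reg s ''j'' = j" "set Q \<subseteq> A"
    and TA: "T \<subseteq> A" and SA: "S \<inter> A \<noteq> {}"
  shows "\<exists>k. wp M final_round s k (\<lambda>s'. final_inv Q b0 (Suc j) s' \<and>
     final_pot Q (Suc j) s' + k \<le> final_pot Q j s)"
proof -
  define y where "y = Q ! j"
  have y: "y \<in> A" using s(3,5) nth_mem unfolding y_def by blast
  have e: "env s" and q2: "arr s ''q2'' j = y" and cnt: "\<And>b. b < 2 \<Longrightarrow> arr s ''cnt'' b = min q (count_side Q b j)"
    using s(2,3) by (auto simp: final_inv_def y_def)
  let ?s = "xec (Assign ''src'' (Get ''q2'' (V ''j''))) s"
  have src: "reg ?s ''src'' = y" using q2 s(4) by simp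
  have e1: "env ?s" using e by (simp add: env_reg)
  have S: "arr ?s ''S'' y = side y" using env_S[OF e1 A_less[OF y]] by (simp add: side_def)
  let ?b = "Less (Get ''cnt'' (Get ''S'' (V ''src''))) (V ''q'')"
  let ?Q = "\<lambda>k s'. final_inv Q b0 (Suc j) s' \<and> final_pot Q (Suc j) s' + k \<le> final_pot Q j s"
  have bv: "bval ?b ?s \<longleftrightarrow> arr s ''cnt'' (side y) < q"
    using S src env_q[OF e1] by simp
  have sel: "sel Q j \<longleftrightarrow> arr s ''cnt'' (side y) < q"
    using cnt[OF side_less[of y]] by (auto simp: sel_def y_def)
  show ?thesis
  proof (cases "arr s ''cnt'' (side y) < q")
    case True
    have "wp M final_round s (1 + (1 + 245 * (m + 1))) (?Q (1 + (1 + 245 * (m + 1))))"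
      unfolding final_round_def
    proof (rule wp_Seq[OF _ order_refl], rule wp_straight)
      assume b1: "bnd M ?s"
      show "wp M (If ?b select Skip) ?s (1 + 245 * (m + 1)) (?Q (1 + (1 + 245 * (m + 1))))"
      proof (rule wp_If[OF b1 _ order_refl])
        have c: "arr ?s ''cnt'' (side y) < q" using True by simp
        show "wp M select ?s (245 * (m + 1)) (?Q (1 + (1 + 245 * (m + 1))))"
        proof (rule wp_conseq[OF wp_select[OF b1 e1 src y c TA SA] _ order_refl])
          fix s' assume s': "frame select ?s s'"
            "arr s' ''cnt'' = (arr ?s ''cnt'')(side y := Suc (arr ?s ''cnt'' (side y))) \<and>
             (\<exists>p\<in>S \<inter> A. (\<forall>u\<in>S \<inter> A. D y p \<le> D y u) \<and> reg s' ''best'' = min (reg ?s ''best'') (ecc p))"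
          obtain p where p: "p \<in> S" "p \<in> A" "\<forall>u\<in>S \<inter> A. D y p \<le> D y u"
            "reg s' ''best'' = min (reg s ''best'') (ecc p)" using s'(2) by auto
          have e': "env s'" by (rule env_frame[OF e1 s'(1)]) (auto simp: written select_def)
          have "arr s' ''q2'' = arr ?s ''q2''" by (rule frame_arr[OF s'(1)]) (auto simp: written select_def)
          then have q2': "\<forall>k<length Q. arr s' ''q2'' k = Q ! k" using s(2) by (simp add: final_inv_def)
          have cnt': "arr s' ''cnt'' = (arr s ''cnt'')(side y := Suc (arr s ''cnt'' (side y)))"
            using s'(2) by simp
          have cnts: "arr s' ''cnt'' b = min q (count_side Q b (Suc j))" if "b < 2" for b
            using True cnt[OF that] cnt[OF side_less[of y]]
            by (auto simp: cnt' count_side_Suc y_def[symmetric])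
          have cand: "\<exists>p\<in>S \<inter> A. (\<forall>u\<in>S \<inter> A. D (Q ! k) p \<le> D (Q ! k) u) \<and> reg s' ''best'' \<le> ecc p"
            if k: "k < Suc j" "sel Q k" for k
          proof (cases "k = j")
            case True
            then show ?thesis using p by (auto simp: y_def[symmetric] intro!: bexI[of _ p])
          next
            case False
            then have "k < j" using k by simp
            then obtain p' where "p' \<in> S \<inter> A" "\<forall>u\<in>S \<inter> A. D (Q ! k) p' \<le> D (Q ! k) u" "reg s ''best'' \<le> ecc p'"
              using s(2) k(2) unfolding final_inv_def by blast
            then show ?thesis using p(4) by (intro bexI[of _ p']) auto
          qed
          have "final_inv Q b0 (Suc j) s'"
            unfolding final_inv_def
            using e' q2' cnts cand s(2) p(1,4) best_ok_min by (auto simp: final_inv_def)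
          moreover have "final_pot Q (Suc j) s' + (1 + (1 + 245 * (m + 1))) \<le> final_pot Q j s"
          proof -
            define a where "a = arr s ''cnt'' 0 + arr s ''cnt'' 1"
            have le: "arr s ''cnt'' 0 \<le> q" "arr s ''cnt'' 1 \<le> q" using cnt by auto
            have "a < 2 * q" using True le by (cases "y \<in> S") (auto simp: a_def side_def)
            moreover have "arr s' ''cnt'' 0 + arr s' ''cnt'' 1 = Suc a"
              by (auto simp: cnt' a_def side_def)
            moreover obtain d where "2 * q = a + 1 + d" using \<open>a < 2 * q\<close> less_iff_Suc_add by auto
            moreover obtain l where "length Q = j + 1 + l" using s(3) less_iff_Suc_add by auto
            ultimately show ?thesis unfolding final_pot_def a_def[symmetric] by (simp add: algebra_simps)
          qed
          ultimately show "?Q (1 + (1 + 245 * (m + 1))) s'" by blast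
        qed
      qed (use True bv in auto)
    qed (use s bnd_arr[OF s(1)] in auto)
    then show ?thesis by blast
  next
    case False
    have "wp M final_round s 3 (?Q 3)"
      unfolding final_round_def
    proof (rule wp_Seq[where ka = 1 and kb = 2], rule wp_straight)
      assume b1: "bnd M ?s"
      show "wp M (If ?b select Skip) ?s 2 (?Q 3)"
      proof (rule wp_If[OF b1 _ , where k' = 1])
        show "wp M Skip ?s 1 (?Q 3)"
        proof (rule wp_Skip[OF b1])
          have cnts: "arr s ''cnt'' b = min q (count_side Q b (Suc j))" if "b < 2" for b
            using False cnt[OF that] cnt[OF side_less[of y]]
            by (auto simp: count_side_Suc y_def[symmetric])
          have "\<not> sel Q j" using sel False by simp
          then have "final_inv Q b0 (Suc j) ?s"
            using s(2) e1 cnts by (auto simp: final_inv_def less_Suc_eq)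
          moreover obtain l where "length Q = j + 1 + l" using s(3) less_iff_Suc_add by auto
          then have "final_pot Q (Suc j) ?s + 3 \<le> final_pot Q j s"
            by (simp add: final_pot_def)
          ultimately show "?Q 3 ?s" by blast
        qed simp
      qed (use False bv in auto)
    qed (use s bnd_arr[OF s(1)] in auto)
    then show ?thesis by blast
  qed
qed

lemma wp_copy_queue:
  assumes s: "bnd M s" "reg s ''tail'' \<le> 2 * m"
  shows "wp M copy_queue s (8 * (m + 1)) (\<lambda>s'. reg s' ''n2'' = reg s ''tail'' \<and>
     (\<forall>k<reg s ''tail''. arr s' ''q2'' k = qlist s ! k) \<and> (\<forall>b<2. arr s' ''cnt'' b = 0))"
  unfolding copy_queue_def
proof (rule wp_Seq[where ka = 3], rule wp_straight)
  let ?c = "Seq (Assign ''n2'' (V ''tail'')) (Seq (Put ''cnt'' (N 0) (N 0)) (Put ''cnt'' (N 1) (N 0)))"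
  let ?s = "xec ?c s"
  let ?l = "reg s ''tail''"
  assume b: "bnd M ?s"
  show "wp M (For ''j'' ''n2'' (Put ''q2'' (V ''j'') (Get ''queue'' (V ''j'')))) ?s (4 + ?l * 4)
    (\<lambda>s'. reg s' ''n2'' = ?l \<and> (\<forall>k<?l. arr s' ''q2'' k = qlist s ! k) \<and> (\<forall>b<2. arr s' ''cnt'' b = 0))"
  proof (rule wp_For[where n = ?l and k' = 1 and I = "\<lambda>i s'. reg s' ''n2'' = ?l \<and>
      arr s' ''queue'' = arr s ''queue'' \<and>
      (\<forall>k<i. arr s' ''q2'' k = qlist s ! k) \<and> (\<forall>b<2. arr s' ''cnt'' b = 0)"])
    fix i s' assume s': "bnd M s'" "reg s' ''n2'' = ?l \<and> arr s' ''queue'' = arr s ''queue'' \<and>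
      (\<forall>k<i. arr s' ''q2'' k = qlist s ! k) \<and> (\<forall>b<2. arr s' ''cnt'' b = 0)" "i < ?l" "reg s' ''j'' = i"
    show "wp M (Put ''q2'' (V ''j'') (Get ''queue'' (V ''j''))) s' 1 (\<lambda>s'. reg s' ''n2'' = ?l \<and>
      arr s' ''queue'' = arr s ''queue'' \<and>
      (\<forall>k<Suc i. arr s' ''q2'' k = qlist s ! k) \<and> (\<forall>b<2. arr s' ''cnt'' b = 0))"
      by (rule wp_straight) (use s' bnd_arr[OF s(1)] in \<open>auto simp: less_Suc_eq qlist_nth\<close>)
  qed (use b bnd_reg[OF s(1)] in \<open>auto simp: less_2_cases_iff\<close>)
qed (use s bnd_reg[OF s(1)] in auto)

lemma wp_final_phase:
  assumes s: "bnd M s" "env s" "reg s ''bw'' = b" "b \<in> A" "best_ok (reg s ''best'')"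
    and TA: "T \<subseteq> A" and SA: "S \<inter> A \<noteq> {}"
  shows "wp M final_phase s (600 * (q + 1) * (m + 1)) (\<lambda>s'. \<exists>Q. bfs_order b Q \<and>
     final_inv Q (reg s ''best'') (length Q) s')"
    (is "wp M _ s _ ?Q")
  unfolding final_phase_def
proof (rule wp_Seq[where ka = 1], rule wp_straight)
  let ?s = "xec (Assign ''src'' (V ''bw'')) s"
  assume b1: "bnd M ?s"
  have e1: "env ?s" using s(2) by (simp add: env_reg)
  have src1: "reg ?s ''src'' = b" using s(3) by simp
  let ?t = "4 + 2 * q * (245 * (m + 1)) + 12 * m"
  show "wp M (Seq bfs (Seq copy_queue (For ''j'' ''n2'' final_round))) ?s
    (bfs_time + (8 * (m + 1) + ?t)) ?Q"
  proof (rule wp_Seq[OF wp_conseq[OF wp_bfs[OF b1 e1 s(4) src1] _ order_refl] order_refl])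
    fix s2 assume s2: "bnd M s2" "frame bfs ?s s2" "bfs_done b s2"
    have e2: "env s2" by (rule env_frame[OF e1 s2(2)]) (auto simp: written)
    have best2: "reg s2 ''best'' = reg ?s ''best''" by (rule frame_reg[OF s2(2)]) (simp add: written)
    define Q where "Q = qlist s2"
    have Q: "bfs_order b Q" using s2(3) by (simp add: bfs_done_def Q_def)
    then have QA: "set Q \<subseteq> A" and dQ: "distinct Q" by (auto simp: bfs_order_def)
    have lQ: "length Q \<le> 2 * m"
      using card_mono[OF finite_A QA] distinct_card[OF dQ] card_A by simp
    then have l2: "reg s2 ''tail'' \<le> 2 * m" by (simp add: Q_def)
    show "wp M (Seq copy_queue (For ''j'' ''n2'' final_round)) s2 (8 * (m + 1) + ?t) ?Q"
    proof (rule wp_Seq[OF wp_conseq[OF wp_copy_queue[OF s2(1) l2] _ order_refl] order_refl])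
      fix s3 assume s3: "bnd M s3" "frame copy_queue s2 s3" "reg s3 ''n2'' = reg s2 ''tail'' \<and>
        (\<forall>k<reg s2 ''tail''. arr s3 ''q2'' k = qlist s2 ! k) \<and> (\<forall>b<2. arr s3 ''cnt'' b = 0)"
      have e3: "env s3" by (rule env_frame[OF e2 s3(2)]) (auto simp: copy_queue_def)
      have best3: "reg s3 ''best'' = reg s ''best''"
        using frame_reg[OF s3(2), of "''best''"] best2 by (simp add: copy_queue_def)
      have cnt3: "arr s3 ''cnt'' 0 = 0" "arr s3 ''cnt'' 1 = 0" using s3(3) by auto
      show "wp M (For ''j'' ''n2'' final_round) s3 ?t ?Q"
      proof (rule wp_For_pot[where n = "length Q" and I = "final_inv Q (reg s ''best'')" and \<Psi> = "final_pot Q"])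
        show "final_inv Q (reg s ''best'') 0 s3"
          using e3 s3(3) best3 s(5) by (simp add: final_inv_def Q_def)
        show "4 + final_pot Q 0 s3 + 3 * length Q \<le> ?t"
          using lQ cnt3 by (simp add: final_pot_def)
        fix i s' assume "bnd M s'" "final_inv Q (reg s ''best'') i s'" "i < length Q" "reg s' ''j'' = i"
        then show "\<exists>k. wp M final_round s' k (\<lambda>s''. final_inv Q (reg s ''best'') (Suc i) s'' \<and>
            final_pot Q (Suc i) s'' + k \<le> final_pot Q i s')"
          by (rule wp_final_round) (use QA TA SA in auto)
      next
        show "length Q \<le> M" using lQ m_le_M by simp
      qed (use s3 Q in \<open>auto simp: Q_def final_inv_def env_reg final_pot_def written final_round_def select_def\<close>)
    qed
  qed
qed (use s bnd_reg[OF s(1)] in \<open>auto simp: bfs_time_def algebra_simps\<close>)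

lemma result_correct:
  assumes g: "greedy_inv (W \<inter> T) si wi q s1" and Q: "bfs_order (reg s1 ''bw'') Q"
    and fin: "final_inv Q (reg s1 ''best'') (length Q) s2"
    and q: "n \<le> q * q" "1 \<le> q" and TA: "T \<subseteq> A" and W: "well_spread q W" and R: "radius < n"
  shows "reg s2 ''best'' \<le> radius + slack radius"
proof -
  define b where "b = reg s1 ''bw''"
  define N where "N = {Q ! k | k. k < length Q \<and> sel Q k}"
  define p where "p v = (SOME p. p \<in> S \<inter> A \<and> (\<forall>u\<in>S \<inter> A. D v p \<le> D v u) \<and> reg s2 ''best'' \<le> ecc p)" for v
  have gr: "greedy (W \<inter> T) q si wi" and best1: "\<And>j. j < q \<Longrightarrow> reg s1 ''best'' \<le> ecc (si j)"
    and b: "b \<in> wi ` {..<q}" "is_rad b (reg s1 ''bestr'')"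
    and rad: "\<And>j. j < q \<Longrightarrow> \<exists>\<rho>\<le>reg s1 ''bestr''. is_rad (wi j) \<rho>"
    using g q(2) unfolding greedy_inv_def b_def by auto
  have bA: "b \<in> A" using b(1) gr TA by (auto simp: greedy_def)
  have best2: "reg s2 ''best'' \<le> reg s1 ''best''" using fin by (simp add: final_inv_def)
  have p: "p v \<in> S \<inter> A \<and> (\<forall>u\<in>S \<inter> A. D v (p v) \<le> D v u) \<and> reg s2 ''best'' \<le> ecc (p v)" if "v \<in> N" for v
    unfolding p_def by (rule someI_ex) (use that fin in \<open>auto simp: N_def final_inv_def\<close>)
  have "(\<exists>i<q. ecc (si i) \<le> radius + slack radius) \<or> (\<exists>v\<in>N. ecc (p v) \<le> radius + slack radius)"
  proof (rule algorithm_core[where W = W and W0 = "W \<inter> T" and wi = wi and b = b and A = A])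
    show "\<And>u v. (u, v) \<in> E \<Longrightarrow> u \<in> A" using A_iff by blast
    show "A \<subseteq> {0..<n}" using A_less by auto
    show "\<And>i. i < q \<Longrightarrow> si i \<in> S" "\<And>i. i < q \<Longrightarrow> wi i \<in> T" "\<And>i. i < q \<Longrightarrow> ecc (si i) = D (si i) (wi i)"
      using gr by (auto simp: greedy_def)
    fix i v x assume i: "i < q" and v: "v \<in> S \<inter> A" and x: "x \<in> W \<inter> T \<union> wi ` {..<i}"
    have fin: "finite (W \<inter> T \<union> wi ` {..<i})" using finite_T by auto
    have "D (si i) x \<le> maxd (W \<inter> T \<union> wi ` {..<i}) (si i)" using maxd_ge[OF fin x] D_sym by metis
    also have "\<dots> \<le> maxd (W \<inter> T \<union> wi ` {..<i}) v" using gr i v by (auto simp: greedy_def)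
    finally show "\<exists>y\<in>W \<inter> T \<union> wi ` {..<i}. D (si i) x \<le> D v y"
      using maxd_attained[OF fin, of v] x D_sym by (metis empty_iff)
  next
    fix r assume "r < 3 * n" "\<exists>i<q. card (gball (wi i) r) \<le> q"
    then obtain i where "i < q" "card (gball (wi i) r) \<le> q" by blast
    moreover obtain \<rho> where "\<rho> \<le> reg s1 ''bestr''" "is_rad (wi i) \<rho>" using rad \<open>i < q\<close> by blast
    ultimately show "card (gball b r) \<le> q" using b(2) \<open>r < 3 * n\<close> unfolding is_rad_def by force
  next
    fix v r assume v: "v \<in> S" "r < 3 * n" "v \<in> gball b r" "card (gball b r) \<le> q"
    have "card ({u. side u = side v} \<inter> gball b r) \<le> q"
      using card_mono[OF finite_gball, of "{u. side u = side v} \<inter> gball b r" b r] v(4) by simp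
    from sel_if_few[OF bA Q[folded b_def] v(2,3) this] show "v \<in> N" by (auto simp: N_def)
  next
    fix v r assume v: "v \<in> T" "r < 3 * n" "v \<in> gball b r" "card (T \<inter> gball b r) < q"
    have "{u. side u = side v} \<inter> gball b r = T \<inter> gball b r"
      using T_iff ST_disjoint[of v] v(1) by (auto simp: side_def gball_def)
    then have "card ({u. side u = side v} \<inter> gball b r) \<le> q" using v(4) by simp
    from sel_if_few[OF bA Q[folded b_def] v(2,3) this] show "v \<in> N" by (auto simp: N_def)
  qed (use q R TA W b p in auto)
  then show ?thesis using best1 best2 p by (meson le_trans)
qed

definition main_time :: "nat \<Rightarrow> nat" where
  "main_time K = 1000 * (K + q + 1) * (m + 1)"

lemma best_ok_estimate:
  assumes "best_ok b" "reg s ''inf'' = (if b < 3 * n then 0 else 1)" "b < 3 * n \<Longrightarrow> reg s ''out'' = b"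
  shows "estimate s = to_ereal b" "radius \<le> b" "b < n \<or> b = 3 * n"
proof -
  obtain v where v: "v \<in> S" "radius = ecc v" using radius_attained by auto
  then have vn: "v < n" using S_sub' by auto
  obtain t where "ecc v = D v t" using ecc_attained by auto
  then have "radius \<le> 3 * n" using v D_le_big[OF vn] by simp
  then show "radius \<le> b" using assms(1) radius_le by (auto simp: best_ok_def)
  show "b < n \<or> b = 3 * n"
  proof (cases "b = 3 * n")
    case False
    then obtain u where u: "u \<in> S" "b = ecc u" using assms(1) by (auto simp: best_ok_def)
    moreover obtain t where "ecc u = D u t" using ecc_attained by auto
    ultimately show ?thesis using D_cases[of u t] S_sub' by auto
  qed simp
  then show "estimate s = to_ereal b" using assms(2,3) n_ge_2 by (auto simp: estimate_def to_ereal_def)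
qed

lemma wp_main_phase:
  assumes s: "bnd M s" "env s" and K: "reg s ''K'' = K" "\<And>j. j < K \<Longrightarrow> arr s ''smp'' j = w j"
    and w: "\<And>j. j < K \<Longrightarrow> w j < n" and mx: "\<forall>u\<in>A. arr s ''mx'' u = 0" and inf: "reg s ''inf'' = 0"
    and TA: "T \<subseteq> A" and SA: "S \<inter> A \<noteq> {}" and q: "n \<le> q * q" "1 \<le> q"
  shows "wp M main_phase s (main_time K) (\<lambda>s'. \<exists>b. estimate s' = to_ereal b \<and> radius \<le> b \<and> (b < n \<or> b = 3 * n) \<and>
     (well_spread q (w ` {..<K}) \<longrightarrow> radius < n \<longrightarrow> b \<le> radius + slack radius))"
    (is "wp M _ s _ ?Q")
  unfolding main_phase_def
proof (rule wp_Seq[where ka = 1], rule wp_straight)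
  let ?s1 = "xec (Assign ''best'' (V ''big'')) s"
  let ?W = "w ` {..<K}"
  let ?last = "If (Less (V ''best'') (V ''big'')) (Assign ''out'' (V ''best'')) (Assign ''inf'' (N 1))"
  assume b1: "bnd M ?s1"
  have e1: "env ?s1" using s(2) by (simp add: env_reg)
  have K1: "reg ?s1 ''K'' = K" "\<And>j. j < K \<Longrightarrow> arr ?s1 ''smp'' j = w j" "\<forall>u\<in>A. arr ?s1 ''mx'' u = 0"
    using K mx by auto
  have best1: "best_ok (reg ?s1 ''best'')" using env_big[OF s(2)] by (simp add: best_ok_def)
  have inf1: "reg ?s1 ''inf'' = 0" using inf by simp
  let ?t = "600 * (q + 1) * (m + 1)"
  show "wp M (Seq (For ''j'' ''K'' sample_round)
     (Seq (Assign ''bestr'' (N 0)) (Seq (For ''j'' ''q'' greedy_round) (Seq final_phase ?last)))) ?s1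
    ((4 + K * (130 * (m + 1))) + (1 + ((4 + q * (283 * (m + 1))) + (?t + 2)))) ?Q"
  proof (rule wp_Seq[OF wp_conseq[OF wp_sample_loop[OF b1 e1 K1(1,2) w K1(3) TA] _ order_refl] order_refl])
    fix s2 assume s2: "bnd M s2" "frame (For ''j'' ''K'' sample_round) ?s1 s2"
      "\<forall>u\<in>A. arr s2 ''mx'' u = maxd (?W \<inter> T) u"
    have e2: "env s2" by (rule env_frame[OF e1 s2(2)]) (auto simp: written sample_round_def)
    have k2: "reg s2 ''best'' = reg ?s1 ''best''" "reg s2 ''inf'' = reg ?s1 ''inf''"
      by (intro frame_reg[OF s2(2)]; simp add: written sample_round_def)+
    let ?s3 = "xec (Assign ''bestr'' (N 0)) s2"
    show "wp M (Seq (Assign ''bestr'' (N 0)) (Seq (For ''j'' ''q'' greedy_round) (Seq final_phase ?last))) s2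
      (1 + ((4 + q * (283 * (m + 1))) + (?t + 2))) ?Q"
    proof (rule wp_Seq[OF _ order_refl], rule wp_straight)
      assume b3: "bnd M ?s3"
      have e3: "env ?s3" using e2 by (simp add: env_reg)
      have mx3: "\<forall>u\<in>A. arr ?s3 ''mx'' u = maxd (?W \<inter> T) u" using s2(3) by simp
      have r3: "reg ?s3 ''bestr'' = 0" "best_ok (reg ?s3 ''best'')" "reg ?s3 ''inf'' = 0"
        using k2 best1 inf1 by simp_all
      show "wp M (Seq (For ''j'' ''q'' greedy_round) (Seq final_phase ?last)) ?s3
        ((4 + q * (283 * (m + 1))) + (?t + 2)) ?Q"
      proof (rule wp_Seq[OF wp_conseq[OF wp_greedy_loop[OF b3 e3 _ mx3 TA SA r3(1,2)] _ order_refl] order_refl])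
        fix s4 assume s4: "bnd M s4" "frame (For ''j'' ''q'' greedy_round) ?s3 s4"
          "\<exists>si wi. greedy_inv (?W \<inter> T) si wi q s4"
        then obtain si wi where g: "greedy_inv (?W \<inter> T) si wi q s4" by blast
        have e4: "env s4" by (rule env_frame[OF e3 s4(2)]) (auto simp: written phase_defs)
        have inf4: "reg s4 ''inf'' = reg ?s3 ''inf''"
          by (rule frame_reg[OF s4(2)]) (simp add: written phase_defs)
        have best4: "best_ok (reg s4 ''best'')" using g by (simp add: greedy_inv_def)
        have bw: "reg s4 ''bw'' \<in> A"
          using g q(2) TA by (auto simp: greedy_inv_def greedy_def)
        show "wp M (Seq final_phase ?last) s4 (?t + 2) ?Q"
        proof (rule wp_Seq[OF wp_conseq[OF wp_final_phase[OF s4(1) e4 refl bw best4 TA SA] _ order_refl] order_refl])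
          fix s5 assume s5: "bnd M s5" "frame final_phase s4 s5"
            "\<exists>Q. bfs_order (reg s4 ''bw'') Q \<and> final_inv Q (reg s4 ''best'') (length Q) s5"
          then obtain Q where Q: "bfs_order (reg s4 ''bw'') Q" "final_inv Q (reg s4 ''best'') (length Q) s5"
            by blast
          have inf5: "reg s5 ''inf'' = reg s4 ''inf''"
            by (rule frame_reg[OF s5(2)]) (simp add: written phase_defs)
          have inf0: "reg s5 ''inf'' = 0" using inf5 inf4 r3(3) by (simp only:)
          have e5: "env s5" and best5: "best_ok (reg s5 ''best'')" using Q(2) by (auto simp: final_inv_def)
          let ?s6 = "xec ?last s5"
          show "wp M ?last s5 2 ?Q"
          proof (rule wp_straight)
            have *: "reg ?s6 ''inf'' = (if reg s5 ''best'' < 3 * n then 0 else 1)"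
              "reg s5 ''best'' < 3 * n \<Longrightarrow> reg ?s6 ''out'' = reg s5 ''best''"
              using inf0 env_big[OF e5] by auto
            have "well_spread q ?W \<longrightarrow> radius < n \<longrightarrow> reg s5 ''best'' \<le> radius + slack radius"
              using result_correct[OF g Q q TA] by blast
            then show "?Q ?s6" using best_ok_estimate[OF best5 *] by blast
            show "safe M ?last s5" using bnd_reg[OF s5(1)] M by simp
          qed (use s5 in auto)
        qed
      qed auto
    qed (use s2 in auto)
  qed
qed (use s bnd_reg[OF s(1)] in \<open>auto simp: main_time_def algebra_simps\<close>)

end

section \<open>Initialisation and sampling\<close>

definition root_loop :: com where
  "root_loop = While (Less (Times (V ''q'') (V ''q'')) (V ''n'')) (Assign ''q'' (Plus (V ''q'') (N 1)))"

definition log_loop :: com where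
  "log_loop = While (Not (Less (V ''n'') (V ''pw'')))
     (Seq (Assign ''pw'' (Times (N 2) (V ''pw''))) (Assign ''l'' (Plus (V ''l'') (N 1))))"

definition parameters :: com where
  "parameters = Seq (Seq (Assign ''big'' (Times (N 3) (V ''n''))) (Assign ''q'' (N 0)))
     (Seq root_loop (Seq (Seq (Assign ''pw'' (N 1)) (Assign ''l'' (N 0)))
     (Seq log_loop (Assign ''K'' (Times (Times (Plus (V ''c'') (N 4)) (V ''q'')) (V ''l''))))))"

definition collect_round :: com where
  "collect_round = If (Less (Get ''off'' (V ''v'')) (Get ''off'' (Plus (V ''v'') (N 1))))
     (Seq (Put ''lst'' (V ''na'') (V ''v'')) (Seq (Assign ''na'' (Plus (V ''na'') (N 1)))
       (If (Equal (Get ''S'' (V ''v'')) (N 1)) (Assign ''cS'' (N 1)) Skip)))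
     (If (Equal (Get ''S'' (V ''v'')) (N 0)) (Assign ''bad'' (N 1)) Skip)"

definition collect :: com where
  "collect = Seq (Assign ''na'' (N 0)) (For ''v'' ''n'' collect_round)"

definition power_phase :: com where
  "power_phase = Seq (Assign ''RN'' (N 1)) (For ''j'' ''K'' (Assign ''RN'' (Times (V ''RN'') (V ''n''))))"

definition decode_round :: com where
  "decode_round = Seq (Assign ''y'' (Div (V ''x'') (V ''n'')))
     (Seq (Put ''smp'' (V ''j'') (Minus (V ''x'') (Times (V ''y'') (V ''n''))))
          (Assign ''x'' (V ''y'')))"

definition decode_phase :: com where
  "decode_phase = Seq (For ''j'' ''K'' decode_round) (Seq (Assign ''RN'' (N 0)) (Seq (Assign ''y'' (N 0)) (Assign ''j'' (N 0))))"

context bichromatic_run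
begin

lemma wp_root_loop:
  assumes s: "bnd M s" "reg s ''n'' = n" "reg s ''q'' = 0"
    and q: "n \<le> q * q" "(q - 1) * (q - 1) < n" "q \<le> n"
  shows "wp M root_loop s (2 * n + 1) (\<lambda>s'. reg s' ''q'' = q)"
  unfolding root_loop_def
proof (rule wp_While[where I = "\<lambda>s. reg s ''n'' = n \<and> reg s ''q'' \<le> q" and \<Phi> = "\<lambda>s. 2 * (q - reg s ''q'')"])
  fix s assume s: "bnd M s" "reg s ''n'' = n \<and> reg s ''q'' \<le> q" "bval (Less (Times (V ''q'') (V ''q'')) (V ''n'')) s"
  have lt: "reg s ''q'' < q"
  proof (rule ccontr)
    assume "\<not> ?thesis"
    then have "q * q \<le> reg s ''q'' * reg s ''q''" by (intro mult_mono) auto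
    then show False using s q by simp
  qed
  show "\<exists>k. wp M (Assign ''q'' (Plus (V ''q'') (N 1))) s k (\<lambda>s'. (reg s' ''n'' = n \<and> reg s' ''q'' \<le> q) \<and>
    2 * (q - reg s' ''q'') + k + 1 \<le> 2 * (q - reg s ''q''))"
    by (rule exI[of _ 1], rule wp_straight) (use s lt q n_le_M in auto)
next
  fix s assume s: "reg s ''n'' = n \<and> reg s ''q'' \<le> q" "\<not> bval (Less (Times (V ''q'') (V ''q'')) (V ''n'')) s"
  show "reg s ''q'' = q"
  proof (rule ccontr)
    assume "reg s ''q'' \<noteq> q"
    then have "reg s ''q'' \<le> q - 1" using s(1) by linarith
    then have "reg s ''q'' * reg s ''q'' \<le> (q - 1) * (q - 1)" by (intro mult_mono) auto
    then show False using s q by simp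
  qed
qed (use s q in auto)

lemma wp_log_loop:
  assumes s: "bnd M s" "reg s ''n'' = n" "reg s ''pw'' = 1" "reg s ''l'' = 0"
    and l: "n < 2 ^ l" "2 ^ (l - 1) \<le> n" "l \<le> n"
  shows "wp M log_loop s (3 * n + 1) (\<lambda>s'. reg s' ''l'' = l)"
  unfolding log_loop_def
proof (rule wp_While[where I = "\<lambda>s. reg s ''n'' = n \<and> reg s ''pw'' = 2 ^ reg s ''l'' \<and> reg s ''l'' \<le> l"
      and \<Phi> = "\<lambda>s. 3 * (l - reg s ''l'')"])
  let ?c = "Seq (Assign ''pw'' (Times (N 2) (V ''pw''))) (Assign ''l'' (Plus (V ''l'') (N 1)))"
  fix s assume s: "bnd M s" "reg s ''n'' = n \<and> reg s ''pw'' = 2 ^ reg s ''l'' \<and> reg s ''l'' \<le> l"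
    "bval (Not (Less (V ''n'') (V ''pw''))) s"
  then have pw: "2 ^ reg s ''l'' \<le> n" by simp
  have lt: "reg s ''l'' < l"
  proof (rule ccontr)
    assume "\<not> ?thesis"
    then have "(2::nat) ^ l \<le> 2 ^ reg s ''l''" by (intro power_increasing) auto
    then show False using pw l(1) by linarith
  qed
  have "2 * 2 ^ reg s ''l'' \<le> M" using pw M by simp
  then show "\<exists>k. wp M ?c s k (\<lambda>s'. (reg s' ''n'' = n \<and> reg s' ''pw'' = 2 ^ reg s' ''l'' \<and> reg s' ''l'' \<le> l) \<and>
    3 * (l - reg s' ''l'') + k + 1 \<le> 3 * (l - reg s ''l''))"
    by (intro exI[of _ 2], intro wp_straight) (use s lt l n_le_M in auto)
next
  fix s assume s: "reg s ''n'' = n \<and> reg s ''pw'' = 2 ^ reg s ''l'' \<and> reg s ''l'' \<le> l"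
    "\<not> bval (Not (Less (V ''n'') (V ''pw''))) s"
  show "reg s ''l'' = l"
  proof (rule ccontr)
    assume "reg s ''l'' \<noteq> l"
    then have "(2::nat) ^ reg s ''l'' \<le> 2 ^ (l - 1)" using s(1) by (intro power_increasing) auto
    moreover have "n < 2 ^ reg s ''l''" using s by simp
    ultimately show False using l(2) by linarith
  qed
qed (use s l in auto)

lemma wp_parameters:
  assumes s: "bnd M s" "reg s ''n'' = n" "reg s ''c'' = c"
    and q: "n \<le> q * q" "(q - 1) * (q - 1) < n" "q \<le> n"
    and l: "n < 2 ^ l" "2 ^ (l - 1) \<le> n" "l \<le> n" and K: "(c + 4) * q * l \<le> M"
  shows "wp M parameters s (5 * n + 7) (\<lambda>s'. reg s' ''big'' = 3 * n \<and> reg s' ''q'' = q \<and>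
     reg s' ''K'' = (c + 4) * q * l)"
    (is "wp M _ s _ ?Q")
  unfolding parameters_def
proof (rule wp_Seq[where ka = 2], rule wp_straight)
  let ?s = "xec (Seq (Assign ''big'' (Times (N 3) (V ''n''))) (Assign ''q'' (N 0))) s"
  let ?last = "Assign ''K'' (Times (Times (Plus (V ''c'') (N 4)) (V ''q'')) (V ''l''))"
  assume b: "bnd M ?s"
  have r: "reg ?s ''n'' = n" "reg ?s ''q'' = 0" "reg ?s ''big'' = 3 * n" "reg ?s ''c'' = c" using s by auto
  show "wp M (Seq root_loop (Seq (Seq (Assign ''pw'' (N 1)) (Assign ''l'' (N 0)))
     (Seq log_loop ?last))) ?s (2 * n + 1 + (2 + (3 * n + 1 + 1))) ?Q"
  proof (rule wp_Seq[OF wp_conseq[OF wp_root_loop[OF b r(1,2) q] _ order_refl] order_refl])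
    fix s2 assume s2: "bnd M s2" "frame root_loop ?s s2" "reg s2 ''q'' = q"
    have r2: "reg s2 ''n'' = reg ?s ''n''" "reg s2 ''big'' = reg ?s ''big''" "reg s2 ''c'' = reg ?s ''c''"
      by (intro frame_reg[OF s2(2)]; simp add: root_loop_def)+
    let ?s3 = "xec (Seq (Assign ''pw'' (N 1)) (Assign ''l'' (N 0))) s2"
    show "wp M (Seq (Seq (Assign ''pw'' (N 1)) (Assign ''l'' (N 0))) (Seq log_loop ?last)) s2
      (2 + (3 * n + 1 + 1)) ?Q"
    proof (rule wp_Seq[OF _ order_refl], rule wp_straight)
      assume b3: "bnd M ?s3"
      have r3: "reg ?s3 ''n'' = n" "reg ?s3 ''pw'' = 1" "reg ?s3 ''l'' = 0" "reg ?s3 ''big'' = 3 * n"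
        "reg ?s3 ''c'' = c" "reg ?s3 ''q'' = q"
        using r r2 s2 by auto
      show "wp M (Seq log_loop ?last) ?s3 (3 * n + 1 + 1) ?Q"
      proof (rule wp_Seq[OF wp_conseq[OF wp_log_loop[OF b3 r3(1-3) l] _ order_refl] order_refl])
        fix s4 assume s4: "bnd M s4" "frame log_loop ?s3 s4" "reg s4 ''l'' = l"
        have r4: "reg s4 ''q'' = reg ?s3 ''q''" "reg s4 ''big'' = reg ?s3 ''big''" "reg s4 ''c'' = reg ?s3 ''c''"
          by (intro frame_reg[OF s4(2)]; simp add: log_loop_def)+
        then have "reg s4 ''q'' = q" "reg s4 ''big'' = 3 * n" "reg s4 ''c'' = c" using r3 by (simp_all only:)
        then show "wp M ?last s4 1 ?Q"
          by (intro wp_straight) (use s4 K in auto)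
      qed
    qed (use s2 M in auto)
  qed
qed (use s big_le in auto)

lemma wp_collect:
  assumes s: "bnd M s" "reg s ''n'' = n" "reg s ''big'' = 3 * n" "reg s ''q'' = q" "reg s ''cS'' = 0" "reg s ''bad'' = 0"
    "\<forall>v<n. arr s ''S'' v = of_bool (v \<in> S)" "\<forall>v\<le>n. arr s ''off'' v = off v" "\<forall>e<2 * m. arr s ''adj'' e = adj e"
  shows "wp M collect s (9 * n + 5) (\<lambda>s'. env s' \<and> reg s' ''cS'' = of_bool (S \<inter> A \<noteq> {}) \<and>
     reg s' ''bad'' = of_bool (\<not> T \<subseteq> A))"
  unfolding collect_def
proof (rule wp_Seq[where ka = 1], rule wp_straight)
  let ?s = "xec (Assign ''na'' (N 0)) s"
  define L where "L i = filter (\<lambda>v. off v < off (Suc v)) [0..<i]" for i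
  define I where "I i s \<longleftrightarrow> reg s ''n'' = n \<and> reg s ''big'' = 3 * n \<and> reg s ''q'' = q \<and>
    (\<forall>v<n. arr s ''S'' v = of_bool (v \<in> S)) \<and> (\<forall>v\<le>n. arr s ''off'' v = off v) \<and>
    (\<forall>e<2 * m. arr s ''adj'' e = adj e) \<and> reg s ''na'' = length (L i) \<and>
    (\<forall>k<length (L i). arr s ''lst'' k = L i ! k) \<and>
    reg s ''cS'' = of_bool (\<exists>v<i. v \<in> S \<inter> A) \<and> reg s ''bad'' = of_bool (\<exists>v<i. v \<in> T \<and> v \<notin> A)" for i and s :: store
  assume b: "bnd M ?s"
  have lL: "length (L i) \<le> i" for i unfolding L_def by (metis length_filter_le length_upt minus_nat.diff_0)
  show "wp M (For ''v'' ''n'' collect_round) ?s (4 + n * (6 + 3)) (\<lambda>s'. env s' \<and>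
     reg s' ''cS'' = of_bool (S \<inter> A \<noteq> {}) \<and> reg s' ''bad'' = of_bool (\<not> T \<subseteq> A))"
  proof (rule wp_For[where n = n and k' = 6 and I = I])
    show "I 0 ?s" using s by (simp add: I_def L_def)
  next
    fix i s v assume "I i s"
    then show "I i (s\<lparr>reg := (reg s)(''v'' := v)\<rparr>)" by (simp add: I_def)
  next
    fix i s assume s: "bnd M s" "I i s" "i < n" "reg s ''v'' = i"
    have o: "arr s ''off'' i = off i" "arr s ''off'' (Suc i) = off (Suc i)" "arr s ''S'' i = of_bool (i \<in> S)"
      using s(2,3) by (auto simp: I_def)
    have A: "i \<in> A \<longleftrightarrow> off i < off (Suc i)" using s(3) by (simp add: A_def)
    have L: "L (Suc i) = (if off i < off (Suc i) then L i @ [i] else L i)" by (simp add: L_def)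
    show "wp M collect_round s 6 (I (Suc i))"
    proof (rule wp_straight)
      show "safe M collect_round s"
        using s lL[of i] n_le_M o by (auto simp: collect_round_def I_def)
      show "I (Suc i) (xec collect_round s)"
      proof (cases "off i < off (Suc i)")
        case True
        then show ?thesis
          using s(2,3,4) o A L unfolding I_def
          by (auto simp: collect_round_def less_Suc_eq nth_append)
      next
        case False
        then show ?thesis
          using s(2,3,4) o A L T_iff[OF s(3)] unfolding I_def
          by (auto simp: collect_round_def less_Suc_eq)
      qed
    qed (use s in \<open>auto simp: collect_round_def\<close>)
  next
    fix s assume I: "I n s"
    have "L n = lst" by (simp add: L_def lst_def)
    then have "env s" using I by (simp add: I_def env_def)
    moreover have "(\<exists>v<n. v \<in> S \<inter> A) \<longleftrightarrow> S \<inter> A \<noteq> {}" using A_less by auto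
    moreover have "(\<exists>v<n. v \<in> T \<and> v \<notin> A) \<longleftrightarrow> \<not> T \<subseteq> A" using T_sub by auto
    ultimately show "env s \<and> reg s ''cS'' = of_bool (S \<inter> A \<noteq> {}) \<and> reg s ''bad'' = of_bool (\<not> T \<subseteq> A)"
      using I unfolding I_def by simp
  qed (use b s n_le_M in \<open>auto simp: collect_round_def\<close>)
qed (use s in auto)

lemma wp_power_phase:
  assumes s: "bnd B s" "reg s ''n'' = n" "reg s ''K'' = K" and B: "n ^ K \<le> B"
  shows "wp B power_phase s (5 + K * 4) (\<lambda>s'. reg s' ''RN'' = n ^ K)"
  unfolding power_phase_def
proof (rule wp_Seq[where ka = 1], rule wp_straight)
  let ?s = "xec (Assign ''RN'' (N 1)) s"
  assume b: "bnd B ?s"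
  show "wp B (For ''j'' ''K'' (Assign ''RN'' (Times (V ''RN'') (V ''n'')))) ?s (4 + K * (1 + 3))
    (\<lambda>s'. reg s' ''RN'' = n ^ K)"
  proof (rule wp_For[where n = K and k' = 1 and I = "\<lambda>i s. reg s ''n'' = n \<and> reg s ''RN'' = n ^ i"])
    fix i s assume s: "bnd B s" "reg s ''n'' = n \<and> reg s ''RN'' = n ^ i" "i < K"
    have "n ^ Suc i \<le> n ^ K" using s(3) n_ge_2 by (intro power_increasing) auto
    then have "n * n ^ i \<le> B" using B by simp
    then show "wp B (Assign ''RN'' (Times (V ''RN'') (V ''n''))) s 1 (\<lambda>s. reg s ''n'' = n \<and> reg s ''RN'' = n ^ Suc i)"
      by (intro wp_straight) (use s in \<open>auto simp: mult.commute\<close>)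
  qed (use b s bnd_reg[OF s(1), of "''K''"] in auto)
qed (use s in \<open>auto simp: bnd_def\<close>)

definition digit :: "nat \<Rightarrow> nat \<Rightarrow> nat" where
  "digit x j = (x div n ^ j) mod n"

lemma wp_decode_phase:
  assumes s: "bnd B s" "reg s ''n'' = n" "reg s ''K'' = K" "reg s ''x'' = x" "x < n ^ K"
  shows "wp B decode_phase s (7 + K * 6) (\<lambda>s'. reg s' ''x'' = 0 \<and> reg s' ''RN'' = 0 \<and> reg s' ''y'' = 0 \<and>
     reg s' ''j'' = 0 \<and> (\<forall>j<K. arr s' ''smp'' j = digit x j) \<and>
     (\<forall>j\<ge>K. arr s' ''smp'' j = arr s ''smp'' j))"
    (is "wp B _ s _ ?Q")
  unfolding decode_phase_def
proof (rule wp_Seq[where ka = "4 + K * (3 + 3)" and kb = 3])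
  let ?c = "Seq (Assign ''RN'' (N 0)) (Seq (Assign ''y'' (N 0)) (Assign ''j'' (N 0)))"
  define I where "I i s' \<longleftrightarrow> reg s' ''n'' = n \<and> reg s' ''x'' = x div n ^ i \<and>
    (\<forall>j<i. arr s' ''smp'' j = digit x j) \<and> (\<forall>j\<ge>K. arr s' ''smp'' j = arr s ''smp'' j)" for i and s' :: store
  show "wp B (For ''j'' ''K'' decode_round) s (4 + K * (3 + 3)) (\<lambda>s'. wp B ?c s' 3 ?Q)"
  proof (rule wp_For[where n = K and k' = 3 and I = I])
    fix i s assume s: "bnd B s" "I i s" "i < K" "reg s ''j'' = i"
    have xi: "x div n ^ i div n = x div n ^ Suc i" by (simp add: power_Suc2 div_mult2_eq del: power_Suc)
    have md: "x div n ^ i - x div n ^ Suc i * n = digit x i"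
      unfolding xi[symmetric] digit_def by (rule minus_div_mult_eq_mod)
    have "x div n ^ i \<le> B" using bnd_reg[OF s(1), of "''x''"] s(2) by (simp add: I_def)
    then have le: "x div n ^ Suc i \<le> B" "digit x i \<le> B"
      using div_le_dividend[of "x div n ^ i" n] mod_less_eq_dividend[of "x div n ^ i" n]
      unfolding xi digit_def by linarith+
    show "wp B decode_round s 3 (I (Suc i))"
      by (rule wp_straight) (use s le md xi in \<open>auto simp: decode_round_def I_def less_Suc_eq\<close>)
  next
    fix s' assume b: "bnd B s'" and I: "I K s'"
    have "x div n ^ K = 0" using s(5) by simp
    then show "wp B ?c s' 3 ?Q"
      by (intro wp_straight) (use b I in \<open>auto simp: I_def bnd_def\<close>)
  qed (use s bnd_reg[OF s(1), of "''K''"] in \<open>auto simp: I_def decode_round_def\<close>)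
qed simp

end

lemma halts_with_Rand:
  assumes "exec c1 s s1 t1"
    and "\<And>x. x < max 1 (aval e s1) \<Longrightarrow> exec c2 (s1\<lparr>reg := (reg s1)(y := x)\<rparr>) (F x) (\<tau> x)"
  shows "halts_with (Seq c1 (Seq (Rand y e) c2)) s
     (map_pmf (\<lambda>x. (F x, t1 + (1 + acost e s1 + \<tau> x))) (pmf_of_set {0..<max 1 (aval e s1)}))"
proof -
  let ?B = "{0..<max 1 (aval e s1)}"
  obtain f1 where f1: "run f1 c1 s = return_pmf (Some (s1, t1))" using assms(1) by (auto simp: exec_def)
  have "\<forall>x\<in>?B. \<exists>f. run f c2 (s1\<lparr>reg := (reg s1)(y := x)\<rparr>) = return_pmf (Some (F x, \<tau> x))"
    using assms(2) by (auto simp: exec_def)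
  then obtain f2 where f2: "\<And>x. x \<in> ?B \<Longrightarrow>
      run (f2 x) c2 (s1\<lparr>reg := (reg s1)(y := x)\<rparr>) = return_pmf (Some (F x, \<tau> x))" by metis
  define g where "g = Max (insert f1 (f2 ` ?B))"
  have g1: "f1 \<le> Suc (Suc g)" unfolding g_def by (rule le_SucI, rule le_SucI, rule Max_ge) auto
  have g2: "f2 x \<le> Suc g" if "x \<in> ?B" for x unfolding g_def using that by (intro le_SucI Max_ge) auto
  have r1: "run (Suc (Suc g)) c1 s = return_pmf (Some (s1, t1))" by (rule run_mono_det[OF f1 g1])
  have r2: "run (Suc g) c2 (s1\<lparr>reg := (reg s1)(y := x)\<rparr>) = return_pmf (Some (F x, \<tau> x))" if "x \<in> ?B" for x
    by (rule run_mono_det[OF f2[OF that] g2[OF that]])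
  have "run (Suc (Suc g)) (Seq (Rand y e) c2) s1 =
    bind_pmf (pmf_of_set ?B) (\<lambda>x. charge (1 + acost e s1) (run (Suc g) c2 (s1\<lparr>reg := (reg s1)(y := x)\<rparr>)))"
    by (simp add: bind_map_pmf)
  also have "\<dots> = bind_pmf (pmf_of_set ?B) (\<lambda>x. return_pmf (Some (F x, 1 + acost e s1 + \<tau> x)))"
    by (intro bind_pmf_cong refl) (use r2 in \<open>auto simp: set_pmf_of_set\<close>)
  finally have *: "run (Suc (Suc g)) (Seq (Rand y e) c2) s1 =
    map_pmf (\<lambda>x. Some (F x, 1 + acost e s1 + \<tau> x)) (pmf_of_set ?B)" by (simp add: map_pmf_def)
  have "run (Suc (Suc (Suc g))) (Seq c1 (Seq (Rand y e) c2)) s =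
    charge t1 (run (Suc (Suc g)) (Seq (Rand y e) c2) s1)"
    unfolding run.simps(6)[of "Suc (Suc g)"] r1 by (simp add: bind_return_pmf del: run.simps)
  also have "\<dots> = map_pmf Some (map_pmf (\<lambda>x. (F x, t1 + (1 + acost e s1 + \<tau> x))) (pmf_of_set ?B))"
    unfolding * by (simp add: charge_def pmf.map_comp o_def)
  finally show ?thesis unfolding halts_with_def by blast
qed

definition sampling_part :: com where
  "sampling_part = Seq decode_phase
     (If (And (Equal (V ''bad'') (N 0)) (Equal (V ''cS'') (N 1))) main_phase (Assign ''inf'' (N 1)))"

definition st_radius_program :: com where
  "st_radius_program = Seq (Seq (Seq parameters collect) power_phase)
     (Seq (Rand ''x'' (V ''RN'')) sampling_part)"

context bichromatic_instance
begin

lemma adj_less: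
  assumes "e < 2 * m"
  shows "adj e < n"
proof -
  have "\<exists>u<v. off u \<le> e \<and> e < off (Suc u)" if "e < off v" "v \<le> n" for v
    using that
  proof (induction v)
    case 0
    then show ?case by (simp add: off_0)
  next
    case (Suc v)
    then show ?case by (cases "e < off v") (auto simp: less_Suc_eq)
  qed
  from this[of n] obtain u where u: "u < n" "off u \<le> e" "e < off (Suc u)" using assms off_n by auto
  then have "adj e \<in> adj ` {off u..<off (Suc u)}" by auto
  then have "(u, adj e) \<in> E" using adj_image[OF u(1)] by auto
  then show ?thesis by (rule E_verts)
qed

lemma radius_inactive: "radius < n \<Longrightarrow> T \<subseteq> A \<and> S \<inter> A \<noteq> {}"
proof -
  assume R: "radius < n"
  obtain s where s: "s \<in> S" "ecc s < n" using radius_attained R by auto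
  have sn: "s < n" using s S_sub' by auto
  have edge: "t \<in> A \<and> s \<in> A" if "t \<in> T" for t
  proof -
    have "D s t < n" using s(2) that ecc_le_iff[of s "ecc s"] by (meson le_less_trans order_refl)
    then have "(s, t) \<in> E\<^sup>*" using reach_iff[OF sn, of t] by simp
    moreover have "s \<noteq> t" using s that ST_disjoint by auto
    ultimately show ?thesis using A_iff E_sym by (metis converse_rtranclE rtranclE)
  qed
  then show ?thesis using s T_ne' by blast
qed

end

context bichromatic_run
begin

lemma bnd_input:
  assumes "(c + 4) * (n + 3) ^ 2 \<le> M"
  shows "bnd M (input_store c G S off adj)"
proof -
  have "c * 1 \<le> (c + 4) * (n + 3) ^ 2" by (intro mult_mono) auto
  then have cM: "c \<le> M" using assms by linarith
  have mM: "m \<le> M" "n \<le> M" "1 \<le> M" using m_le_M n_le_M M by linarith+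
  have "off i \<le> M" if "i \<le> n" for i using off_le[OF that] m_le_M by simp
  moreover have "adj e \<le> M" if "e < 2 * m" for e using adj_less[OF that] n_le_M by simp
  ultimately show ?thesis using cM mM M by (auto simp: bnd_def input_store_def)
qed

lemma wp_init:
  assumes M': "(c + 4) * (n + 3) ^ 2 \<le> M"
    and q: "n \<le> q * q" "(q - 1) * (q - 1) < n" "q \<le> n"
    and l: "n < 2 ^ l" "2 ^ (l - 1) \<le> n" "l \<le> n"
  shows "wp M (Seq parameters collect) (input_store c G S off adj) (14 * n + 12)
     (\<lambda>s. env s \<and> reg s ''K'' = (c + 4) * q * l \<and> reg s ''cS'' = of_bool (S \<inter> A \<noteq> {}) \<and>
       reg s ''bad'' = of_bool (\<not> T \<subseteq> A) \<and> (\<forall>u. arr s ''mx'' u = 0) \<and> reg s ''inf'' = 0)"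
    (is "wp M _ ?s _ ?Q")
proof (rule wp_Seq)
  have r: "reg ?s ''n'' = n" "reg ?s ''c'' = c" by (auto simp: input_store_def)
  have "(c + 4) * q * l \<le> (c + 4) * (n * n)" using q(3) l(3) by (simp add: mult_le_mono)
  also have "\<dots> \<le> (c + 4) * (n + 3) ^ 2" unfolding power2_eq_square by (intro mult_mono) auto
  also note M'
  finally have K: "(c + 4) * q * l \<le> M" .
  show "wp M parameters ?s (5 * n + 7) (\<lambda>s1. wp M collect s1 (9 * n + 5) ?Q)"
  proof (rule wp_conseq[OF wp_parameters[OF bnd_input[OF M'] r q l K] _ order_refl])
    fix s1 assume s1: "bnd M s1" "frame parameters ?s s1"
      "reg s1 ''big'' = 3 * n \<and> reg s1 ''q'' = q \<and> reg s1 ''K'' = (c + 4) * q * l"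
    have fr: "reg s1 x = reg ?s x" if "x \<in> {''n'', ''cS'', ''bad'', ''inf''}" for x
      by (rule frame_reg[OF s1(2)]) (use that in \<open>auto simp: parameters_def root_loop_def log_loop_def\<close>)
    have fa: "arr s1 a = arr ?s a" for a
      by (rule frame_arr[OF s1(2)]) (auto simp: parameters_def root_loop_def log_loop_def)
    have pre: "reg s1 ''n'' = n" "reg s1 ''big'' = 3 * n" "reg s1 ''q'' = q" "reg s1 ''cS'' = 0" "reg s1 ''bad'' = 0"
      "\<forall>v<n. arr s1 ''S'' v = of_bool (v \<in> S)" "\<forall>v\<le>n. arr s1 ''off'' v = off v" "\<forall>e<2 * m. arr s1 ''adj'' e = adj e"
      using s1(3) by (simp_all add: fr fa) (simp_all add: input_store_def)
    show "wp M collect s1 (9 * n + 5) ?Q"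
    proof (rule wp_conseq[OF wp_collect[OF s1(1) pre] _ order_refl])
      fix s2 assume s2: "frame collect s1 s2" "env s2 \<and> reg s2 ''cS'' = of_bool (S \<inter> A \<noteq> {}) \<and>
        reg s2 ''bad'' = of_bool (\<not> T \<subseteq> A)"
      have "reg s2 ''K'' = reg s1 ''K''" "reg s2 ''inf'' = reg s1 ''inf''" "arr s2 ''mx'' = arr s1 ''mx''"
        by (intro frame_reg[OF s2(1)] frame_arr[OF s2(1)]; simp add: collect_def collect_round_def)+
      moreover have "reg ?s ''inf'' = 0" "arr ?s ''mx'' u = 0" for u by (auto simp: input_store_def)
      ultimately show "?Q s2" using s2(2) s1(3) fr fa by simp
    qed
  qed
qed simp

definition good_output :: "nat set \<Rightarrow> store \<Rightarrow> bool" where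
  "good_output W s \<longleftrightarrow> (\<exists>b. estimate s = to_ereal b \<and> radius \<le> b \<and> (b < n \<or> b = 3 * n) \<and>
     (well_spread q W \<longrightarrow> radius < n \<longrightarrow> b \<le> radius + slack radius))"

definition rest_time :: "nat \<Rightarrow> nat" where
  "rest_time K = (if T \<subseteq> A \<and> S \<inter> A \<noteq> {} then main_time K else 1)"

lemma exec_sampling_part:
  assumes s: "bnd M s" "env s" "reg s ''K'' = K" "reg s ''cS'' = of_bool (S \<inter> A \<noteq> {})"
    "reg s ''bad'' = of_bool (\<not> T \<subseteq> A)" "\<forall>u. arr s ''mx'' u = 0" "reg s ''inf'' = 0"
    and s2: "bnd B s2" "frame power_phase s s2" "n ^ K \<le> B" and x: "x < n ^ K"
    and q: "n \<le> q * q" "1 \<le> q"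
  shows "\<exists>s' t. exec sampling_part (s2\<lparr>reg := (reg s2)(''x'' := x)\<rparr>) s' t \<and>
     t \<le> (7 + K * 6) * unit_cost B + (1 + rest_time K) * unit_cost M \<and>
     good_output (digit x ` {..<K}) s'"
proof -
  let ?s3 = "s2\<lparr>reg := (reg s2)(''x'' := x)\<rparr>"
  have b3: "bnd B ?s3" using s2(1,3) x by (auto simp: bnd_def)
  have r2: "reg s2 y = reg s y" if "y \<notin> {''RN'', ''j''}" for y
    by (rule frame_reg[OF s2(2)]) (use that in \<open>auto simp: power_phase_def\<close>)
  have a2: "arr s2 a = arr s a" for a
    by (rule frame_arr[OF s2(2)]) (auto simp: power_phase_def)
  have n: "reg s ''n'' = n" using s(2) by (simp add: env_def)
  have r3: "reg ?s3 ''n'' = n" "reg ?s3 ''K'' = K" "reg ?s3 ''x'' = x" using n s(3) by (simp_all add: r2)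
  obtain s4 t4 where e4: "exec decode_phase ?s3 s4 t4" "t4 \<le> (7 + K * 6) * unit_cost B"
    and d: "reg s4 ''x'' = 0" "reg s4 ''RN'' = 0" "reg s4 ''y'' = 0" "reg s4 ''j'' = 0"
      "\<forall>j<K. arr s4 ''smp'' j = digit x j" "\<forall>j\<ge>K. arr s4 ''smp'' j = arr ?s3 ''smp'' j"
    using wp_decode_phase[OF b3 r3 x] by (auto simp: wp_def)
  have f4: "frame decode_phase ?s3 s4" by (rule exec_frame[OF e4(1)])
  have r4: "reg s4 y = reg s y" if "y \<notin> {''RN'', ''j'', ''x'', ''y''}" for y
  proof -
    have "reg s4 y = reg ?s3 y"
      by (rule frame_reg[OF f4]) (use that in \<open>auto simp: decode_phase_def decode_round_def\<close>)
    then show ?thesis using that by (simp add: r2)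
  qed
  have a4: "arr s4 a = arr s a" if "a \<noteq> ''smp''" for a
  proof -
    have "arr s4 a = arr ?s3 a"
      by (rule frame_arr[OF f4]) (use that in \<open>auto simp: decode_phase_def decode_round_def\<close>)
    then show ?thesis by (simp add: a2)
  qed
  have dn: "digit x j < n" for j using n_ge_2 by (simp add: digit_def)
  have b4: "bnd M s4"
    unfolding bnd_def
  proof (intro conjI allI)
    show "4 \<le> M" using M by simp
    show "reg s4 y \<le> M" for y
      using r4[of y] d(1-4) bnd_reg[OF s(1), of y] by (cases "y \<in> {''RN'', ''j'', ''x'', ''y''}") auto
    show "arr s4 a j \<le> M" for a j
    proof (cases "a = ''smp''")
      case True
      then show ?thesis
        using d(5,6) dn[of j] n_le_M bnd_arr[OF s(1), of "''smp''" j] a2 by (cases "j < K") auto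
    next
      case False
      then show ?thesis using a4 bnd_arr[OF s(1)] by simp
    qed
  qed
  have env4: "env s4" using s(2) by (simp add: env_def r4 a4)
  let ?if = "If (And (Equal (V ''bad'') (N 0)) (Equal (V ''cS'') (N 1))) main_phase (Assign ''inf'' (N 1))"
  have cond: "bval (And (Equal (V ''bad'') (N 0)) (Equal (V ''cS'') (N 1))) s4 \<longleftrightarrow> T \<subseteq> A \<and> S \<inter> A \<noteq> {}"
    using s(4,5) by (simp add: r4)
  have "wp M ?if s4 (1 + rest_time K) (good_output (digit x ` {..<K}))"
  proof (rule wp_If[OF b4 _ order_refl])
    assume "bval (And (Equal (V ''bad'') (N 0)) (Equal (V ''cS'') (N 1))) s4"
    then have ok: "T \<subseteq> A" "S \<inter> A \<noteq> {}" using cond by auto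
    have K4: "reg s4 ''K'' = K" "\<forall>u\<in>A. arr s4 ''mx'' u = 0" "reg s4 ''inf'' = 0"
      using s(3,6,7) by (simp_all add: r4 a4)
    have "wp M main_phase s4 (main_time K) (good_output (digit x ` {..<K}))"
      unfolding good_output_def
      by (rule wp_main_phase[OF b4 env4 K4(1) _ dn K4(2,3) ok q]) (use d(5) in simp)
    then show "wp M main_phase s4 (rest_time K) (good_output (digit x ` {..<K}))"
      using ok by (simp add: rest_time_def)
  next
    assume "\<not> bval (And (Equal (V ''bad'') (N 0)) (Equal (V ''cS'') (N 1))) s4"
    then have nok: "\<not> (T \<subseteq> A \<and> S \<inter> A \<noteq> {})" using cond by blast
    then have "\<not> radius < n" using radius_inactive by blast
    moreover have "best_ok (3 * n)" by (simp add: best_ok_def)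
    ultimately have "good_output (digit x ` {..<K}) (s4\<lparr>reg := (reg s4)(''inf'' := 1)\<rparr>)"
      unfolding good_output_def
      using best_ok_estimate[of "3 * n" "s4\<lparr>reg := (reg s4)(''inf'' := 1)\<rparr>"]
      by (intro exI[of _ "3 * n"]) auto
    then show "wp M (Assign ''inf'' (N 1)) s4 (rest_time K) (good_output (digit x ` {..<K}))"
      using nok M by (intro wp_straight b4) (auto simp: rest_time_def)
  qed simp
  then obtain s5 t5 where e5: "exec ?if s4 s5 t5" "t5 \<le> (1 + rest_time K) * unit_cost M"
    "good_output (digit x ` {..<K}) s5" by (auto simp: wp_def)
  have "exec sampling_part ?s3 s5 (t4 + t5)"
    unfolding sampling_part_def by (rule exec_Seq[OF e4(1) e5(1)])
  then show ?thesis using e4(2) e5(2,3) by (meson add_mono)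
qed

section \<open>Probability of failure\<close>

lemma card_digits_avoid:
  assumes "Y \<subseteq> {0..<n}"
  shows "card {x. x < n ^ K \<and> (\<forall>j<K. digit x j \<notin> Y)} \<le> (n - card Y) ^ K"
proof (induction K)
  case 0
  have "{x. x < n ^ 0 \<and> (\<forall>j<0. digit x j \<notin> Y)} = {0}" by auto
  then show ?case by simp
next
  case (Suc K)
  let ?B = "\<lambda>K. {x. x < n ^ K \<and> (\<forall>j<K. digit x j \<notin> Y)}"
  have fin: "finite (?B K)" by auto
  have "card (?B (Suc K)) \<le> card (({0..<n} - Y) \<times> ?B K)"
  proof (rule card_inj_on_le)
    show "inj_on (\<lambda>x. (x mod n, x div n)) (?B (Suc K))"
      by (rule inj_onI) (metis Pair_inject div_mult_mod_eq)
    show "(\<lambda>x. (x mod n, x div n)) ` ?B (Suc K) \<subseteq> ({0..<n} - Y) \<times> ?B K"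
    proof
      fix p assume "p \<in> (\<lambda>x. (x mod n, x div n)) ` ?B (Suc K)"
      then obtain x where x: "x < n ^ Suc K" "\<forall>j<Suc K. digit x j \<notin> Y" "p = (x mod n, x div n)" by auto
      have "x div n < n ^ K" using x(1) n_ge_2 by (simp add: less_mult_imp_div_less mult.commute)
      moreover have "digit (x div n) j = digit x (Suc j)" for j by (simp add: digit_def div_mult2_eq)
      moreover have "x mod n = digit x 0" "digit x 0 < n" using n_ge_2 by (simp_all add: digit_def)
      ultimately show "p \<in> ({0..<n} - Y) \<times> ?B K" using x by auto
    qed
  qed (use fin in auto)
  also have "\<dots> = (n - card Y) * card (?B K)"
    using assms by (simp add: card_cartesian_product card_Diff_subset finite_subset)
  also have "\<dots> \<le> (n - card Y) * (n - card Y) ^ K" using Suc.IH by (intro mult_left_mono) auto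
  finally show ?case by simp
qed

lemma card_not_spread:
  "card {x. x < n ^ K \<and> \<not> well_spread q (digit x ` {..<K})} \<le> 3 * n ^ 2 * (n - q) ^ K"
proof -
  define I where "I = {(w, r). w < n \<and> r < 3 * n \<and> q \<le> card (T \<inter> gball w r)}"
  define B where "B p = {x. x < n ^ K \<and> (\<forall>j<K. digit x j \<notin> T \<inter> gball (fst p) (snd p))}" for p
  have I_sub: "I \<subseteq> {0..<n} \<times> {0..<3 * n}" by (auto simp: I_def)
  then have finI: "finite I" by (rule finite_subset) simp
  have cardI: "card I \<le> n * (3 * n)" using card_mono[OF _ I_sub] by simp
  have "{x. x < n ^ K \<and> \<not> well_spread q (digit x ` {..<K})} \<subseteq> (\<Union>p\<in>I. B p)"
  proof
    fix x assume "x \<in> {x. x < n ^ K \<and> \<not> well_spread q (digit x ` {..<K})}"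
    then obtain w r where x: "x < n ^ K" and wr: "w < n" "r < 3 * n" "q \<le> card (T \<inter> gball w r)"
      "digit x ` {..<K} \<inter> T \<inter> gball w r = {}" unfolding well_spread_def by blast
    then have "(w, r) \<in> I" "x \<in> B (w, r)" by (auto simp: I_def B_def)
    then show "x \<in> (\<Union>p\<in>I. B p)" by blast
  qed
  then have "card {x. x < n ^ K \<and> \<not> well_spread q (digit x ` {..<K})} \<le> card (\<Union>p\<in>I. B p)"
    using finI by (intro card_mono) (auto simp: B_def)
  also have "\<dots> \<le> (\<Sum>p\<in>I. card (B p))" by (rule card_UN_le[OF finI])
  also have "\<dots> \<le> (\<Sum>p\<in>I. (n - q) ^ K)"
  proof (rule sum_mono)
    fix p assume p: "p \<in> I"
    have "card (B p) \<le> (n - card (T \<inter> gball (fst p) (snd p))) ^ K"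
      unfolding B_def using T_sub by (intro card_digits_avoid) auto
    also have "\<dots> \<le> (n - q) ^ K" using p by (intro power_mono) (auto simp: I_def)
    finally show "card (B p) \<le> (n - q) ^ K" .
  qed
  also have "\<dots> = card I * (n - q) ^ K" by simp
  also have "\<dots> \<le> (n * (3 * n)) * (n - q) ^ K" using cardI by (intro mult_right_mono) auto
  finally show ?thesis by (simp add: power2_eq_square mult.assoc)
qed

lemma failure_bound:
  assumes q: "n \<le> q * q" "q \<le> n" and l: "n < 2 ^ l" and K: "K = (c + 4) * q * l"
  shows "real (3 * n ^ 2 * (n - q) ^ K) \<le> real (n ^ K) / real n ^ c"
proof -
  have n: "0 < real n" using n_ge_2 by simp
  define y where "y = real q / real n"
  have "real (n - q) = real n * (1 - y)" using q n by (simp add: y_def of_nat_diff field_simps)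
  also have "\<dots> \<le> real n * exp (- y)" using exp_ge_add_one_self[of "- y"] n by (intro mult_left_mono) auto
  finally have "real (n - q) ^ K \<le> (real n * exp (- y)) ^ K" by (intro power_mono) auto
  also have "\<dots> = real n ^ K * exp (- (y * real K))"
    by (simp add: power_mult_distrib exp_of_nat_mult[symmetric] mult.commute)
  also have "exp (- (y * real K)) \<le> exp (- (real (c + 4) * real l))"
  proof -
    have "real n \<le> real q * real q" using q(1) by (metis of_nat_le_iff of_nat_mult)
    then have "1 \<le> y * real q" using n by (simp add: y_def field_simps)
    then have "real (c + 4) * real l * 1 \<le> real (c + 4) * real l * (y * real q)" by (intro mult_left_mono) auto
    then show ?thesis by (simp add: K algebra_simps)
  qed
  also have "exp (- (real (c + 4) * real l)) = exp (- real l) ^ (c + 4)"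
    using exp_of_nat_mult[of "c + 4" "- real l"] by simp
  also have "\<dots> \<le> (1 / real n) ^ (c + 4)"
  proof (intro power_mono)
    have "real n \<le> 2 ^ l" using l by (metis less_imp_le of_nat_le_iff of_nat_numeral of_nat_power)
    also have "(2::real) ^ l \<le> exp 1 ^ l" using exp_ge_add_one_self[of 1] by (intro power_mono) auto
    also have "\<dots> = exp (real l)" using exp_of_nat_mult[of l "1::real"] by simp
    finally show "exp (- real l) \<le> 1 / real n" using n by (simp add: exp_minus field_simps)
  qed simp
  finally have "real (n - q) ^ K \<le> real n ^ K * (1 / real n) ^ (c + 4)" using n by simp
  then have "3 * real n ^ 2 * real (n - q) ^ K \<le> 3 * real n ^ 2 * (real n ^ K * (1 / real n) ^ (c + 4))"
    by (intro mult_left_mono) auto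
  also have "\<dots> = (3 / real n ^ 2) * (real n ^ K / real n ^ c)"
    using n by (simp add: power_divide power_add field_simps eval_nat_numeral)
  also have "\<dots> \<le> 1 * (real n ^ K / real n ^ c)"
  proof (rule mult_right_mono)
    have "(2::real) ^ 2 \<le> real n ^ 2" using n_ge_2 by (intro power_mono) auto
    then show "3 / real n ^ 2 \<le> 1" using n by (simp add: field_simps)
  qed simp
  finally show ?thesis by simp
qed

lemma good_output_approx:
  assumes g: "good_output W s" and W: "well_spread q W"
  shows "ST_radius G S T \<le> estimate s \<and>
     estimate s \<le> ereal (5/3) * ST_radius G S T + ereal (5/3) \<and>
     ((\<exists>j :: nat. ST_radius G S T = ereal (real (3 * j))) \<longrightarrow>
        estimate s \<le> ereal (5/3) * ST_radius G S T + 1)"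
proof -
  obtain b where b: "estimate s = to_ereal b" "radius \<le> b" "b < n \<or> b = 3 * n"
    "radius < n \<Longrightarrow> b \<le> radius + slack radius" using g W unfolding good_output_def by auto
  have le: "ST_radius G S T \<le> estimate s"
    unfolding ST_radius_eq b(1) using to_ereal_mono b(2) by (auto dest: monoD)
  show ?thesis
  proof (cases "radius < n")
    case True
    have "b \<le> radius + slack radius" using b(4) True by simp
    moreover have "slack radius \<le> radius + 3" by (rule slack_props)
    ultimately have "b < n" using b(3) True n_ge_2 by linarith
    then have eq: "estimate s = ereal (real b)" "ST_radius G S T = ereal (real radius)"
      using b(1) True by (auto simp: ST_radius_eq to_ereal_def)
    have br: "real b \<le> real (radius + slack radius)" using b(4) True by (intro of_nat_mono) simp
    then have "real b \<le> 5/3 * real radius + 5/3" using approx_bound(1)[of radius] by linarith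
    moreover have "real b \<le> 5/3 * real radius + 1" if "ereal (real radius) = ereal (real (3 * j))" for j :: nat
    proof -
      have "radius = 3 * j" using that by (simp only: ereal.inject of_nat_eq_iff)
      then show ?thesis using br approx_bound(2)[of radius] by simp
    qed
    ultimately show ?thesis using le unfolding eq by (auto simp: one_ereal_def)
  next
    case False
    then have "ST_radius G S T = \<infinity>" by (simp add: ST_radius_eq to_ereal_def)
    then show ?thesis using le by simp
  qed
qed

end

section \<open>Running time\<close>

lemma word_cost_less: "x < 2 ^ k \<Longrightarrow> word_cost x \<le> k + 1"
  using floorlog_le_of_less[of x k] by (simp add: word_cost_def)

lemma unit_cost_bounds:
  fixes n l c K :: nat
  assumes n: "2 \<le> n" "n < 2 ^ l" and K: "1 \<le> K"
  shows "unit_cost ((c + 4) * (n + 3) ^ 2) \<le> 5001 * ((c + 11) * l)"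
    "unit_cost ((c + 4) * (n + 3) ^ 2 + n ^ K) \<le> 5001 * ((c + 12) * (l * K))"
proof -
  have l: "1 \<le> l" using n by (cases l) auto
  have "n + 3 < 2 ^ (l + 2)" using n by (simp add: power_add)
  then have "(n + 3) ^ 2 < (2 ^ (l + 2)) ^ 2" by (intro power_strict_mono) auto
  also have "(2 ^ (l + 2)) ^ 2 = (2::nat) ^ ((l + 2) * 2)" by (rule power_mult[symmetric])
  also have "(l + 2) * 2 = 2 * l + 4" by simp
  finally have "(c + 4) * (n + 3) ^ 2 < 2 ^ (c + 4) * 2 ^ (2 * l + 4)"
    using less_exp[of "c + 4"] by (intro mult_strict_mono) auto
  then have M: "(c + 4) * (n + 3) ^ 2 < 2 ^ (c + 8 + 2 * l)" by (simp add: power_add)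
  have "c + 8 + 2 * l + 1 \<le> (c + 11) * l"
    using l by (cases l) (auto simp: algebra_simps)
  then show "unit_cost ((c + 4) * (n + 3) ^ 2) \<le> 5001 * ((c + 11) * l)"
    using word_cost_less[OF M] unfolding unit_cost_def by simp
  have lK: "1 \<le> l * K" "l \<le> l * K" using l K by auto
  have "n ^ K \<le> (2 ^ l) ^ K" using n by (intro power_mono) auto
  then have nK: "n ^ K \<le> 2 ^ (l * K)" by (simp add: power_mult)
  have "(2::nat) ^ a + 2 ^ b \<le> 2 ^ (a + b)" if ab: "1 \<le> a" "1 \<le> b" for a b :: nat
  proof -
    have "2 \<le> (2::nat) ^ a" "2 \<le> (2::nat) ^ b"
      using ab power_increasing[of 1 _ "2::nat"] by simp_all
    then obtain x y where "(2::nat) ^ a = 2 + x" "(2::nat) ^ b = 2 + y" by (metis le_iff_add)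
    then show ?thesis by (simp add: power_add algebra_simps)
  qed
  from this[of "c + 8 + 2 * l" "l * K"] M nK lK
  have "(c + 4) * (n + 3) ^ 2 + n ^ K < 2 ^ (c + 8 + 2 * l + l * K)" by linarith
  from word_cost_less[OF this]
  have "word_cost ((c + 4) * (n + 3) ^ 2 + n ^ K) \<le> c + 8 + 2 * l + l * K + 1" .
  also have "\<dots> \<le> (c + 12) * (l * K)"
  proof -
    have "c \<le> c * (l * K)" using lK by simp
    then show ?thesis using lK unfolding distrib_right by linarith
  qed
  finally show "unit_cost ((c + 4) * (n + 3) ^ 2 + n ^ K) \<le> 5001 * ((c + 12) * (l * K))"
    unfolding unit_cost_def by simp
qed

definition time_const :: "nat \<Rightarrow> nat" where
  "time_const c = 5001 * (22 * (c + 11) + 92 * ((c + 12) * (c + 4) ^ 2) + 2000 * ((c + 6) * (c + 11)))"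

lemma total_time:
  fixes n m q l c K U B :: nat
  assumes q: "q * q \<le> 4 * n" and l: "1 \<le> l" and K: "K = (c + 4) * q * l"
    and U: "U \<le> 5001 * ((c + 11) * l)" and B: "B \<le> 5001 * ((c + 12) * (l * K))"
  shows "22 * n * U + 23 * K * B + 2000 * (c + 6) * (q * l * m) * U \<le> time_const c * ((n + m * q) * l ^ 3)"
proof -
  have l3: "l \<le> l ^ 3" "l ^ 2 \<le> l ^ 3" using l power_increasing[of 1 3 l] power_increasing[of 2 3 l] by auto
  have "22 * n * U \<le> 22 * n * (5001 * ((c + 11) * l))" using U by (rule mult_left_mono) simp
  also have "\<dots> = 5001 * (22 * (c + 11)) * (n * l)" by simp
  also have "\<dots> \<le> 5001 * (22 * (c + 11)) * (n * l ^ 3)" using l3 by (intro mult_left_mono) auto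
  finally have 1: "22 * n * U \<le> 5001 * (22 * (c + 11)) * (n * l ^ 3)" .
  have "23 * K * B \<le> 23 * K * (5001 * ((c + 12) * (l * K)))" using B by (rule mult_left_mono) simp
  also have "\<dots> = 5001 * (23 * ((c + 12) * (c + 4) ^ 2)) * ((q * q) * l ^ 3)"
    by (simp add: K power2_eq_square power3_eq_cube)
  also have "\<dots> \<le> 5001 * (23 * ((c + 12) * (c + 4) ^ 2)) * ((4 * n) * l ^ 3)"
    using q by (intro mult_left_mono mult_right_mono) auto
  finally have 2: "23 * K * B \<le> 5001 * (92 * ((c + 12) * (c + 4) ^ 2)) * (n * l ^ 3)" by simp
  have "2000 * (c + 6) * (q * l * m) * U \<le> 2000 * (c + 6) * (q * l * m) * (5001 * ((c + 11) * l))"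
    using U by (rule mult_left_mono) simp
  also have "\<dots> = 5001 * (2000 * ((c + 6) * (c + 11))) * (m * q * l ^ 2)"
    by (simp add: power2_eq_square)
  also have "\<dots> \<le> 5001 * (2000 * ((c + 6) * (c + 11))) * (m * q * l ^ 3)"
    using l3 by (intro mult_left_mono) auto
  finally have 3: "2000 * (c + 6) * (q * l * m) * U \<le> 5001 * (2000 * ((c + 6) * (c + 11))) * (m * q * l ^ 3)" .
  define X Y where "X = n * l ^ 3" and "Y = m * q * l ^ 3"
  have "time_const c * ((n + m * q) * l ^ 3) = time_const c * X + time_const c * Y"
    by (simp add: X_def Y_def algebra_simps)
  moreover have "(5001 * (22 * (c + 11)) + 5001 * (92 * ((c + 12) * (c + 4) ^ 2))) * X \<le> time_const c * X"
    unfolding time_const_def by (rule mult_right_mono) (simp_all add: distrib_left)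
  moreover have "5001 * (2000 * ((c + 6) * (c + 11))) * Y \<le> time_const c * Y"
    unfolding time_const_def by (rule mult_right_mono) (simp_all add: distrib_left)
  ultimately show ?thesis
    using 1 2 3 unfolding X_def[symmetric] Y_def[symmetric] by (simp add: distrib_right)
qed

lemma time_bound_real:
  fixes n m q l c t :: nat
  assumes n: "2 \<le> n" and q: "q * q \<le> 4 * n" and l: "2 ^ (l - 1) \<le> n"
    and t: "t \<le> time_const c * ((n + m * q) * l ^ 3)"
  shows "real t \<le> (16 * real (time_const c)) * (real n + real m * sqrt (real n)) * log 2 (real n) ^ 3"
proof -
  have "real (q * q) \<le> real (4 * n)" using q by (rule of_nat_mono)
  then have "real q ^ 2 \<le> 4 * real n" by (simp add: power2_eq_square)
  then have "real q \<le> sqrt (4 * real n)" by (rule real_le_rsqrt)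
  then have q': "real q \<le> 2 * sqrt (real n)" by (simp add: real_sqrt_mult)
  have "1 \<le> log 2 (real n)" using n by (simp add: le_log_iff)
  moreover have "real (l - 1) \<le> log 2 (real n)" using l n by (intro le_log2_of_power) auto
  ultimately have l': "real l \<le> 2 * log 2 (real n)" by linarith
  have "real m * real q \<le> real m * (2 * sqrt (real n))" using q' by (intro mult_left_mono) auto
  then have nm: "real n + real m * real q \<le> 2 * (real n + real m * sqrt (real n))"
    by (simp add: algebra_simps)
  have "real l ^ 3 \<le> (2 * log 2 (real n)) ^ 3" using l' by (intro power_mono) auto
  then have l3: "real l ^ 3 \<le> 8 * log 2 (real n) ^ 3" by (simp add: power_mult_distrib)
  have "real t \<le> real (time_const c * ((n + m * q) * l ^ 3))" using t by (rule of_nat_mono)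
  also have "\<dots> = real (time_const c) * ((real n + real m * real q) * real l ^ 3)" by simp
  also have "\<dots> \<le> real (time_const c) * ((2 * (real n + real m * sqrt (real n))) * (8 * log 2 (real n) ^ 3))"
    using nm l3 by (intro mult_left_mono mult_mono) auto
  finally have "real t \<le> real (time_const c) * ((2 * (real n + real m * sqrt (real n))) * (8 * log 2 (real n) ^ 3))" .
  moreover have "a * ((2 * x) * (8 * y)) = (16 * a) * x * y" for a x y :: real by simp
  ultimately show ?thesis by (simp only:)
qed

context bichromatic_instance
begin

lemma program_correct:
  "\<exists>p. halts_with st_radius_program (input_store c G S off adj) p \<and>
     (\<forall>(s, t) \<in> set_pmf p. real t \<le> time_bound (16 * real (time_const c)) 3 G) \<and>
     measure_pmf.prob p {(s, t).
         ST_radius G S T \<le> estimate s \<and>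
         estimate s \<le> ereal (5/3) * ST_radius G S T + ereal (5/3) \<and>
         ((\<exists>j :: nat. ST_radius G S T = ereal (real (3 * j))) \<longrightarrow>
           estimate s \<le> ereal (5/3) * ST_radius G S T + 1)}
       \<ge> 1 - 1 / real n ^ c"
  (is "\<exists>p. _ \<and> _ \<and> _ \<le> measure_pmf.prob p ?X")
proof -
  define q where "q = (LEAST q. n \<le> q * q)"
  have q1: "n \<le> q * q" unfolding q_def by (rule LeastI[of _ n]) (use n_ge_2 in simp)
  have qn: "q \<le> n" unfolding q_def by (rule Least_le) (use n_ge_2 in simp)
  have q0: "1 \<le> q" using q1 n_ge_2 by (cases q) auto
  have q2: "(q - 1) * (q - 1) < n"
    using not_less_Least[of "q - 1" "\<lambda>q. n \<le> q * q"] q0 unfolding q_def[symmetric] by simp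
  have q4: "q * q \<le> 4 * n"
  proof (cases "q = 1")
    case False
    then have "q \<le> 2 * (q - 1)" using q0 by simp
    then have "q * q \<le> (2 * (q - 1)) * (2 * (q - 1))" by (intro mult_mono) auto
    then show ?thesis using q2 by simp
  qed (use n_ge_2 in simp)
  define l where "l = (LEAST l. n < (2::nat) ^ l)"
  have l1: "n < 2 ^ l" unfolding l_def by (rule LeastI[of _ n]) (rule less_exp)
  have ln: "l \<le> n" unfolding l_def by (rule Least_le) (rule less_exp)
  have l0: "1 \<le> l" using l1 n_ge_2 by (cases l) auto
  have l2: "2 ^ (l - 1) \<le> n"
    using not_less_Least[of "l - 1" "\<lambda>l. n < 2 ^ l"] l0 unfolding l_def[symmetric] by simp
  define K where "K = (c + 4) * q * l"
  have K0: "1 \<le> K" using q0 l0 by (simp add: K_def Suc_le_eq)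
  define M where "M = (c + 4) * (n + 3) ^ 2"
  define B where "B = M + n ^ K"
  have "1 * (n + 3) ^ 2 \<le> M" unfolding M_def by (rule mult_right_mono) auto
  then have "n * n + 3 * n + 4 \<le> M" by (simp add: power2_eq_square algebra_simps)
  then interpret bichromatic_run G S off adj M q by unfold_locales
  let ?s = "input_store c G S off adj"
  obtain s1 t1 where e1: "exec (Seq parameters collect) ?s s1 t1" "t1 \<le> (14 * n + 12) * unit_cost M"
    and s1: "bnd M s1" "env s1" "reg s1 ''K'' = K" "reg s1 ''cS'' = of_bool (S \<inter> A \<noteq> {})"
       "reg s1 ''bad'' = of_bool (\<not> T \<subseteq> A)" "\<forall>u. arr s1 ''mx'' u = 0" "reg s1 ''inf'' = 0"
    using wp_init[of c l, OF _ q1 q2 qn l1 l2 ln] unfolding wp_def M_def K_def by blast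
  have b1: "bnd B s1" using s1(1) unfolding bnd_def B_def by (auto intro: trans_le_add1)
  have n1: "reg s1 ''n'' = n" using s1(2) by (simp add: env_def)
  obtain s2 t2 where e2: "exec power_phase s1 s2 t2" "t2 \<le> (5 + K * 4) * unit_cost B"
    and s2: "bnd B s2" "reg s2 ''RN'' = n ^ K"
    using wp_power_phase[OF b1 n1 s1(3)] unfolding wp_def B_def by auto
  have f2: "frame power_phase s1 s2" by (rule exec_frame[OF e2(1)])
  have nB: "n ^ K \<le> B" by (simp add: B_def)
  let ?R = "{0..<n ^ K}"
  have "\<forall>x\<in>?R. \<exists>s' t. exec sampling_part (s2\<lparr>reg := (reg s2)(''x'' := x)\<rparr>) s' t \<and>
     t \<le> (7 + K * 6) * unit_cost B + (1 + rest_time K) * unit_cost M \<and>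
     good_output (digit x ` {..<K}) s'"
    using exec_sampling_part[OF s1 s2(1) f2 nB _ q1 q0] by simp
  then obtain F \<tau> where F\<tau>: "\<forall>x\<in>?R. exec sampling_part (s2\<lparr>reg := (reg s2)(''x'' := x)\<rparr>) (F x) (\<tau> x) \<and>
     \<tau> x \<le> (7 + K * 6) * unit_cost B + (1 + rest_time K) * unit_cost M \<and>
     good_output (digit x ` {..<K}) (F x)" by metis
  have F: "exec sampling_part (s2\<lparr>reg := (reg s2)(''x'' := x)\<rparr>) (F x) (\<tau> x)"
    "\<tau> x \<le> (7 + K * 6) * unit_cost B + (1 + rest_time K) * unit_cost M"
    "good_output (digit x ` {..<K}) (F x)" if "x < n ^ K" for x
    using F\<tau> that by auto
  have nK: "max 1 (aval (V ''RN'') s2) = n ^ K" using s2(2) n_ge_2 by (simp add: max_def Suc_le_eq)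
  define p where "p = map_pmf (\<lambda>x. (F x, (t1 + t2) + (1 + acost (V ''RN'') s2 + \<tau> x))) (pmf_of_set ?R)"
  have "halts_with st_radius_program ?s p"
    unfolding st_radius_program_def p_def
    using halts_with_Rand[OF exec_Seq[OF e1(1) e2(1)], of "V ''RN''" sampling_part "''x''" F \<tau>] F(1)
    unfolding nK by blast
  moreover have "real t \<le> time_bound (16 * real (time_const c)) 3 G" if st: "(s, t) \<in> set_pmf p" for s t
  proof -
    have "0 < n ^ K" using n_ge_2 by simp
    then have "set_pmf (pmf_of_set ?R) = ?R" by (intro set_pmf_of_set) auto
    then obtain x where x: "x < n ^ K" "t = (t1 + t2) + (1 + acost (V ''RN'') s2 + \<tau> x)"
      using st unfolding p_def set_map_pmf by auto
    have "acost (V ''RN'') s2 \<le> asz (V ''RN'') * (50 * word_cost B)" by (rule acost_le[OF s2(1)]) simp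
    also have "\<dots> \<le> 100 * (50 * word_cost B)" by simp
    finally have "1 + acost (V ''RN'') s2 \<le> unit_cost B" by (rule unit_cost_ge)
    then have "t \<le> (14 * n + 12) * unit_cost M + (5 + K * 4) * unit_cost B + unit_cost B +
        ((7 + K * 6) * unit_cost B + (1 + rest_time K) * unit_cost M)"
      using e1(2) e2(2) F(2)[OF x(1)] x(2) by linarith
    also have "\<dots> = (14 * n + 13 + rest_time K) * unit_cost M + (13 + K * 10) * unit_cost B"
      by (simp add: algebra_simps)
    also have "\<dots> \<le> (22 * n + 2000 * (c + 6) * (q * l * m)) * unit_cost M + (23 * K) * unit_cost B"
    proof (rule add_mono; rule mult_right_mono)
      show "13 + K * 10 \<le> 23 * K" using K0 by simp
      show "14 * n + 13 + rest_time K \<le> 22 * n + 2000 * (c + 6) * (q * l * m)"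
      proof (cases "T \<subseteq> A \<and> S \<inter> A \<noteq> {}")
        case True
        then have "card A \<noteq> 0" using finite_A by auto
        then have m: "1 \<le> m" using card_A by simp
        have "K + q + 1 \<le> (c + 6) * (q * l)"
        proof -
          have "q * 1 \<le> q * l" "1 * 1 \<le> q * l" using q0 l0 by (intro mult_mono; simp)+
          then have "K + q + 1 \<le> (c + 4) * (q * l) + q * l + q * l" unfolding K_def mult.assoc by linarith
          also have "\<dots> = (c + 6) * (q * l)" by (simp add: algebra_simps)
          finally show ?thesis .
        qed
        then have "main_time K \<le> 1000 * ((c + 6) * (q * l)) * (2 * m)"
          unfolding main_time_def using m by (intro mult_mono) auto
        also have "\<dots> = 2000 * (c + 6) * (q * l * m)" by simp
        finally have "main_time K \<le> 2000 * (c + 6) * (q * l * m)" .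
        then show ?thesis using True n_ge_2 by (simp add: rest_time_def)
      qed (use n_ge_2 in \<open>auto simp: rest_time_def\<close>)
    qed auto
    also have "\<dots> = 22 * n * unit_cost M + 23 * K * unit_cost B + 2000 * (c + 6) * (q * l * m) * unit_cost M"
      by (simp add: algebra_simps)
    also have "\<dots> \<le> time_const c * ((n + m * q) * l ^ 3)"
      by (rule total_time[OF q4 l0 K_def])
         (use unit_cost_bounds[OF n_ge_2 l1 K0, of c] in \<open>simp_all only: M_def B_def\<close>)
    finally show ?thesis
      using time_bound_real[OF n_ge_2 q4 l2] by (simp add: time_bound_def Let_def)
  qed
  moreover have "1 - 1 / real n ^ c \<le> measure_pmf.prob p ?X"
  proof -
    let ?bad = "{x. x < n ^ K \<and> \<not> well_spread q (digit x ` {..<K})}"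
    let ?g = "\<lambda>x. (F x, (t1 + t2) + (1 + acost (V ''RN'') s2 + \<tau> x))"
    have fin: "finite ?R" "?R \<noteq> {}" using n_ge_2 by auto
    have pos: "0 < real (n ^ K)" using n_ge_2 by simp
    have "real (card ?bad) \<le> real (3 * n ^ 2 * (n - q) ^ K)" using card_not_spread by (rule of_nat_mono)
    also have "\<dots> \<le> real (n ^ K) / real n ^ c" by (rule failure_bound[OF q1 qn l1 K_def])
    finally have bad: "real (card ?bad) \<le> real (n ^ K) / real n ^ c" .
    have "?R - ?bad \<subseteq> ?R \<inter> ?g -` ?X"
    proof
      fix x assume "x \<in> ?R - ?bad"
      then have x: "x < n ^ K" "well_spread q (digit x ` {..<K})" by auto
      have "?g x \<in> ?X" unfolding mem_Collect_eq case_prod_conv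
        by (rule good_output_approx[OF F(3)[OF x(1)] x(2)])
      then show "x \<in> ?R \<inter> ?g -` ?X" using x(1) by simp
    qed
    then have "card (?R - ?bad) \<le> card (?R \<inter> ?g -` ?X)" by (intro card_mono) auto
    moreover have "card (?R - ?bad) = n ^ K - card ?bad"
      by (subst card_Diff_subset) auto
    ultimately have "real (n ^ K) - real (card ?bad) \<le> real (card (?R \<inter> ?g -` ?X))" by linarith
    then have "real (n ^ K) * (1 - 1 / real n ^ c) \<le> real (card (?R \<inter> ?g -` ?X))"
      using bad by (simp add: right_diff_distrib)
    then have "1 - 1 / real n ^ c \<le> real (card (?R \<inter> ?g -` ?X)) / real (card ?R)"
      using pos by (simp add: pos_le_divide_eq mult.commute)
    also have "\<dots> = measure_pmf.prob (pmf_of_set ?R) (?g -` ?X)"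
      using fin by (simp add: measure_pmf_of_set)
    also have "\<dots> = measure_pmf.prob p ?X" by (simp add: p_def)
    finally show ?thesis .
  qed
  ultimately show ?thesis by blast
qed

lemmas program_correct_complement = program_correct[unfolded T_def]

end

theorem theorem13:
  shows "\<exists>(P :: com) (k :: nat). \<forall>c :: nat. \<exists>C :: real.
    \<forall>(G :: nat pair_pre_digraph) (S :: nat set) (T :: nat set) off adj.
      pair_graph G \<and> pverts G = {0..<num_verts G} \<and> adjacency_lists G off adj \<and>
      S \<subseteq> pverts G \<and> T = pverts G - S \<and> S \<noteq> {} \<and> T \<noteq> {} \<longrightarrow>
      (\<exists>p. halts_with P (input_store c G S off adj) p \<and>
        (\<forall>(s, t) \<in> set_pmf p. real t \<le> time_bound C k G) \<and>
        measure_pmf.prob p {(s, t).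
            ST_radius G S T \<le> estimate s \<and>
            estimate s \<le> ereal (5/3) * ST_radius G S T + ereal (5/3) \<and>
            ((\<exists>j :: nat. ST_radius G S T = ereal (real (3 * j))) \<longrightarrow>
              estimate s \<le> ereal (5/3) * ST_radius G S T + 1)}
          \<ge> 1 - 1 / real (num_verts G) ^ c)"
  by (rule exI, rule exI, rule allI, rule exI, (rule allI)+, rule impI, elim conjE, hypsubst,
      rule bichromatic_instance.program_correct_complement,
      intro bichromatic_instance.intro bichromatic_graph.intro bichromatic_instance_axioms.intro)

end
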